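(* Let $n\ge 1$ and let $Y=Y(\mathfrak{sl}_{n+1})$ be the Yangian. For every $1\le i\le n$, the Theta series $\Theta_i(z)$ is $$\Theta_i(z)=\exp\Big(\sum_{1\le j\le i<k\le n+1}E_{kj}\otimes E_{jk}\Big),$$ and the coproduct of the S-series $S_i(z)$ is $$\Delta(S_i(z))=(1\otimes S_i(z))\,\exp\Big(-\sum_{1\le j\le i<k\le n+1}E_{kj}\otimes E_{jk}\,z^{-1}\Big)\,(S_i(z)\otimes 1).$$ Here $E_{jk}$ are the elementary matrices of $\mathfrak{sl}_{n+1}\subset Y(\mathfrak{sl}_{n+1})$.
   Context: Let $I=\{1,\dots,n\}$, $(c_{ij})$ the Cartan matrix of type $A_n$, $\alpha_i$ the simple roots, $Q=\bigoplus_i\mathbb Z\alpha_i$, $Q_+=\sum_i\mathbb N\alpha_i$ with $\mathbb N=\mathbb Z_{\ge0}$, and $\omega_i^\vee$ the fundamental coweights, so $\langle\omega_i^\vee,\beta\rangle$ is the coefficient of $\alpha_i$ in $\beta\in Q$. **Yangian.** $Y$ is the associative $\mathbb C$-algebra generated by $x^\pm_{i,m},\xi_{i,m}$ ($i\in I$, $m\in\mathbb N$) with relations $[\xi_{i,p},\xi_{j,m}]=0$; $[x^+_{i,p},x^-_{j,m}]=\delta_{ij}\xi_{i,p+m}$; $[\xi_{i,m+1},x^\pm_{j,p}]-[\xi_{i,m},x^\pm_{j,p+1}]=\pm\frac12c_{ij}(\xi_{i,m}x^\pm_{j,p}+x^\pm_{j,p}\xi_{i,m})$ and $[\xi_{i,0},x^\pm_{j,p}]=\pm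 c_{ij}x^\pm_{j,p}$; $[x^\pm_{i,m+1},x^\pm_{j,p}]-[x^\pm_{i,m},x^\pm_{j,p+1}]=\pm\frac12c_{ij}(x^\pm_{i,m}x^\pm_{j,p}+x^\pm_{j,p}x^\pm_{i,m})$; $\mathrm{ad}_{x^\pm_{i,0}}^{1-c_{ij}}(x^\pm_{j,0})=0$ for $i\ne j$. It is $Q$-graded by $\mathrm{wt}(x^\pm_{i,m})=\pm\alpha_i$, $\mathrm{wt}(\xi_{i,m})=0$; $Y_\beta$ is the component of weight $\beta$. $Y^0$ is the commutative subalgebra generated by all $\xi_{i,p}$, and $\xi_i(z)=1+\sum_{m\ge0}\xi_{i,m}z^{-m-1}$. $\mathfrak{sl}_{n+1}$ embeds in $Y$ by $E_{i,i+1}\mapsto x^+_{i,0}$, $E_{i+1,i}\mapsto x^-_{i,0}$, $E_{ii}-E_{i+1,i+1}\mapsto\xi_{i,0}$; for $j\ne k$, $E_{jk}\in Y$ denotes the image of the elementary matrix. **Coproduct.** $\Delta:Y\to Y\otimes Y$ is Drinfeld's coproduct (transported from the J-presentation, where $\Delta(x)=x\otimes1+1\otimes x$ and $\Delta(J(x))=J(x)\otimes1+1\otimes J(x)+\frac12[x\otimes1,\Omega]$ for $x\in\mathfrak{sl}_{n+1}$, $\Omega$ being the Casimir tensor). Explicitly it is the algebra homomorphism with $\Delta(x)=x\otimes1+1\otimes x$ for $x\in\mathfrak{sl}_{n+1}$ and $$\Delta(x^+_{i,1})=x^+_{i,1}\otimes1+1\otimes x^+_{i,1}+\xi_{i,0}\otimes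 x^+_{i,0}+\sum_{j=1}^{i-1}E_{ij}\otimes E_{j,i+1}-\sum_{k=i+2}^{n+1}E_{k,i+1}\otimes E_{ik}.$$ It is extended coefficientwise to power series. **S-series.** The GKLO-series $A_i(z)\in1+z^{-1}Y^0[[z^{-1}]]$ ($i\in I$) are uniquely determined by $$\xi_i(z)=\frac{A_{i-1}(z-\frac12)A_{i+1}(z-\frac12)}{A_i(z)A_i(z-1)},\qquad A_0(z)=A_{n+1}(z)=1.$$ Write $A_i(z)=\exp(\sum_{m\ge0}a_{i,m}z^{-m-1})$. The S-series $S_i(z)$ is the unique element of $1+z^{-1}Y^0[[z^{-1}]]$ with $$S_i(z+1)=S_i(z)\,A_i(z)\,\exp\Big(a_{i,0}\sum_{k>0}\frac{(-z)^{-k}}{k}\Big).$$ **Theta series.** Define $\Omega_i(z)\in1\otimes1+z^{-1}(Y\otimes Y)[[z^{-1}]]$ by $\Delta(S_i(z))=(1\otimes S_i(z))\,\Omega_i(z)\,(S_i(z)\otimes1)$. It decomposes as $\Omega_i(z)=\sum_{\beta\in Q_+}\Omega_{i,\beta}(z)$ with $\Omega_{i,\beta}(z)\in(Y_{-\beta}\otimes Y_\beta)[[z^{-1}]]$. Put $\Theta_{i,\beta}(z)=(-z)^{\langle\omega_i^\vee,\beta\rangle}\Omega_{i,\beta}(z)$ and $$\Theta_i(z)=\sum_{\beta\in Q_+}\Theta_{i,\beta}(z)\in\prod_{\beta\in Q_+}(Y_{-\beta}\otimes Y_\beta)((z^{-1})).$$ The exponential $\exp(\sum E_{kj}\otimes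 E_{jk})$ is taken in this product (each weight component is a finite sum). *)

theory Defs
  imports
    Complex_Main
    "HOL-Library.Cardinality"
    "HOL-Library.Poly_Mapping"
    "HOL-Computational_Algebra.Formal_Laurent_Series"
begin

section \<open>Complex associative algebras\<close>

class complex_algebra_1 = ring_1 +
  fixes scaleC :: "complex \<Rightarrow> 'a \<Rightarrow> 'a"  (infixr "*\<^sub>C" 75)
  assumes scaleC_add_right: "c *\<^sub>C (x + y) = c *\<^sub>C x + c *\<^sub>C y"
    and scaleC_add_left: "(c + d) *\<^sub>C x = c *\<^sub>C x + d *\<^sub>C x"
    and scaleC_scaleC: "c *\<^sub>C (d *\<^sub>C x) = (c * d) *\<^sub>C x"
    and scaleC_one: "1 *\<^sub>C x = x"
    and mult_scaleC_left: "(c *\<^sub>C x) * y = c *\<^sub>C (x * y)"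
    and mult_scaleC_right: "x * (c *\<^sub>C y) = c *\<^sub>C (x * y)"

global_interpretation cvs: vector_space "scaleC :: complex \<Rightarrow> 'a \<Rightarrow> 'a::complex_algebra_1"
  by unfold_locales (simp_all add: scaleC_add_right scaleC_add_left scaleC_scaleC scaleC_one)

definition algebra_hom :: "('a::complex_algebra_1 \<Rightarrow> 'b::complex_algebra_1) \<Rightarrow> bool" where
  "algebra_hom f \<longleftrightarrow> f 1 = 1 \<and> (\<forall>x y. f (x + y) = f x + f y) \<and> (\<forall>x y. f (x * y) = f x * f y)
     \<and> (\<forall>c x. f (c *\<^sub>C x) = c *\<^sub>C f x)"

inductive_set subalgebra_gen :: "'a::complex_algebra_1 set \<Rightarrow> 'a set" for G where
  one: "1 \<in> subalgebra_gen G"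
| gen: "g \<in> G \<Longrightarrow> g \<in> subalgebra_gen G"
| add: "x \<in> subalgebra_gen G \<Longrightarrow> y \<in> subalgebra_gen G \<Longrightarrow> x + y \<in> subalgebra_gen G"
| mult: "x \<in> subalgebra_gen G \<Longrightarrow> y \<in> subalgebra_gen G \<Longrightarrow> x * y \<in> subalgebra_gen G"
| scale: "x \<in> subalgebra_gen G \<Longrightarrow> c *\<^sub>C x \<in> subalgebra_gen G"

definition bracket :: "'a::ring_1 \<Rightarrow> 'a \<Rightarrow> 'a" where
  "bracket x y = x * y - y * x"


section \<open>Two-sided ideals and monoid algebras\<close>

inductive_set two_sided_ideal :: "'a::ring_1 set \<Rightarrow> 'a set" for G where
  zero: "0 \<in> two_sided_ideal G"
| gen: "g \<in> G \<Longrightarrow> a * g * b \<in> two_sided_ideal G"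
| add: "x \<in> two_sided_ideal G \<Longrightarrow> y \<in> two_sided_ideal G \<Longrightarrow> x + y \<in> two_sided_ideal G"

lemma two_sided_ideal_mult_left:
  "x \<in> two_sided_ideal G \<Longrightarrow> c * x \<in> two_sided_ideal G"
proof (induction rule: two_sided_ideal.induct)
  case (gen g a b)
  then show ?case using two_sided_ideal.gen[of g G "c * a" b] by (simp add: mult.assoc)
qed (auto intro: two_sided_ideal.intros simp: distrib_left)

lemma two_sided_ideal_mult_right:
  "x \<in> two_sided_ideal G \<Longrightarrow> x * c \<in> two_sided_ideal G"
proof (induction rule: two_sided_ideal.induct)
  case (gen g a b)
  then show ?case using two_sided_ideal.gen[of g G a "b * c"] by (simp add: mult.assoc)
qed (auto intro: two_sided_ideal.intros simp: distrib_right)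

lemma two_sided_ideal_uminus: "x \<in> two_sided_ideal G \<Longrightarrow> - x \<in> two_sided_ideal G"
  using two_sided_ideal_mult_left[of x G "- 1"] by simp

lemma two_sided_ideal_gen: "g \<in> G \<Longrightarrow> g \<in> two_sided_ideal G"
  using two_sided_ideal.gen[of g G 1 1] by simp

definition ideal_rel :: "'a::ring_1 set \<Rightarrow> 'a \<Rightarrow> 'a \<Rightarrow> bool" where
  "ideal_rel G p q \<longleftrightarrow> p - q \<in> two_sided_ideal G"

lemma equivp_ideal_rel: "equivp (ideal_rel G)"
proof (rule equivpI)
  show "reflp (ideal_rel G)"
    by (simp add: reflp_def ideal_rel_def two_sided_ideal.zero)
  show "symp (ideal_rel G)"
    unfolding symp_def ideal_rel_def using two_sided_ideal_uminus by fastforce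
  show "transp (ideal_rel G)"
    unfolding transp_def ideal_rel_def
  proof (intro allI impI)
    fix x y z assume "x - y \<in> two_sided_ideal G" "y - z \<in> two_sided_ideal G"
    from two_sided_ideal.add[OF this] show "x - z \<in> two_sided_ideal G" by simp
  qed
qed

lemma ideal_rel_add:
  assumes "ideal_rel G p q" "ideal_rel G r s" shows "ideal_rel G (p + r) (q + s)"
  using two_sided_ideal.add[OF assms[unfolded ideal_rel_def]]
  by (simp add: ideal_rel_def algebra_simps)

lemma ideal_rel_uminus: "ideal_rel G p q \<Longrightarrow> ideal_rel G (- p) (- q)"
  unfolding ideal_rel_def using two_sided_ideal_uminus[of "p - q" G] by simp

lemma ideal_rel_diff:
  assumes "ideal_rel G p q" "ideal_rel G r s" shows "ideal_rel G (p - r) (q - s)"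
  using ideal_rel_add[OF assms(1) ideal_rel_uminus[OF assms(2)]] by simp

lemma ideal_rel_mult:
  assumes "ideal_rel G p q" "ideal_rel G r s" shows "ideal_rel G (p * r) (q * s)"
proof -
  have "(p - q) * r + q * (r - s) \<in> two_sided_ideal G"
    using assms unfolding ideal_rel_def
    by (intro two_sided_ideal.add two_sided_ideal_mult_left two_sided_ideal_mult_right)
  then show ?thesis by (simp add: ideal_rel_def algebra_simps)
qed

text \<open>
  For a monoid \<open>M\<close> written additively, \<open>M \<Rightarrow>\<^sub>0 complex\<close> with its convolution product is the
  monoid algebra; \<open>scalar c\<close> is \<open>c\<close> times its unit.
\<close>

abbreviation scalar :: "complex \<Rightarrow> ('m::monoid_add \<Rightarrow>\<^sub>0 complex)" where
  "scalar c \<equiv> Poly_Mapping.single 0 c"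

abbreviation mon :: "'m::monoid_add \<Rightarrow> ('m \<Rightarrow>\<^sub>0 complex)" where
  "mon w \<equiv> Poly_Mapping.single w 1"

lemma monoid_algebra_induct [case_names single add]:
  fixes p :: "'m::monoid_add \<Rightarrow>\<^sub>0 complex"
  assumes "\<And>w c. P (Poly_Mapping.single w c)" "\<And>p q. P p \<Longrightarrow> P q \<Longrightarrow> P (p + q)"
  shows "P p"
proof (induction p rule: Poly_Mapping.update_induct)
  case const
  show ?case using assms(1)[of 0 0] by simp
next
  case (update f a b)
  have "Poly_Mapping.update a b f = f + Poly_Mapping.single a b"
    using update(1) by (intro poly_mapping_eqI)
      (auto simp: lookup_update lookup_add lookup_single in_keys_iff when_def)
  then show ?case using assms update by simp
qed

lemma scalar_central: "scalar c * p = p * scalar c"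
  by (induction p rule: monoid_algebra_induct) (simp_all add: mult_single distrib_left distrib_right mult.commute)

definition lin_ext :: "('m \<Rightarrow> complex) \<Rightarrow> ('m \<Rightarrow>\<^sub>0 complex) \<Rightarrow> complex" where
  "lin_ext h p = (\<Sum>k\<in>Poly_Mapping.keys p. Poly_Mapping.lookup p k * h k)"

lemma lin_ext_superset:
  assumes "finite K" "Poly_Mapping.keys p \<subseteq> K"
  shows "lin_ext h p = (\<Sum>k\<in>K. Poly_Mapping.lookup p k * h k)"
  unfolding lin_ext_def
  using assms by (intro sum.mono_neutral_left) (auto simp: in_keys_iff)

lemma lin_ext_add: "lin_ext h (p + q) = lin_ext h p + lin_ext h q"
proof -
  let ?K = "Poly_Mapping.keys p \<union> Poly_Mapping.keys q"
  have "Poly_Mapping.keys (p + q) \<subseteq> ?K" by (rule Poly_Mapping.keys_add)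
  then show ?thesis
    by (simp add: lin_ext_superset[of ?K] lookup_add distrib_right sum.distrib)
qed

lemma lin_ext_single: "lin_ext h (Poly_Mapping.single w c) = c * h w"
  by (simp add: lin_ext_def)

lemma lin_ext_zero: "lin_ext h 0 = 0"
  by (simp add: lin_ext_def)

lemma lin_ext_uminus: "lin_ext h (- p) = - lin_ext h p"
  using lin_ext_add[of h p "- p"] by (simp add: lin_ext_zero add_eq_0_iff)

lemma lin_ext_diff: "lin_ext h (p - q) = lin_ext h p - lin_ext h q"
  using lin_ext_add[of h p "- q"] by (simp add: lin_ext_uminus)

lemma lin_ext_mult:
  assumes "\<And>v w. h (v + w) = h v * h w"
  shows "lin_ext h (p * q) = lin_ext h p * lin_ext h q"
proof (induction p rule: monoid_algebra_induct)
  case (single v c)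
  show ?case
    by (induction q rule: monoid_algebra_induct)
      (simp_all add: mult_single lin_ext_single lin_ext_add distrib_left assms)
qed (simp add: lin_ext_add distrib_right)


section \<open>Tensor product of algebras\<close>

text \<open>
  \<open>A \<otimes> B\<close> is the free vector space on \<open>A \<times> B\<close> modulo the bilinearity relations.  The free
  vector space is made into an algebra as the monoid algebra of the multiplicative monoid
  \<open>A \<times> B\<close> (written additively, as required by the type of monoid algebras); the subspace
  spanned by the bilinearity relations is a two-sided ideal of it.
\<close>

datatype ('a, 'b) mpair = MPair 'a 'b

instantiation mpair :: (monoid_mult, monoid_mult) monoid_add
begin

definition "0 = MPair 1 1"

fun plus_mpair :: "('a, 'b) mpair \<Rightarrow> ('a, 'b) mpair \<Rightarrow> ('a, 'b) mpair" where
  "MPair a b + MPair a' b' = MPair (a * a') (b * b')"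

instance
proof
  fix x y z :: "('a, 'b) mpair"
  show "x + y + z = x + (y + z)"
    by (cases x; cases y; cases z) (simp add: mult.assoc)
  show "0 + x = x" "x + 0 = x"
    by (cases x; simp add: zero_mpair_def)+
qed

end

definition bilinear_relations ::
  "(('a::complex_algebra_1, 'b::complex_algebra_1) mpair \<Rightarrow>\<^sub>0 complex) set" where
  "bilinear_relations =
     {mon (MPair (x + x') y) - mon (MPair x y) - mon (MPair x' y) | x x' y. True} \<union>
     {mon (MPair x (y + y')) - mon (MPair x y) - mon (MPair x y') | x y y'. True} \<union>
     {mon (MPair (c *\<^sub>C x) y) - scalar c * mon (MPair x y) | c x y. True} \<union>
     {mon (MPair x (c *\<^sub>C y)) - scalar c * mon (MPair x y) | c x y. True}"

quotient_type (overloaded) ('a, 'b) tensor =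
  "('a::complex_algebra_1, 'b::complex_algebra_1) mpair \<Rightarrow>\<^sub>0 complex" / "ideal_rel bilinear_relations"
  by (rule equivp_ideal_rel)

lemma exists_unital_functional:
  "\<exists>f :: 'a::complex_algebra_1 \<Rightarrow> complex. f 1 = 1 \<and> (\<forall>x y. f (x + y) = f x + f y)
     \<and> (\<forall>c x. f (c *\<^sub>C x) = c * f x)"
proof -
  interpret vp: vector_space_pair "scaleC :: complex \<Rightarrow> 'a \<Rightarrow> 'a" "(*) :: complex \<Rightarrow> complex \<Rightarrow> complex"
    by unfold_locales (simp_all add: algebra_simps)
  have "cvs.independent {1 :: 'a}" by simp
  from vp.linear_independent_extend[OF this, of "\<lambda>_. 1"]
  obtain f where f: "Vector_Spaces.linear scaleC (*) f" and f1: "f (1 :: 'a) = 1" by auto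
  interpret f: Vector_Spaces.linear "scaleC :: complex \<Rightarrow> 'a \<Rightarrow> 'a" "(*)" f by (rule f)
  show ?thesis using f1 f.add f.scale by blast
qed

lemma tensor_nontrivial:
  "\<not> ideal_rel bilinear_relations
     (0 :: ('a::complex_algebra_1, 'b::complex_algebra_1) mpair \<Rightarrow>\<^sub>0 complex) 1"
proof
  obtain f :: "'a \<Rightarrow> complex" where f: "f 1 = 1" "\<And>x y. f (x + y) = f x + f y"
    "\<And>c x. f (c *\<^sub>C x) = c * f x" using exists_unital_functional[where 'a='a] by blast
  obtain g :: "'b \<Rightarrow> complex" where g: "g 1 = 1" "\<And>x y. g (x + y) = g x + g y"
    "\<And>c x. g (c *\<^sub>C x) = c * g x" using exists_unital_functional[where 'a='b] by blast
  define h where "h = (\<lambda>k :: ('a, 'b) mpair. case k of MPair x y \<Rightarrow> f x * g y)"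
  have single: "lin_ext h (Poly_Mapping.single v c * r * Poly_Mapping.single w d) = 0"
    if "r \<in> bilinear_relations" for r v w c d
  proof -
    obtain a b where v: "v = MPair a b" by (cases v)
    obtain a' b' where w: "w = MPair a' b'" by (cases w)
    show ?thesis
      using that unfolding bilinear_relations_def
      by (auto simp: left_diff_distrib right_diff_distrib mult_single lin_ext_diff lin_ext_single v w
          h_def zero_mpair_def f g distrib_left distrib_right mult_scaleC_left mult_scaleC_right)
  qed
  have left: "lin_ext h (Poly_Mapping.single v c * r * q) = 0"
    if "r \<in> bilinear_relations" for r v c q
    by (induction q rule: monoid_algebra_induct)
      (simp_all add: single[OF that] distrib_left lin_ext_add)
  have gen: "lin_ext h (p * r * q) = 0" if "r \<in> bilinear_relations" for p r q
    by (induction p rule: monoid_algebra_induct)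
      (simp_all add: left[OF that] distrib_right lin_ext_add)
  have ideal: "lin_ext h x = 0" if "x \<in> two_sided_ideal bilinear_relations" for x
    using that
    by (induction rule: two_sided_ideal.induct)
      (simp_all add: lin_ext_zero lin_ext_add gen)
  have one: "lin_ext h 1 = 1"
    unfolding single_one[symmetric] lin_ext_single by (simp add: h_def zero_mpair_def f g)
  assume "ideal_rel bilinear_relations (0 :: ('a, 'b) mpair \<Rightarrow>\<^sub>0 complex) 1"
  then have "lin_ext h (0 - 1) = 0" using ideal unfolding ideal_rel_def by blast
  then show False using one unfolding lin_ext_diff lin_ext_zero by simp
qed

instantiation tensor :: (complex_algebra_1, complex_algebra_1) complex_algebra_1
begin

lift_definition zero_tensor :: "('a, 'b) tensor" is 0 .
lift_definition one_tensor :: "('a, 'b) tensor" is 1 .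
lift_definition plus_tensor :: "('a, 'b) tensor \<Rightarrow> ('a, 'b) tensor \<Rightarrow> ('a, 'b) tensor" is "(+)"
  by (rule ideal_rel_add)
lift_definition minus_tensor :: "('a, 'b) tensor \<Rightarrow> ('a, 'b) tensor \<Rightarrow> ('a, 'b) tensor" is "(-)"
  by (rule ideal_rel_diff)
lift_definition uminus_tensor :: "('a, 'b) tensor \<Rightarrow> ('a, 'b) tensor" is uminus
  by (rule ideal_rel_uminus)
lift_definition times_tensor :: "('a, 'b) tensor \<Rightarrow> ('a, 'b) tensor \<Rightarrow> ('a, 'b) tensor" is "(*)"
  by (rule ideal_rel_mult)
lift_definition scaleC_tensor :: "complex \<Rightarrow> ('a, 'b) tensor \<Rightarrow> ('a, 'b) tensor"
  is "\<lambda>c p. scalar c * p"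
  by (intro ideal_rel_mult equivp_reflp[OF equivp_ideal_rel])

instance
proof
  fix x y z :: "('a, 'b) tensor" and c d :: complex
  note r = equivp_reflp[OF equivp_ideal_rel]
  have eq: "p = q \<Longrightarrow> ideal_rel bilinear_relations p q"
    for p q :: "('a, 'b) mpair \<Rightarrow>\<^sub>0 complex" using r by simp
  show "x + y + z = x + (y + z)" by transfer (rule eq, simp)
  show "x + y = y + x" by transfer (rule eq, simp)
  show "0 + x = x" by transfer (rule eq, simp)
  show "- x + x = 0" by transfer (rule eq, simp)
  show "x - y = x + - y" by transfer (rule eq, simp)
  show "x * y * z = x * (y * z)" by transfer (rule eq, simp add: mult.assoc)
  show "1 * x = x" by transfer (rule eq, simp)
  show "x * 1 = x" by transfer (rule eq, simp)
  show "(x + y) * z = x * z + y * z" by transfer (rule eq, simp add: distrib_right)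
  show "x * (y + z) = x * y + x * z" by transfer (rule eq, simp add: distrib_left)
  show "(0 :: ('a, 'b) tensor) \<noteq> 1" by transfer (rule tensor_nontrivial)
  show "c *\<^sub>C (x + y) = c *\<^sub>C x + c *\<^sub>C y" by transfer (rule eq, simp add: distrib_left)
  show "(c + d) *\<^sub>C x = c *\<^sub>C x + d *\<^sub>C x"
    by transfer (rule eq, simp add: single_add distrib_right)
  show "c *\<^sub>C (d *\<^sub>C x) = (c * d) *\<^sub>C x"
    by transfer (rule eq, simp add: mult.assoc[symmetric] mult_single)
  show "1 *\<^sub>C x = x" by transfer (rule eq, simp)
  show "(c *\<^sub>C x) * y = c *\<^sub>C (x * y)" by transfer (rule eq, simp add: mult.assoc)
  show "x * (c *\<^sub>C y) = c *\<^sub>C (x * y)"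
    by transfer (rule eq, metis mult.assoc scalar_central)
qed

end

lift_definition pure_tensor ::
  "'a::complex_algebra_1 \<Rightarrow> 'b::complex_algebra_1 \<Rightarrow> ('a, 'b) tensor"  (infixl "\<otimes>" 75)
  is "\<lambda>x y. mon (MPair x y)" .


section \<open>The Yangian\<close>

text \<open>
  The rank \<open>n\<close> is \<open>CARD('n)\<close>, where \<open>'n\<close> is an arbitrary finite type; \<open>'n node\<close> is the set
  \<open>I = {1, \<dots>, n}\<close> as a type.
\<close>

typedef ('n::finite) node = "{1..CARD('n)}"
  morphisms label node
  using finite_UNIV_card_ge_0[where 'a='n] by (intro exI[of _ 1]) auto

datatype pm = Plus | Minus

primrec pm_sgn :: "pm \<Rightarrow> complex" where
  "pm_sgn Plus = 1"
| "pm_sgn Minus = - 1"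

datatype ('n::finite) gen = GX pm "'n node" nat | GXi "'n node" nat

definition cartan :: "nat \<Rightarrow> nat \<Rightarrow> int" where
  "cartan i j = (if i = j then 2 else if i = j + 1 \<or> j = i + 1 then - 1 else 0)"

text \<open>The free monoid, written additively.\<close>

datatype 'g word = Word "'g list"

instantiation word :: (type) monoid_add
begin

definition "0 = Word []"

fun plus_word :: "'a word \<Rightarrow> 'a word \<Rightarrow> 'a word" where
  "Word u + Word v = Word (u @ v)"

instance
proof
  fix x y z :: "'a word"
  show "x + y + z = x + (y + z)" by (cases x; cases y; cases z) simp
  show "0 + x = x" "x + 0 = x" by (cases x; simp add: zero_word_def)+
qed

end

type_synonym 'g free_algebra = "'g word \<Rightarrow>\<^sub>0 complex"

definition free_x :: "pm \<Rightarrow> 'n::finite node \<Rightarrow> nat \<Rightarrow> 'n gen free_algebra" where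
  "free_x s i m = mon (Word [GX s i m])"

definition free_xi :: "'n::finite node \<Rightarrow> nat \<Rightarrow> 'n gen free_algebra" where
  "free_xi i m = mon (Word [GXi i m])"

abbreviation node_cartan :: "'n::finite node \<Rightarrow> 'n node \<Rightarrow> int" where
  "node_cartan i j \<equiv> cartan (label i) (label j)"

definition yangian_relations :: "'n::finite gen free_algebra set" where
  "yangian_relations =
     {bracket (free_xi i p) (free_xi j m) | i j p m. True} \<union>
     {bracket (free_x Plus i p) (free_x Minus j m) - (if i = j then free_xi i (p + m) else 0)
        | i j p m. True} \<union>
     {bracket (free_xi i (m + 1)) (free_x s j p) - bracket (free_xi i m) (free_x s j (p + 1))
        - scalar (pm_sgn s * of_int (node_cartan i j) / 2)
            * (free_xi i m * free_x s j p + free_x s j p * free_xi i m)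
        | s i j p m. True} \<union>
     {bracket (free_xi i 0) (free_x s j p)
        - scalar (pm_sgn s * of_int (node_cartan i j)) * free_x s j p
        | s i j p. True} \<union>
     {bracket (free_x s i (m + 1)) (free_x s j p) - bracket (free_x s i m) (free_x s j (p + 1))
        - scalar (pm_sgn s * of_int (node_cartan i j) / 2)
            * (free_x s i m * free_x s j p + free_x s j p * free_x s i m)
        | s i j p m. True} \<union>
     {(bracket (free_x s i 0) ^^ nat (1 - node_cartan i j)) (free_x s j 0) | s i j. i \<noteq> j}"

quotient_type (overloaded) 'n yangian =
  "'n::finite gen free_algebra" / "ideal_rel yangian_relations"
  by (rule equivp_ideal_rel)

lemma yangian_nontrivial:
  "\<not> ideal_rel yangian_relations (0 :: 'n::finite gen free_algebra) 1"
proof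
  define h where "h = (\<lambda>w :: 'n gen word. if w = 0 then 1 else 0 :: complex)"
  have h: "h (v + w) = h v * h w" for v w
    by (cases v; cases w) (auto simp: h_def zero_word_def)
  note mult = lin_ext_mult[of h, OF h]
  have x: "lin_ext h (free_x s i m) = 0" and xi: "lin_ext h (free_xi i m) = 0" for s i m
    by (simp_all add: free_x_def free_xi_def lin_ext_single h_def zero_word_def)
  have br: "lin_ext h (bracket p q) = 0" for p q
    by (simp add: bracket_def lin_ext_diff mult)
  have ad: "lin_ext h ((bracket p ^^ k) q) = 0" if "lin_ext h q = 0" for p q k
    using that by (cases k) (simp_all add: br)
  have rel: "lin_ext h r = 0" if "r \<in> yangian_relations" for r
    using that unfolding yangian_relations_def
    by (auto simp: lin_ext_diff lin_ext_add lin_ext_zero mult x xi br ad)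
  have ideal: "lin_ext h x = 0" if "x \<in> two_sided_ideal yangian_relations" for x
    using that
    by (induction rule: two_sided_ideal.induct) (simp_all add: lin_ext_zero lin_ext_add mult rel)
  have one: "lin_ext h 1 = 1"
    unfolding single_one[symmetric] lin_ext_single by (simp add: h_def)
  assume "ideal_rel yangian_relations (0 :: 'n::finite gen free_algebra) 1"
  then have "lin_ext h (0 - 1) = 0" using ideal unfolding ideal_rel_def by blast
  then show False using one unfolding lin_ext_diff lin_ext_zero by simp
qed

instantiation yangian :: (finite) complex_algebra_1
begin

lift_definition zero_yangian :: "'a yangian" is 0 .
lift_definition one_yangian :: "'a yangian" is 1 .
lift_definition plus_yangian :: "'a yangian \<Rightarrow> 'a yangian \<Rightarrow> 'a yangian" is "(+)"
  by (rule ideal_rel_add)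
lift_definition minus_yangian :: "'a yangian \<Rightarrow> 'a yangian \<Rightarrow> 'a yangian" is "(-)"
  by (rule ideal_rel_diff)
lift_definition uminus_yangian :: "'a yangian \<Rightarrow> 'a yangian" is uminus
  by (rule ideal_rel_uminus)
lift_definition times_yangian :: "'a yangian \<Rightarrow> 'a yangian \<Rightarrow> 'a yangian" is "(*)"
  by (rule ideal_rel_mult)
lift_definition scaleC_yangian :: "complex \<Rightarrow> 'a yangian \<Rightarrow> 'a yangian"
  is "\<lambda>c p. scalar c * p"
  by (intro ideal_rel_mult equivp_reflp[OF equivp_ideal_rel])

instance
proof
  fix x y z :: "'a yangian" and c d :: complex
  note r = equivp_reflp[OF equivp_ideal_rel]
  have eq: "p = q \<Longrightarrow> ideal_rel yangian_relations p q"
    for p q :: "'a gen free_algebra" using r by simp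
  show "x + y + z = x + (y + z)" by transfer (rule eq, simp)
  show "x + y = y + x" by transfer (rule eq, simp)
  show "0 + x = x" by transfer (rule eq, simp)
  show "- x + x = 0" by transfer (rule eq, simp)
  show "x - y = x + - y" by transfer (rule eq, simp)
  show "x * y * z = x * (y * z)" by transfer (rule eq, simp add: mult.assoc)
  show "1 * x = x" by transfer (rule eq, simp)
  show "x * 1 = x" by transfer (rule eq, simp)
  show "(x + y) * z = x * z + y * z" by transfer (rule eq, simp add: distrib_right)
  show "x * (y + z) = x * y + x * z" by transfer (rule eq, simp add: distrib_left)
  show "(0 :: 'a yangian) \<noteq> 1" by transfer (rule yangian_nontrivial)
  show "c *\<^sub>C (x + y) = c *\<^sub>C x + c *\<^sub>C y" by transfer (rule eq, simp add: distrib_left)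
  show "(c + d) *\<^sub>C x = c *\<^sub>C x + d *\<^sub>C x"
    by transfer (rule eq, simp add: single_add distrib_right)
  show "c *\<^sub>C (d *\<^sub>C x) = (c * d) *\<^sub>C x"
    by transfer (rule eq, simp add: mult.assoc[symmetric] mult_single)
  show "1 *\<^sub>C x = x" by transfer (rule eq, simp)
  show "(c *\<^sub>C x) * y = c *\<^sub>C (x * y)" by transfer (rule eq, simp add: mult.assoc)
  show "x * (c *\<^sub>C y) = c *\<^sub>C (x * y)"
    by transfer (rule eq, metis mult.assoc scalar_central)
qed

end

type_synonym 'n yangian2 = "('n yangian, 'n yangian) tensor"

text \<open>The generators, indexed by natural numbers \<open>i \<in> {1..CARD('n)}\<close>.\<close>

definition x_gen :: "pm \<Rightarrow> nat \<Rightarrow> nat \<Rightarrow> 'n::finite yangian" where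
  "x_gen s i m = abs_yangian (free_x s (node i) m)"

definition xi_gen :: "nat \<Rightarrow> nat \<Rightarrow> 'n::finite yangian" where
  "xi_gen i m = abs_yangian (free_xi (node i) m)"

definition Y_zero :: "'n::finite yangian set" where
  "Y_zero = subalgebra_gen {xi_gen i p | i p. i \<in> {1..CARD('n)}}"


section \<open>The root lattice grading\<close>

text \<open>
  \<open>Q\<close> is realised as the functions \<open>nat \<Rightarrow>\<^sub>0 int\<close> supported on \<open>{1..n}\<close>; the value at \<open>i\<close> is the
  coefficient of \<open>\<alpha>\<^sub>i\<close>.
\<close>

type_synonym weight = "nat \<Rightarrow>\<^sub>0 int"

abbreviation simple_root :: "nat \<Rightarrow> weight" where
  "simple_root i \<equiv> Poly_Mapping.single i 1"

abbreviation coweight_pairing :: "nat \<Rightarrow> weight \<Rightarrow> int" where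
  "coweight_pairing i \<beta> \<equiv> Poly_Mapping.lookup \<beta> i"

definition Q_plus :: "nat \<Rightarrow> weight set" where
  "Q_plus n = {\<beta>. Poly_Mapping.keys \<beta> \<subseteq> {1..n} \<and> (\<forall>i. 0 \<le> coweight_pairing i \<beta>)}"

primrec gen_wt :: "'n::finite gen \<Rightarrow> weight" where
  "gen_wt (GX s i m) = (if s = Plus then simple_root (label i) else - simple_root (label i))"
| "gen_wt (GXi i m) = 0"

primrec word_wt :: "'n::finite gen word \<Rightarrow> weight" where
  "word_wt (Word gs) = sum_list (map gen_wt gs)"

definition Y_wt :: "weight \<Rightarrow> 'n::finite yangian set" where
  "Y_wt \<beta> = cvs.span {abs_yangian (mon w) | w. word_wt w = \<beta>}"

definition YY_wt :: "weight \<Rightarrow> weight \<Rightarrow> 'n::finite yangian2 set" where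
  "YY_wt \<beta> \<gamma> = cvs.span {x \<otimes> y | x y. x \<in> Y_wt \<beta> \<and> y \<in> Y_wt \<gamma>}"


section \<open>The embedding of the special linear Lie algebra\<close>

text \<open>Matrices of size \<open>N\<close> are functions vanishing outside \<open>{1..N} \<times> {1..N}\<close>.\<close>

type_synonym cmat = "nat \<Rightarrow> nat \<Rightarrow> complex"

definition sl :: "nat \<Rightarrow> cmat set" where
  "sl N = {M. (\<forall>a b. M a b \<noteq> 0 \<longrightarrow> a \<in> {1..N} \<and> b \<in> {1..N}) \<and> (\<Sum>a=1..N. M a a) = 0}"

definition mat_mult :: "nat \<Rightarrow> cmat \<Rightarrow> cmat \<Rightarrow> cmat" where
  "mat_mult N M M' = (\<lambda>a b. \<Sum>c=1..N. M a c * M' c b)"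

definition elem :: "nat \<Rightarrow> nat \<Rightarrow> cmat" where
  "elem j k = (\<lambda>a b. if a = j \<and> b = k then 1 else 0)"

text \<open>\<open>\<iota>\<close> is the Lie algebra homomorphism extending the given assignment of the Chevalley generators.\<close>

definition sl_embedding :: "(cmat \<Rightarrow> 'n::finite yangian) \<Rightarrow> bool" where
  "sl_embedding \<iota> \<longleftrightarrow>
     (let n = CARD('n); N = n + 1 in
       (\<forall>M\<in>sl N. \<forall>M'\<in>sl N. \<iota> (\<lambda>a b. M a b + M' a b) = \<iota> M + \<iota> M') \<and>
       (\<forall>c. \<forall>M\<in>sl N. \<iota> (\<lambda>a b. c * M a b) = c *\<^sub>C \<iota> M) \<and>
       (\<forall>M\<in>sl N. \<forall>M'\<in>sl N.
          \<iota> (\<lambda>a b. mat_mult N M M' a b - mat_mult N M' M a b) = bracket (\<iota> M) (\<iota> M')) \<and>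
       (\<forall>i\<in>{1..n}. \<iota> (elem i (i + 1)) = x_gen Plus i 0 \<and>
          \<iota> (elem (i + 1) i) = x_gen Minus i 0 \<and>
          \<iota> (\<lambda>a b. elem i i a b - elem (i + 1) (i + 1) a b) = xi_gen i 0))"


section \<open>The coproduct\<close>

text \<open>
  \<open>Y\<close> is generated by the image of \<open>\<iota>\<close> and the \<open>x\<^sup>+\<^sub>i\<^sub>,\<^sub>1\<close>, so these values determine \<open>\<Delta>\<close>.
\<close>

definition yangian_coproduct ::
  "(cmat \<Rightarrow> 'n::finite yangian) \<Rightarrow> ('n yangian \<Rightarrow> 'n yangian2) \<Rightarrow> bool" where
  "yangian_coproduct \<iota> \<Delta> \<longleftrightarrow>
     (let n = CARD('n); E = (\<lambda>j k. \<iota> (elem j k)) in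
       algebra_hom \<Delta> \<and>
       (\<forall>x\<in>sl (n + 1). \<Delta> (\<iota> x) = \<iota> x \<otimes> 1 + 1 \<otimes> \<iota> x) \<and>
       (\<forall>i\<in>{1..n}. \<Delta> (x_gen Plus i 1) =
          x_gen Plus i 1 \<otimes> 1 + 1 \<otimes> x_gen Plus i 1 + xi_gen i 0 \<otimes> x_gen Plus i 0
          + (\<Sum>j\<in>{1..<i}. E i j \<otimes> E j (i + 1))
          - (\<Sum>k\<in>{i+2..n+1}. E k (i + 1) \<otimes> E i k)))"


section \<open>Series in the inverse of z\<close>

text \<open>
  A series in \<open>z\<^sup>-\<^sup>1\<close> is an \<open>fps\<close> (or \<open>fls\<close>) whose variable \<open>X\<close> stands for \<open>z\<^sup>-\<^sup>1\<close>: \<open>F $ m\<close> is the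
  coefficient of \<open>z\<^sup>-\<^sup>m\<close>, and \<open>fls_X_inv\<close> is \<open>z\<close>.
\<close>

definition fps_map :: "('a \<Rightarrow> 'b) \<Rightarrow> 'a fps \<Rightarrow> 'b fps" where
  "fps_map f F = Abs_fps (\<lambda>m. f (F $ m))"

text \<open>
  \<open>z_shift c F\<close> is \<open>F(z + c)\<close>, using
  \<open>(z + c)\<^sup>-\<^sup>k = \<Sum>\<^sub>l (-k choose l) c\<^sup>l z\<^sup>-\<^sup>k\<^sup>-\<^sup>l\<close>.
\<close>

definition z_shift :: "complex \<Rightarrow> 'a::complex_algebra_1 fps \<Rightarrow> 'a fps" where
  "z_shift c F = Abs_fps (\<lambda>m. \<Sum>k\<le>m. (((- of_nat k) gchoose (m - k)) * c ^ (m - k)) *\<^sub>C (F $ k))"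

text \<open>
  The exponential of a series without constant term: only the powers \<open>F ^ k\<close> with \<open>k \<le> m\<close>
  contribute to the coefficient of \<open>z\<^sup>-\<^sup>m\<close>.
\<close>

definition fps_exponential :: "'a::complex_algebra_1 fps \<Rightarrow> 'a fps" where
  "fps_exponential F = Abs_fps (\<lambda>m. \<Sum>k\<le>m. (1 / fact k) *\<^sub>C ((F ^ k) $ m))"


section \<open>GKLO-series and S-series\<close>

definition xi_series :: "nat \<Rightarrow> 'n::finite yangian fps" where
  "xi_series i = 1 + fps_X * Abs_fps (xi_gen i)"

text \<open>The series \<open>A\<^sub>i\<close> are invertible and commute, so the denominators can be cleared.\<close>

definition GKLO_series :: "(nat \<Rightarrow> 'n::finite yangian fps) \<Rightarrow> bool" where
  "GKLO_series A \<longleftrightarrow>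
     A 0 = 1 \<and> A (CARD('n) + 1) = 1 \<and>
     (\<forall>i\<in>{1..CARD('n)}. A i $ 0 = 1 \<and> (\<forall>m. A i $ m \<in> Y_zero) \<and>
        xi_series i * (A i * z_shift (- 1) (A i))
          = z_shift (- 1 / 2) (A (i - 1)) * z_shift (- 1 / 2) (A (i + 1)))"

text \<open>The coefficients \<open>a m\<close> are those of the logarithm of the GKLO-series.\<close>

definition S_series :: "(nat \<Rightarrow> 'n::finite yangian fps) \<Rightarrow> (nat \<Rightarrow> 'n yangian fps) \<Rightarrow> bool" where
  "S_series A S \<longleftrightarrow>
     (\<forall>i\<in>{1..CARD('n)}. S i $ 0 = 1 \<and> (\<forall>m. S i $ m \<in> Y_zero) \<and>
        (\<exists>a. A i = fps_exponential (fps_X * Abs_fps a) \<and>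
           z_shift 1 (S i) = S i * A i * fps_exponential
             (fps_const (a 0) * Abs_fps (\<lambda>k. if k = 0 then 0 else ((- 1) ^ k / of_nat k) *\<^sub>C 1))))"


section \<open>Theta series\<close>

text \<open>
  An element of \<open>\<Prod>\<^sub>\<beta> (Y\<^sub>-\<^sub>\<beta> \<otimes> Y\<^sub>\<beta>)((z\<^sup>-\<^sup>1))\<close>, with \<open>\<beta>\<close> ranging over \<open>Q\<^sub>+\<close>, is the family of its
  components, extended by \<open>0\<close> outside \<open>Q\<^sub>+\<close>.
  In \<open>is_theta_series\<close>, \<open>s\<close> is the series \<open>S\<^sub>i\<close>, \<open>W\<close> is \<open>\<Omega>\<^sub>i\<close> and \<open>F \<beta>\<close> is \<open>\<Omega>\<^sub>i\<^sub>,\<^sub>\<beta>\<close>.  The sum of the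
  \<open>F \<beta>\<close> is taken in each power of \<open>z\<close> separately, where only finitely many terms are nonzero.
\<close>

definition is_theta_series ::
  "('n::finite yangian \<Rightarrow> 'n yangian2) \<Rightarrow> 'n yangian fps \<Rightarrow> nat \<Rightarrow> (weight \<Rightarrow> 'n yangian2 fls) \<Rightarrow> bool"
  where
  "is_theta_series \<Delta> s i \<Theta> \<longleftrightarrow>
     (\<exists>W F. W $ 0 = 1 \<and>
        fps_map \<Delta> s = fps_map (\<lambda>y. 1 \<otimes> y) s * W * fps_map (\<lambda>y. y \<otimes> 1) s \<and>
        (\<forall>\<beta>\<in>Q_plus CARD('n). \<forall>m. F \<beta> $ m \<in> YY_wt (- \<beta>) \<beta>) \<and>
        (\<forall>\<beta>. \<beta> \<notin> Q_plus CARD('n) \<longrightarrow> F \<beta> = 0) \<and>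
        (\<forall>m. finite {\<beta>. F \<beta> $ m \<noteq> 0} \<and> W $ m = Sum_any (\<lambda>\<beta>. F \<beta> $ m)) \<and>
        \<Theta> = (\<lambda>\<beta>. (- fls_X_inv) ^ nat (coweight_pairing i \<beta>) * fps_to_fls (F \<beta>)))"

definition theta_series ::
  "('n::finite yangian \<Rightarrow> 'n yangian2) \<Rightarrow> 'n yangian fps \<Rightarrow> nat \<Rightarrow> (weight \<Rightarrow> 'n yangian2 fls)" where
  "theta_series \<Delta> s i = (THE \<Theta>. is_theta_series \<Delta> s i \<Theta>)"

text \<open>
  Product, powers and exponential in the product over \<open>Q\<^sub>+\<close>.  If the component of weight \<open>0\<close>
  vanishes, each component of the exponential is a finite sum.
\<close>

definition graded_mult ::
  "nat \<Rightarrow> (weight \<Rightarrow> 'a::ring_1) \<Rightarrow> (weight \<Rightarrow> 'a) \<Rightarrow> (weight \<Rightarrow> 'a)" where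
  "graded_mult n F G = (\<lambda>\<beta>. \<Sum>(\<gamma>, \<delta>) | \<gamma> \<in> Q_plus n \<and> \<delta> \<in> Q_plus n \<and> \<gamma> + \<delta> = \<beta>. F \<gamma> * G \<delta>)"

primrec graded_pow :: "nat \<Rightarrow> (weight \<Rightarrow> 'a::ring_1) \<Rightarrow> nat \<Rightarrow> (weight \<Rightarrow> 'a)" where
  "graded_pow n F 0 = (\<lambda>\<beta>. if \<beta> = 0 then 1 else 0)"
| "graded_pow n F (Suc m) = graded_mult n F (graded_pow n F m)"

definition graded_exp :: "nat \<Rightarrow> (weight \<Rightarrow> 'a::complex_algebra_1) \<Rightarrow> (weight \<Rightarrow> 'a)" where
  "graded_exp n F = (\<lambda>\<beta>. Sum_any (\<lambda>m. (1 / fact m) *\<^sub>C graded_pow n F m \<beta>))"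

text \<open>
  The element \<open>\<Sum>\<^sub>j\<^sub>\<le>\<^sub>i\<^sub><\<^sub>k E\<^sub>k\<^sub>j \<otimes> E\<^sub>j\<^sub>k\<close> of \<open>Y \<otimes> Y\<close>, and its weight components: \<open>E\<^sub>j\<^sub>k\<close> has weight
  \<open>\<alpha>\<^sub>j + \<dots> + \<alpha>\<^sub>k\<^sub>-\<^sub>1\<close>.
\<close>

definition E_sum :: "(cmat \<Rightarrow> 'n::finite yangian) \<Rightarrow> nat \<Rightarrow> 'n yangian2" where
  "E_sum \<iota> i = (\<Sum>(j, k)\<in>{1..i} \<times> {i+1..CARD('n)+1}. \<iota> (elem k j) \<otimes> \<iota> (elem j k))"

definition E_components :: "(cmat \<Rightarrow> 'n::finite yangian) \<Rightarrow> nat \<Rightarrow> weight \<Rightarrow> 'n yangian2" where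
  "E_components \<iota> i \<beta> =
     (\<Sum>(j, k) | (j, k) \<in> {1..i} \<times> {i+1..CARD('n)+1} \<and> (\<Sum>l=j..<k. simple_root l) = \<beta>.
        \<iota> (elem k j) \<otimes> \<iota> (elem j k))"

end

theory Submission imports Defs begin

text \<open>
  Put \<open>E = \<Sum>\<^sub>j\<^sub>\<le>\<^sub>i\<^sub><\<^sub>k E\<^sub>k\<^sub>j \<otimes> E\<^sub>j\<^sub>k\<close>, \<open>T(z) = exp (- E z\<^sup>-\<^sup>1)\<close> and \<open>D(z) = (1 \<otimes> S\<^sub>i(z)) T(z) (S\<^sub>i(z) \<otimes> 1)\<close>.  Since
  \<open>S\<^sub>i(z)\<close> is determined by the series \<open>\<xi>\<^sub>j(z)\<close>, so are its exchange relations: it commutes with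
  \<open>x\<^sup>\<plusminus>\<^sub>l\<^sub>,\<^sub>m\<close> for \<open>l \<noteq> i\<close>, and \<open>S\<^sub>i(z) (x\<^sup>+\<^sub>i\<^sub>,\<^sub>m - z\<^sup>-\<^sup>1 x\<^sup>+\<^sub>i\<^sub>,\<^sub>m\<^sub>+\<^sub>1) = x\<^sup>+\<^sub>i\<^sub>,\<^sub>m S\<^sub>i(z)\<close>.  Hence \<open>\<Delta>(S\<^sub>i(z))\<close> intertwines
  \<open>\<Delta>(x\<^sup>+\<^sub>i\<^sub>,\<^sub>0 - z\<^sup>-\<^sup>1 x\<^sup>+\<^sub>i\<^sub>,\<^sub>1)\<close> with \<open>\<Delta>(x\<^sup>+\<^sub>i\<^sub>,\<^sub>0)\<close> and commutes with \<open>\<Delta>(x\<^sup>+\<^sub>l\<^sub>,\<^sub>0)\<close> for \<open>l \<noteq> i\<close>.  The same relations hold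
  for \<open>D(z)\<close>, because conjugation by \<open>T(z)\<close> produces exactly the extra terms of \<open>\<Delta>(x\<^sup>+\<^sub>i\<^sub>,\<^sub>1)\<close>.
  Moreover \<open>\<Delta>(S\<^sub>i(z))\<close> and \<open>D(z)\<close> agree with \<open>S\<^sub>i(z) \<otimes> S\<^sub>i(z)\<close> up to terms whose second factor has
  weight in \<open>Q\<^sub>+ - {0}\<close>.  The lowest nonzero coefficient of their difference would then commute with
  all \<open>\<Delta>(x\<^sup>+\<^sub>l\<^sub>,\<^sub>0)\<close>; the first factors of its component of minimal weight \<open>\<beta>\<close> would be highest weight
  vectors of weight \<open>- \<beta>\<close> in the adjoint representation of \<open>sl\<close> on \<open>Y\<close>, which is impossible as that
  representation is locally finite.
\<close>

section \<open>Brackets and subalgebras\<close>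

text \<open>Why exp(-E z^-1): if Q denotes the non-primitive part of \<Delta>(x^+_{i,1}), then
  [E, x^+_{i,0} \<otimes> 1] = -Q, so conjugation by this exponential creates the term Q z^-1 that
  cancels the one in \<Delta>(x^+_{i,0} - z^-1 x^+_{i,1}). Repeated brackets with E stop after the
  second, which leaves one identity at z^-2 to check. Exchange relations are obtained without
  logarithms: A_i and S_i are solved degree by degree, and the same recursion, run in two algebras
  at once, carries a compatible relation from the inputs to the solutions. This is done once for
  index shifts of x_{j,m} and once for congruence modulo positive second weights. The obstacle to
  comparing leading terms is that \<Delta> is prescribed only up to mode 1, while A_i involves all
  \<xi>_{j,m}. The Cartan element \<xi>_{i,1} - \<xi>_{i,0}^2 / 2, whose bracket raises modes,
  carries the information upwards. No basis of Y is used: weight components are separated by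
  eigenvalues of the \<xi>_{l,0}, and local finiteness enters only as local nilpotency of ad
  x^-_{l,0}.\<close>

lemma scaleC_zero_left [simp]: "0 *\<^sub>C x = (0 :: 'a::complex_algebra_1)"
  by (rule cvs.scale_zero_left)

lemma scaleC_zero_right [simp]: "c *\<^sub>C (0 :: 'a::complex_algebra_1) = 0"
  by (rule cvs.scale_zero_right)

lemmas scaleC_simps = scaleC_add_left scaleC_add_right scaleC_scaleC mult_scaleC_left
  mult_scaleC_right cvs.scale_minus_left cvs.scale_minus_right cvs.scale_left_diff_distrib
  cvs.scale_right_diff_distrib

declare scaleC_one [simp]

lemma scaleC_of_nat: "of_nat k *\<^sub>C x = of_nat k * (x :: 'a::complex_algebra_1)"
  by (induction k) (simp_all add: scaleC_add_left distrib_right)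

lemma scaleC_numeral: "numeral k *\<^sub>C x = numeral k * (x :: 'a::complex_algebra_1)"
  using scaleC_of_nat[of "numeral k" x] by simp

lemma scaleC_cancel: "c \<noteq> 0 \<Longrightarrow> c *\<^sub>C x = c *\<^sub>C y \<longleftrightarrow> x = (y :: 'a::complex_algebra_1)"
  by simp

lemma half_eq: "x + x = y + y \<Longrightarrow> x = (y :: 'a::complex_algebra_1)"
  by (metis (no_types) mult_2 scaleC_cancel scaleC_numeral zero_neq_numeral)

lemma bracket_add_left: "bracket (x + y) z = bracket x z + bracket y z"
  and bracket_add_right: "bracket z (x + y) = bracket z x + bracket z y"
  and bracket_diff_left: "bracket (x - y) z = bracket x z - bracket y z"
  and bracket_diff_right: "bracket z (x - y) = bracket z x - bracket z y"
  and bracket_minus_left: "bracket (- x) z = - bracket x z"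
  and bracket_minus_right: "bracket z (- x) = - bracket z x"
  and bracket_zero_left [simp]: "bracket 0 z = 0"
  and bracket_zero_right [simp]: "bracket z 0 = 0"
  and bracket_one_left [simp]: "bracket 1 z = 0"
  and bracket_one_right [simp]: "bracket z 1 = 0"
  and bracket_self [simp]: "bracket x x = 0"
  by (simp_all add: bracket_def algebra_simps)

lemma bracket_scaleC_left: "bracket (c *\<^sub>C x) y = c *\<^sub>C bracket x (y :: 'a::complex_algebra_1)"
  and bracket_scaleC_right: "bracket x (c *\<^sub>C y) = c *\<^sub>C bracket x (y :: 'a::complex_algebra_1)"
  by (simp_all add: bracket_def scaleC_simps)

lemma bracket_mult_right: "bracket x (y * z) = bracket x y * z + y * bracket x z"
  by (simp add: bracket_def algebra_simps)

lemma bracket_mult_left: "bracket (x * y) z = x * bracket y z + bracket x z * y"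
  by (simp add: bracket_def algebra_simps)

lemma bracket_anti: "bracket y x = - bracket x y"
  by (simp add: bracket_def)

lemma bracket_jacobi: "bracket x (bracket y z) = bracket (bracket x y) z + bracket y (bracket x z)"
  by (simp add: bracket_def algebra_simps)

lemma bracket_eq_0_iff: "bracket x y = 0 \<longleftrightarrow> x * y = y * x"
  by (simp add: bracket_def)

lemma bracket_eq_0_sym: "bracket x y = 0 \<Longrightarrow> bracket y x = 0"
  by (simp add: bracket_def)

lemma bracket_sum_left: "bracket (\<Sum>a\<in>I. f a) z = (\<Sum>a\<in>I. bracket (f a) z)"
  by (induction I rule: infinite_finite_induct) (simp_all add: bracket_add_left)

lemma bracket_sum_right: "bracket z (\<Sum>a\<in>I. f a) = (\<Sum>a\<in>I. bracket z (f a))"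
  by (induction I rule: infinite_finite_induct) (simp_all add: bracket_add_right)

lemmas bracket_simps = bracket_add_left bracket_add_right bracket_diff_left bracket_diff_right
  bracket_minus_left bracket_minus_right bracket_scaleC_left bracket_scaleC_right

lemma algebra_homD:
  assumes "algebra_hom f"
  shows "f 1 = 1" "f (x + y) = f x + f y" "f (x * y) = f x * f y" "f (c *\<^sub>C x) = c *\<^sub>C f x"
    "f 0 = 0" "f (x - y) = f x - f y" "f (- x) = - f x"
    "f (sum g I) = (\<Sum>a\<in>I. f (g a))" "f (bracket x y) = bracket (f x) (f y)"
proof -
  note h = assms[unfolded algebra_hom_def]
  have add: "f (x + y) = f x + f y" for x y using h by blast
  have mult: "f (x * y) = f x * f y" for x y using h by blast
  show "f 1 = 1" "f (x + y) = f x + f y" "f (x * y) = f x * f y" "f (c *\<^sub>C x) = c *\<^sub>C f x"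
    using h by blast+
  show zero: "f 0 = 0" using add[of 0 0] by simp
  have uminus: "f (- x) = - f x" for x using add[of x "- x"] zero by (simp add: add_eq_0_iff)
  have diff: "f (x - y) = f x - f y" for x y using add[of x "- y"] uminus by simp
  show "f (x - y) = f x - f y" "f (- x) = - f x" by (rule diff uminus)+
  show "f (sum g I) = (\<Sum>a\<in>I. f (g a))"
    by (induction I rule: infinite_finite_induct) (simp_all add: zero add)
  show "f (bracket x y) = bracket (f x) (f y)" by (simp add: bracket_def diff mult)
qed

text \<open>Bracketing with \<open>x\<close> is a derivation, so the centraliser of \<open>x\<close>
  is a subalgebra.\<close>

lemma subalgebra_gen_commute:
  assumes "y \<in> subalgebra_gen G" "\<And>g. g \<in> G \<Longrightarrow> bracket x g = 0"
  shows "bracket x y = 0"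
  using assms(1)
  by induction (simp_all add: assms(2) bracket_add_right bracket_mult_right bracket_scaleC_right)


section \<open>Tensors\<close>

lemma tensor_eqI: "p - q \<in> bilinear_relations \<Longrightarrow> ideal_rel bilinear_relations p q"
  unfolding ideal_rel_def by (rule two_sided_ideal_gen)

lemma tensor_eqI_add: "p - q - r \<in> bilinear_relations \<Longrightarrow> ideal_rel bilinear_relations p (q + r)"
  by (rule tensor_eqI) (simp add: diff_diff_eq)

lemma tensor_add_left: "(x + x') \<otimes> y = x \<otimes> y + x' \<otimes> y"
  by transfer (rule tensor_eqI_add, unfold bilinear_relations_def, blast)

lemma tensor_add_right: "x \<otimes> (y + y') = x \<otimes> y + x \<otimes> y'"
  by transfer (rule tensor_eqI_add, unfold bilinear_relations_def, blast)

lemma tensor_scaleC_left: "(c *\<^sub>C x) \<otimes> y = c *\<^sub>C (x \<otimes> y)"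
  by transfer (rule tensor_eqI, unfold bilinear_relations_def, blast)

lemma tensor_scaleC_right: "x \<otimes> (c *\<^sub>C y) = c *\<^sub>C (x \<otimes> y)"
  by transfer (rule tensor_eqI, unfold bilinear_relations_def, blast)

lemma tensor_mult: "(x \<otimes> y) * (x' \<otimes> y') = (x * x') \<otimes> (y * y')"
  by transfer (simp add: mult_single equivp_reflp[OF equivp_ideal_rel])

lemma tensor_one: "1 \<otimes> 1 = 1"
proof -
  have "mon (MPair 1 1) = (1 :: ('a, 'b) mpair \<Rightarrow>\<^sub>0 complex)"
    by (simp flip: zero_mpair_def)
  then show ?thesis by transfer (simp add: equivp_reflp[OF equivp_ideal_rel])
qed

lemma tensor_zero_left [simp]: "0 \<otimes> y = 0"
  using tensor_scaleC_left[of 0 0 y] by simp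

lemma tensor_zero_right [simp]: "x \<otimes> 0 = 0"
  using tensor_scaleC_right[of x 0 0] by simp

lemma tensor_minus_left: "(- x) \<otimes> y = - (x \<otimes> y)"
  using tensor_add_left[of x "- x" y] by (simp add: eq_neg_iff_add_eq_0 add.commute)

lemma tensor_minus_right: "x \<otimes> (- y) = - (x \<otimes> y)"
  using tensor_add_right[of x y "- y"] by (simp add: eq_neg_iff_add_eq_0 add.commute)

lemma tensor_diff_left: "(x - x') \<otimes> y = x \<otimes> y - x' \<otimes> y"
  using tensor_add_left[of x "- x'" y] by (simp add: tensor_minus_left)

lemma tensor_diff_right: "x \<otimes> (y - y') = x \<otimes> y - x \<otimes> y'"
  using tensor_add_right[of x y "- y'"] by (simp add: tensor_minus_right)

lemmas tensor_simps = tensor_add_left tensor_add_right tensor_diff_left tensor_diff_right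
  tensor_minus_left tensor_minus_right tensor_scaleC_left tensor_scaleC_right

lemma bracket_tensor:
  "bracket (x \<otimes> y) (x' \<otimes> y') = bracket x x' \<otimes> (y * y') + (x' * x) \<otimes> bracket y y'"
  by (simp add: bracket_def tensor_mult tensor_simps)

lemma bracket_tensor_left: "bracket (x \<otimes> 1) (x' \<otimes> y') = bracket x x' \<otimes> y'"
  by (simp add: bracket_tensor)

lemma tensor_hom_left: "algebra_hom (\<lambda>x. x \<otimes> 1)"
  and tensor_hom_right: "algebra_hom (\<lambda>y. 1 \<otimes> y)"
  by (simp_all add: algebra_hom_def tensor_simps tensor_one tensor_mult)

text \<open>The scalar of a monomial is absorbed into its first factor, so sums of pure tensors
  already exhaust the tensor product.\<close>

lemma tensor_induct [case_names tensor add]: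
  assumes "\<And>x y. P (x \<otimes> y)" "\<And>u v. P u \<Longrightarrow> P v \<Longrightarrow> P (u + v)"
  shows "P t"
proof -
  have *: "P (abs_tensor p)" for p
  proof (induction p rule: monoid_algebra_induct)
    case (single w c)
    obtain x y where w: "w = MPair x y" by (cases w)
    have "abs_tensor (Poly_Mapping.single w c) = c *\<^sub>C (x \<otimes> y)"
      by (simp add: w scaleC_tensor.abs_eq pure_tensor.abs_eq mult_single)
    then show ?case using assms(1)[of "c *\<^sub>C x" y] by (simp add: tensor_scaleC_left)
  next
    case (add p q)
    then show ?case using assms(2) by (metis plus_tensor.abs_eq)
  qed
  show ?thesis using *[of "rep_tensor t"] by (simp add: Quotient_abs_rep[OF Quotient_tensor])
qed


section \<open>Generators and relations of the Yangian\<close>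

lemma abs_yangian_hom:
  "abs_yangian (p + q) = abs_yangian p + abs_yangian q"
  "abs_yangian (p - q) = abs_yangian p - abs_yangian q"
  "abs_yangian (p * q) = abs_yangian p * abs_yangian q"
  "abs_yangian (scalar c) = c *\<^sub>C 1"
  "abs_yangian 0 = 0" "abs_yangian 1 = 1"
  "abs_yangian (bracket p q) = bracket (abs_yangian p) (abs_yangian q)"
  by (simp_all add: plus_yangian.abs_eq minus_yangian.abs_eq times_yangian.abs_eq
      scaleC_yangian.abs_eq zero_yangian_def one_yangian_def bracket_def)

lemma abs_yangian_relation: "r \<in> yangian_relations \<Longrightarrow> abs_yangian r = 0"
  unfolding zero_yangian_def yangian.abs_eq_iff ideal_rel_def
  by (simp add: two_sided_ideal_gen)

lemma label_node: "i \<in> {1..CARD('n)} \<Longrightarrow> label (node i :: 'n::finite node) = i"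
  by (rule node_inverse)

lemma label_range: "label (i :: 'n::finite node) \<in> {1..CARD('n)}"
  by (rule label)

lemma node_label: "node (label i) = i"
  by (rule label_inverse)

abbreviation ycartan :: "nat \<Rightarrow> nat \<Rightarrow> complex" where
  "ycartan i j \<equiv> of_int (cartan i j)"

lemma cartan_simps [simp]:
  "cartan i i = 2" "cartan i (Suc i) = - 1" "cartan (Suc i) i = - 1"
  by (simp_all add: cartan_def)

context
  fixes i j :: nat and T :: "'n::finite itself"
  assumes i: "i \<in> {1..CARD('n)}" and j: "j \<in> {1..CARD('n)}"
begin

lemma xi_xi: "bracket (xi_gen i p) (xi_gen j m) = (0 :: 'n yangian)"
proof -
  have "bracket (free_xi (node i) p) (free_xi (node j) m) \<in> (yangian_relations :: 'n gen free_algebra set)"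
    unfolding yangian_relations_def by ((rule UnI1)+, (rule CollectI exI conjI refl TrueI)+)
  from abs_yangian_relation[OF this] show ?thesis
    by (simp add: xi_gen_def abs_yangian_hom)
qed

lemma x_plus_x_minus:
  "bracket (x_gen Plus i p) (x_gen Minus j m) = (if i
      = j then xi_gen i (p + m) else 0 :: 'n yangian)"
proof -
  have "bracket (free_x Plus (node i) p) (free_x Minus (node j) m)
     - (if node i = (node j :: 'n node) then free_xi (node i) (p + m) else 0)
     \<in> (yangian_relations :: 'n gen free_algebra set)"
    unfolding yangian_relations_def
    by (rule UnI1, rule UnI1, rule UnI1, rule UnI1, rule UnI2, (rule CollectI exI conjI refl TrueI)+)
  moreover have "node i = (node j :: 'n node) \<longleftrightarrow> i = j"
    using i j label_node by metis
  ultimately show ?thesis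
    using abs_yangian_relation by (fastforce simp: xi_gen_def x_gen_def abs_yangian_hom)
qed

lemma xi_x_step:
  "bracket (xi_gen i (Suc m)) (x_gen s j p) - bracket (xi_gen i m) (x_gen s j (Suc p))
    = (pm_sgn s * ycartan i j / 2) *\<^sub>C
        (xi_gen i m * x_gen s j p + x_gen s j p * xi_gen i m :: 'n yangian)"
proof -
  have "bracket (free_xi (node i) (m + 1)) (free_x s (node j) p)
        - bracket (free_xi (node i) m) (free_x s (node j) (p + 1))
        - scalar (pm_sgn s * of_int (node_cartan (node i :: 'n node) (node j :: 'n node)) / 2)
            * (free_xi (node i) m * free_x s (node j) p + free_x s (node j) p * free_xi (node i) m)
        \<in> (yangian_relations :: 'n gen free_algebra set)"
    unfolding yangian_relations_def by (rule UnI1, rule UnI1, rule UnI1, rule UnI2, (rule CollectI exI conjI refl TrueI)+)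
  from abs_yangian_relation[OF this] show ?thesis
    by (simp add: xi_gen_def x_gen_def abs_yangian_hom mult_scaleC_left label_node[OF i] label_node[OF j])
qed

lemma xi_zero_x:
  "bracket (xi_gen i 0) (x_gen s j p) = (pm_sgn s * ycartan i j) *\<^sub>C (x_gen s j p :: 'n yangian)"
proof -
  have "bracket (free_xi (node i) 0) (free_x s (node j) p)
        - scalar (pm_sgn s * of_int (node_cartan (node i :: 'n node) (node j :: 'n node))) * free_x s (node j) p
        \<in> (yangian_relations :: 'n gen free_algebra set)"
    unfolding yangian_relations_def by (rule UnI1, rule UnI1, rule UnI2, (rule CollectI exI conjI refl TrueI)+)
  from abs_yangian_relation[OF this] show ?thesis
    by (simp add: xi_gen_def x_gen_def abs_yangian_hom mult_scaleC_left label_node[OF i] label_node[OF j])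
qed

lemma x_x_step:
  "bracket (x_gen s i (Suc m)) (x_gen s j p) - bracket (x_gen s i m) (x_gen s j (Suc p))
    = (pm_sgn s * ycartan i j / 2) *\<^sub>C
        (x_gen s i m * x_gen s j p + x_gen s j p * x_gen s i m :: 'n yangian)"
proof -
  have "bracket (free_x s (node i) (m + 1)) (free_x s (node j) p)
        - bracket (free_x s (node i) m) (free_x s (node j) (p + 1))
        - scalar (pm_sgn s * of_int (node_cartan (node i :: 'n node) (node j :: 'n node)) / 2)
            * (free_x s (node i) m * free_x s (node j) p + free_x s (node j) p * free_x s (node i) m)
        \<in> (yangian_relations :: 'n gen free_algebra set)"
    unfolding yangian_relations_def by (rule UnI1, rule UnI2, (rule CollectI exI conjI refl TrueI)+)
  from abs_yangian_relation[OF this] show ?thesis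
    by (simp add: x_gen_def abs_yangian_hom mult_scaleC_left label_node[OF i] label_node[OF j])
qed

lemma serre:
  assumes "i \<noteq> j"
  shows "(bracket (x_gen s i 0) ^^ nat (1 - cartan i j)) (x_gen s j 0) = (0 :: 'n yangian)"
proof -
  have ne: "node i \<noteq> (node j :: 'n node)" using i j assms label_node by metis
  have "(bracket (free_x s (node i) 0) ^^ nat (1 - node_cartan (node i :: 'n node) (node j :: 'n node))) (free_x s (node j) 0)
        \<in> (yangian_relations :: 'n gen free_algebra set)"
    unfolding yangian_relations_def by (rule UnI2, (rule CollectI exI conjI refl ne)+)
  note * = abs_yangian_relation[OF this]
  have "abs_yangian ((bracket p ^^ k) q) = (bracket (abs_yangian p) ^^ k) (abs_yangian q)"
    for p q :: "'n gen free_algebra" and k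
    by (induction k) (simp_all add: abs_yangian_hom)
  then show ?thesis
    using * by (simp add: x_gen_def label_node[OF i] label_node[OF j])
qed

end

text \<open>Words in the generators span Y, and every node is \<open>node i\<close> for a label
  \<open>i\<close> in {1..n}.\<close>

lemma yangian_induct [case_names one x xi add mult scale]:
  fixes y :: "'n::finite yangian"
  assumes one: "P 1"
    and x: "\<And>s i m. i \<in> {1..CARD('n)} \<Longrightarrow> P (x_gen s i m)"
    and xi: "\<And>i m. i \<in> {1..CARD('n)} \<Longrightarrow> P (xi_gen i m)"
    and add: "\<And>a b. P a \<Longrightarrow> P b \<Longrightarrow> P (a + b)"
    and mult: "\<And>a b. P a \<Longrightarrow> P b \<Longrightarrow> P (a * b)"
    and scale: "\<And>c a. P a \<Longrightarrow> P (c *\<^sub>C a)"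
  shows "P y"
proof -
  have word: "P (abs_yangian (mon (Word gs)))" for gs :: "'n gen list"
  proof (induction gs)
    case Nil
    have "mon (Word []) = (1 :: 'n gen free_algebra)" by (simp flip: zero_word_def)
    then show ?case using one by (simp add: abs_yangian_hom)
  next
    case (Cons g gs)
    have *: "mon (Word (g # gs)) = mon (Word [g]) * (mon (Word gs) :: 'n gen free_algebra)"
      by (simp add: mult_single)
    have "P (abs_yangian (mon (Word [g])))"
    proof (cases g)
      case (GX s i m)
      then show ?thesis using x[OF label_range, of s i m]
        by (simp add: x_gen_def free_x_def node_label)
    next
      case (GXi i m)
      then show ?thesis using xi[OF label_range, of i m]
        by (simp add: xi_gen_def free_xi_def node_label)
    qed
    then show ?case using mult Cons by (simp add: * abs_yangian_hom)
  qed
  have *: "P (abs_yangian p)" for p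
  proof (induction p rule: monoid_algebra_induct)
    case (single w c)
    have "Poly_Mapping.single w c = scalar c * mon w" by (simp add: mult_single)
    then show ?case using word scale
        by (cases w) (simp only: abs_yangian_hom mult_scaleC_left mult_1)
  qed (use add in \<open>simp add: abs_yangian_hom\<close>)
  show ?thesis using *[of "rep_yangian y"] by (simp add: Quotient_abs_rep[OF Quotient_yangian])
qed


section \<open>Series with coefficients in an algebra\<close>

lemma fps_map_nth [simp]: "fps_map f F $ m = f (F $ m)"
  by (simp add: fps_map_def)

lemma fps_map_hom:
  assumes "algebra_hom f"
  shows "fps_map f 1 = 1" "fps_map f (F * G) = fps_map f F * fps_map f G"
    "fps_map f (F + G) = fps_map f F + fps_map f G"
    "fps_map f (z_shift c F) = z_shift c (fps_map f F)"
  by (simp_all add: fps_eq_iff fps_mult_nth algebra_homD[OF assms] z_shift_def)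

lemma z_shift_one [simp]: "z_shift c 1 = 1"
proof (rule fps_ext)
  fix m
  have "z_shift c (1 :: 'a fps) $ m
      = (\<Sum>k\<in>{0}. (((- of_nat k) gchoose (m - k)) * c ^ (m - k)) *\<^sub>C ((1 :: 'a fps) $ k))"
    unfolding z_shift_def fps_nth_Abs_fps by (rule sum.mono_neutral_right) auto
  also have "\<dots> = (1 :: 'a fps) $ m" by (cases m) (simp_all add: gbinomial_0_left)
  finally show "z_shift c (1 :: 'a fps) $ m = 1 $ m" .
qed

text \<open>The expansion of (z + c)^-k in powers of z^-1.\<close>

definition shift_power :: "complex \<Rightarrow> nat \<Rightarrow> complex fps" where
  "shift_power c k = fps_X ^ k * Abs_fps (\<lambda>n. ((- of_nat k) gchoose n) * c ^ n)"

lemma shift_power_nth: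
  "shift_power c k $ m = (if k \<le> m then ((- of_nat k) gchoose (m - k)) * c ^ (m - k) else 0)"
  by (simp add: shift_power_def fps_X_power_mult_nth)

text \<open>In coefficients this is Vandermonde's identity for generalised binomial
  coefficients.\<close>

lemma shift_power_add: "shift_power c k * shift_power c l = shift_power c (k + l)"
proof -
  have *: "Abs_fps (\<lambda>n. (a gchoose n) * c ^ n) * Abs_fps (\<lambda>n. (b gchoose n) * c ^ n)
      = Abs_fps (\<lambda>n. ((a + b) gchoose n) * c ^ n)" for a b :: complex
  proof (rule fps_ext)
    fix n
    have "(Abs_fps (\<lambda>n. (a gchoose n) * c ^ n) * Abs_fps (\<lambda>n. (b gchoose n) * c ^ n)) $ n
        = (\<Sum>i\<le>n. (a gchoose i) * (b gchoose (n - i)) * (c ^ i * c ^ (n - i)))"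
      by (simp add: fps_mult_nth atLeast0AtMost mult_ac)
    also have "\<dots> = (\<Sum>i\<le>n. (a gchoose i) * (b gchoose (n - i))) * c ^ n"
      unfolding sum_distrib_right by (rule sum.cong) (simp_all flip: power_add)
    finally show "(Abs_fps (\<lambda>n. (a gchoose n) * c ^ n) * Abs_fps (\<lambda>n. (b gchoose n) * c ^ n)) $ n
        = Abs_fps (\<lambda>n. ((a + b) gchoose n) * c ^ n) $ n"
      by (simp add: gbinomial_Vandermonde flip: atLeast0AtMost)
  qed
  have "shift_power c k * shift_power c l = fps_X ^ (k + l)
      * (Abs_fps (\<lambda>n. ((- of_nat k) gchoose n) * c ^ n) * Abs_fps (\<lambda>n. ((- of_nat l) gchoose n) * c ^ n))"
    by (simp add: shift_power_def power_add mult_ac)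
  then show ?thesis by (simp only: * shift_power_def of_nat_add minus_add_distrib)
qed

text \<open>The bound \<open>M\<close> is free so that several coefficients can be expanded over one
  common index range; the additional terms vanish because (z + c)^-k starts at z^-k.\<close>

lemma z_shift_nth:
  assumes "m \<le> M"
  shows "z_shift c F $ m = (\<Sum>k\<le>M. (shift_power c k $ m) *\<^sub>C (F $ k))"
proof -
  have "(\<Sum>k\<le>M. (shift_power c k $ m) *\<^sub>C (F $ k)) = (\<Sum>k\<le>m. (shift_power c k $ m) *\<^sub>C (F $ k))"
    using assms by (intro sum.mono_neutral_right) (auto simp: shift_power_nth)
  also have "\<dots> = z_shift c F $ m"
    by (simp add: z_shift_def shift_power_nth)
  finally show ?thesis ..
qed

lemma sum_scaleC_right: "(\<Sum>a\<in>I. c *\<^sub>C f a) = c *\<^sub>C (\<Sum>a\<in>I. f a)"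
  by (rule cvs.scale_sum_right[symmetric])

lemma sum_scaleC_left: "(\<Sum>a\<in>I. f a *\<^sub>C x) = (\<Sum>a\<in>I. f a) *\<^sub>C x"
  by (rule cvs.scale_sum_left[symmetric])

text \<open>Translation affects the powers of z by complex scalars only. Noncommuting coefficients
  therefore keep their order, and the claim reduces to \<open>shift_power_add\<close>.\<close>

lemma z_shift_mult: "z_shift c (F * G) = z_shift c F * z_shift c G"
proof (rule fps_ext)
  fix m
  define h where "h = (\<lambda>(k, l). (shift_power c (k + l) $ m) *\<^sub>C (F $ k * G $ l))"
  have "(z_shift c F * z_shift c G) $ m
      = (\<Sum>i\<le>m. (\<Sum>k\<le>m. (shift_power c k $ i) *\<^sub>C (F $ k)) * (\<Sum>l\<le>m. (shift_power c l $ (m - i)) *\<^sub>C (G $ l)))"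
    by (simp add: fps_mult_nth atLeast0AtMost z_shift_nth[where M = m])
  also have "\<dots>
      = (\<Sum>i\<le>m. \<Sum>k\<le>m. \<Sum>l\<le>m. (shift_power c k $ i * shift_power c l $ (m - i)) *\<^sub>C (F $ k * G $ l))"
    by (simp add: sum_product scaleC_simps mult.commute)
  also have "\<dots>
      = (\<Sum>k\<le>m. \<Sum>l\<le>m. \<Sum>i\<le>m. (shift_power c k $ i * shift_power c l $ (m - i)) *\<^sub>C (F $ k * G $ l))"
    by (subst sum.swap, rule sum.cong[OF refl], rule sum.swap)
  also have "\<dots> = (\<Sum>k\<le>m. \<Sum>l\<le>m. h (k, l))"
    unfolding sum_scaleC_left h_def
    by (simp add: fps_mult_nth atLeast0AtMost flip: shift_power_add)
  also have "\<dots> = (\<Sum>p\<in>{..m} \<times> {..m}. h p)"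
    by (simp add: sum.cartesian_product)
  \<comment> \<open>Pairs with k + l > m contribute nothing, since (z + c)^-(k+l) starts at
    z^-(k+l).\<close>
  also have "\<dots> = (\<Sum>p\<in>{(k, l). k + l \<le> m}. h p)"
  proof (rule sum.mono_neutral_right)
    show "\<forall>p\<in>{..m} \<times> {..m} - {(k, l). k + l \<le> m}. h p = 0"
      by (auto simp del: of_nat_add simp: h_def shift_power_nth split: if_splits)
  qed auto
  also have "\<dots> = (\<Sum>n\<le>m. \<Sum>k\<le>n. h (k, n - k))"
    using sum.triangle_reindex_eq[of "\<lambda>k l. h (k, l)" m] by simp
  also have "\<dots> = z_shift c (F * G) $ m"
    by (simp add: h_def z_shift_nth[where M = m] fps_mult_nth atLeast0AtMost sum_scaleC_right)
  finally show "z_shift c (F * G) $ m = (z_shift c F * z_shift c G) $ m" ..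
qed

lemma z_shift_nth_0 [simp]: "z_shift c F $ 0 = F $ 0"
  by (simp add: z_shift_def)

lemma z_shift_split: "z_shift c F $ m = F $ m + (\<Sum>k<m. (shift_power c k $ m) *\<^sub>C (F $ k))"
  by (simp add: z_shift_nth[OF order_refl] shift_power_nth flip: lessThan_Suc_atMost)

lemma fps_mult_split:
  assumes "m > 0"
  shows "(F * G) $ m = F $ 0 * G $ m + F $ m * G $ 0 + (\<Sum>k=1..<m. F $ k * G $ (m - k))"
proof -
  have "{0..m} = insert 0 (insert m {1..<m})" using assms by auto
  then show ?thesis using assms by (simp add: fps_mult_nth add.assoc)
qed


text \<open>
  \<open>binomial_recursion a G\<close> characterises \<open>G = (1 + z\<^sup>-\<^sup>1)\<^sup>-\<^sup>a\<close>.
\<close>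

definition binomial_recursion :: "'a::complex_algebra_1 \<Rightarrow> 'a fps \<Rightarrow> bool" where
  "binomial_recursion a G \<longleftrightarrow> G $ 0 = 1 \<and>
     (\<forall>m. of_nat (Suc m) *\<^sub>C (G $ Suc m) = - (a * G $ m) - of_nat m *\<^sub>C (G $ m))"

abbreviation neg_log_series :: "'a::complex_algebra_1 fps" where
  "neg_log_series \<equiv> Abs_fps (\<lambda>k. if k = 0 then 0 else ((- 1) ^ k / of_nat k) *\<^sub>C 1)"

text \<open>\<open>neg_log_series\<close> is -log(1 + z^-1), so the exponential is (1 + z^-1)^-a.
  Only powers of the single element \<open>a\<close> occur, which reduces the recursion to scalar
  identities for the powers of the series \<open>L\<close>.\<close>

lemma binomial_recursion_exp:
  fixes a :: "'a::complex_algebra_1"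
  shows "binomial_recursion a (fps_exponential (fps_const a * neg_log_series))"
proof -
  define L :: "complex fps" where "L = Abs_fps (\<lambda>k. if k = 0 then 0 else (- 1) ^ k / of_nat k)"
  define F :: "'a fps" where "F = fps_const a * neg_log_series"
  have F: "F $ i = (L $ i) *\<^sub>C a" for i
    by (simp add: F_def L_def mult_scaleC_right)
  have pow: "(F ^ k) $ m = (L ^ k $ m) *\<^sub>C a ^ k" for k m
  proof (induction k arbitrary: m)
    case (Suc k)
    have "(F ^ Suc k) $ m = (\<Sum>i=0..m. (L $ i * L ^ k $ (m - i)) *\<^sub>C (a * a ^ k))"
      unfolding power_Suc fps_mult_nth Suc F by (simp add: scaleC_simps mult.commute)
    then show ?case by (simp add: sum_scaleC_left fps_mult_nth)
  qed (auto simp: fps_one_def)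
  have L0: "L $ 0 = 0" by (simp add: L_def)
  have Lk: "L ^ k $ m = 0" if "m < k" for k m
    using that L0 by (rule startsby_zero_power_prefix[rule_format, rotated])
  have G: "fps_exponential F $ m = (\<Sum>k\<le>M. (L ^ k $ m / fact k) *\<^sub>C a ^ k)" if "m \<le> M" for m M
  proof -
    have "fps_exponential F $ m = (\<Sum>k\<le>m. (L ^ k $ m / fact k) *\<^sub>C a ^ k)"
      by (simp add: fps_exponential_def pow scaleC_scaleC)
    also have "\<dots> = (\<Sum>k\<le>M. (L ^ k $ m / fact k) *\<^sub>C a ^ k)"
      using that by (intro sum.mono_neutral_left) (auto simp: Lk)
    finally show ?thesis .
  qed
  \<comment> \<open>The differential equation of -log(1 + X). It gives (1 + X) (L^(k+1))' = -(k+1)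
    L^k, and comparing coefficients yields the recursion for each power of \<open>a\<close>
    separately.\<close>
  have dL: "(1 + fps_X) * fps_deriv L = - 1"
  proof (rule fps_ext)
    fix n show "((1 + fps_X) * fps_deriv L) $ n = (- 1 :: complex fps) $ n"
      by (cases n) (simp_all add: distrib_right L_def del: of_nat_Suc)
  qed
  have coeff: "of_nat (Suc m) * L ^ Suc k $ Suc m + of_nat m * L ^ Suc k $ m
      = - (of_nat (Suc k) * L ^ k $ m)" for k m
  proof -
    have "(1 + fps_X) * fps_deriv (L ^ Suc k)
        = fps_const (of_nat (Suc k)) * L ^ k * ((1 + fps_X) * fps_deriv L)"
      by (simp only: fps_deriv_power diff_Suc_1 mult_ac)
    also have "\<dots> = - (fps_const (of_nat (Suc k)) * L ^ k)"
      unfolding dL by simp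
    finally have "((1 + fps_X) * fps_deriv (L ^ Suc k)) $ m
        = (- (fps_const (of_nat (Suc k)) * L ^ k)) $ m"
      by simp
    then show ?thesis
      by (cases m) (simp_all add: distrib_right del: power_Suc of_nat_Suc)
  qed
  have "of_nat (Suc m) *\<^sub>C (fps_exponential F $ Suc m) = - (a * fps_exponential F $ m)
      - of_nat m *\<^sub>C (fps_exponential F $ m)" for m
  proof -
    have "of_nat (Suc m) *\<^sub>C (fps_exponential F $ Suc m) + of_nat m *\<^sub>C (fps_exponential F $ m)
        = (\<Sum>k\<le>Suc m. ((of_nat (Suc m) * L ^ k $ Suc m + of_nat m * L ^ k $ m) / fact k) *\<^sub>C a ^ k)"
      by (simp only: G[of "Suc m" "Suc m"] G[of m "Suc m"] le_SucI order_refl cvs.scale_sum_right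
          scaleC_scaleC sum.distrib[symmetric] scaleC_add_left[symmetric] add_divide_distrib times_divide_eq_right)
    also have "\<dots> = (\<Sum>k\<le>m. ((of_nat (Suc m) * L ^ Suc k $ Suc m + of_nat m * L ^ Suc k $ m)
        / fact (Suc k)) *\<^sub>C a ^ Suc k)"
      by (subst sum.atMost_Suc_shift) (cases m; simp)
    also have "\<dots> = (\<Sum>k\<le>m. - (L ^ k $ m / fact k) *\<^sub>C a ^ Suc k)"
    proof (rule sum.cong[OF refl])
      fix k
      have "(of_nat (Suc m) * L ^ Suc k $ Suc m + of_nat m * L ^ Suc k $ m) / fact (Suc k)
          = - (of_nat (Suc k) * L ^ k $ m) / (of_nat (Suc k) * fact k)"
        unfolding coeff fact_Suc by simp
      also have "\<dots> = - (L ^ k $ m / fact k)"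
        by (simp del: of_nat_Suc)
      finally show "((of_nat (Suc m) * L ^ Suc k $ Suc m
          + of_nat m * L ^ Suc k $ m) / fact (Suc k)) *\<^sub>C a ^ Suc k
          = - (L ^ k $ m / fact k) *\<^sub>C a ^ Suc k" by simp
    qed
    also have "\<dots> = - (a * fps_exponential F $ m)"
      by (simp add: G[of m m] sum_distrib_left mult_scaleC_right sum_negf)
    finally show ?thesis by (simp add: algebra_simps)
  qed
  moreover have "fps_exponential F $ 0 = 1" by (simp add: fps_exponential_def)
  ultimately show ?thesis by (simp add: binomial_recursion_def F_def)
qed

text \<open>A Leibniz rule: the factor m + 1 is split as k + (m + 1 - k), one part for each series.
  In the result \<open>b\<close> has to be pulled to the left past the coefficients of
  \<open>U\<close>, hence the commutation hypothesis.\<close>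

lemma binomial_recursion_mult:
  assumes U: "binomial_recursion a U" and V: "binomial_recursion b V"
    and comm: "\<And>k. b * U $ k = U $ k * b"
  shows "binomial_recursion (a + b) (U * V)"
proof -
  have "of_nat (Suc m) *\<^sub>C ((U * V) $ Suc m)
      = - ((a + b) * (U * V) $ m) - of_nat m *\<^sub>C ((U * V) $ m)" for m
  proof -
    have "of_nat (Suc m) *\<^sub>C ((U * V) $ Suc m)
        = (\<Sum>k\<le>Suc m. of_nat (Suc m) *\<^sub>C (U $ k * V $ (Suc m - k)))"
      by (simp only: fps_mult_nth atLeast0AtMost sum_scaleC_right)
    also have "\<dots> = (\<Sum>k\<le>Suc m. of_nat k *\<^sub>C (U $ k * V $ (Suc m - k)))
        + (\<Sum>k\<le>Suc m. of_nat (Suc m - k) *\<^sub>C (U $ k * V $ (Suc m - k)))"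
      unfolding sum.distrib[symmetric] scaleC_add_left[symmetric] of_nat_add[symmetric]
      by (rule sum.cong) auto
    also have "(\<Sum>k\<le>Suc m. of_nat k *\<^sub>C (U $ k * V $ (Suc m - k)))
        = (\<Sum>k\<le>m. (of_nat (Suc k) *\<^sub>C (U $ Suc k)) * V $ (m - k))"
      by (subst sum.atMost_Suc_shift) (simp add: mult_scaleC_left del: of_nat_Suc)
    also have "(\<Sum>k\<le>Suc m. of_nat (Suc m - k) *\<^sub>C (U $ k * V $ (Suc m - k)))
        = (\<Sum>k\<le>m. U $ k * (of_nat (Suc (m - k)) *\<^sub>C (V $ (Suc (m - k)))))"
      by (simp add: mult_scaleC_right Suc_diff_le del: of_nat_Suc of_nat_diff)
    also have "(\<Sum>k\<le>m. (of_nat (Suc k) *\<^sub>C (U $ Suc k)) * V $ (m - k))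
        + (\<Sum>k\<le>m. U $ k * (of_nat (Suc (m - k)) *\<^sub>C (V $ (Suc (m - k)))))
        = (\<Sum>k\<le>m. - ((a + b) * (U $ k * V $ (m - k))) - of_nat m *\<^sub>C (U $ k * V $ (m - k)))"
      unfolding sum.distrib[symmetric]
    proof (rule sum.cong[OF refl])
      fix k assume "k \<in> {..m}"
      then have "of_nat m = (of_nat k + of_nat (m - k) :: complex)" by simp
      moreover have "U $ k * (b * V $ (m - k)) = b * (U $ k * V $ (m - k))"
        using comm[of k] by (simp flip: mult.assoc)
      ultimately show "(of_nat (Suc k) *\<^sub>C (U $ Suc k)) * V $ (m - k)
          + U $ k * (of_nat (Suc (m - k)) *\<^sub>C (V $ (Suc (m - k))))
          = - ((a + b) * (U $ k * V $ (m - k))) - of_nat m *\<^sub>C (U $ k * V $ (m - k))"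
        using U V unfolding binomial_recursion_def
        by (simp add: ring_distribs scaleC_simps mult.assoc del: of_nat_Suc of_nat_diff)
    qed
    also have "\<dots> = - ((a + b) * (U * V) $ m) - of_nat m *\<^sub>C ((U * V) $ m)"
      by (simp add: fps_mult_nth atLeast0AtMost sum_distrib_left cvs.scale_sum_right sum_subtractf sum_negf)
    finally show ?thesis .
  qed
  then show ?thesis using U V by (simp add: binomial_recursion_def)
qed

text \<open>Multiplication by 1 + z^-1 thus changes the parameter \<open>a\<close> by -1, which is
  the effect on a_0 of moving past x^+_i.\<close>

lemma binomial_recursion_minus_one: "binomial_recursion (- 1) (1 + fps_X)"
  unfolding binomial_recursion_def
proof (intro conjI allI)
  fix m
  show "of_nat (Suc m) *\<^sub>C ((1 + fps_X :: 'a fps) $ Suc m)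
      = - ((- 1) * (1 + fps_X) $ m) - of_nat m *\<^sub>C ((1 + fps_X) $ m)"
    by (cases m) (auto simp: fps_X_def)
qed simp

lemma fps_exponential_X_nth_1: "fps_exponential (fps_X * Abs_fps a) $ 1 = a 0"
  by (simp add: fps_exponential_def)


section \<open>Relations compatible with the algebra structure\<close>

text \<open>
  \<open>R\<close> is a subalgebra of the product of two algebras, written as a relation.  The coefficients of
  the GKLO-series and of the S-series are obtained from those of \<open>\<xi>\<^sub>i\<close> by algebra operations, so
  \<open>R\<close>-related \<open>\<xi>\<close>-series have \<open>R\<close>-related GKLO-series and S-series.
\<close>

locale algebra_rel =
  fixes R :: "'a::complex_algebra_1 \<Rightarrow> 'b::complex_algebra_1 \<Rightarrow> bool"
  assumes one: "R 1 1"
    and add: "R x y \<Longrightarrow> R x' y' \<Longrightarrow> R (x + x') (y + y')"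
    and mult: "R x y \<Longrightarrow> R x' y' \<Longrightarrow> R (x * x') (y * y')"
    and scale: "R x y \<Longrightarrow> R (c *\<^sub>C x) (c *\<^sub>C y)"
begin

lemma zero: "R 0 0"
  using scale[OF one, of 0] by simp

lemma minus: "R x y \<Longrightarrow> R (- x) (- y)"
  using scale[of x y "- 1"] by simp

lemma diff: "R x y \<Longrightarrow> R x' y' \<Longrightarrow> R (x - x') (y - y')"
  using add[OF _ minus] by fastforce

lemma sum: "(\<And>a. a \<in> I \<Longrightarrow> R (f a) (g a)) \<Longrightarrow> R (\<Sum>a\<in>I. f a) (\<Sum>a\<in>I. g a)"
  by (induction I rule: infinite_finite_induct) (auto simp: zero add)

section \<open>Degree-by-degree propagation along the equations for the GKLO-series and
  S-series\<close>

lemma shift_low: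
  assumes "\<And>k. k < m \<Longrightarrow> R (F $ k) (F' $ k)"
  shows "R (z_shift c F $ m - F $ m) (z_shift c F' $ m - F' $ m)"
  using assms by (auto simp: z_shift_split intro!: sum scale)

lemma shift_lt:
  assumes "\<And>k. k < m \<Longrightarrow> R (F $ k) (F' $ k)" "k < m"
  shows "R (z_shift c F $ k) (z_shift c F' $ k)"
  using assms by (auto simp: z_shift_split intro!: sum scale add)

lemma mult_lt:
  assumes "\<And>k. k < m \<Longrightarrow> R (F $ k) (F' $ k)" "\<And>k. k < m \<Longrightarrow> R (G $ k) (G' $ k)" "k < m"
  shows "R ((F * G) $ k) ((F' * G') $ k)"
  using assms by (auto simp: fps_mult_nth intro!: sum mult)

text \<open>With constant terms 1 the two extreme summands of the Cauchy product split off, so the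
  coefficients of degree \<open>m\<close>, about which nothing is assumed, enter only
  additively.\<close>

lemma mult_low:
  assumes "\<And>k. k < m \<Longrightarrow> R (F $ k) (F' $ k)" "\<And>k. k < m \<Longrightarrow> R (G $ k) (G' $ k)" "m > 0"
    and "F $ 0 = 1" "G $ 0 = 1" "F' $ 0 = 1" "G' $ 0 = 1"
  shows "R ((F * G) $ m - (F $ m + G $ m)) ((F' * G') $ m - (F' $ m + G' $ m))"
proof -
  have *: "(F * G) $ m - (F $ m + G $ m) = (\<Sum>k=1..<m. F $ k * G $ (m - k))"
    if "F $ 0 = 1" "G $ 0 = 1" for F G :: "'c::complex_algebra_1 fps"
    using that by (simp add: fps_mult_split[OF \<open>m > 0\<close>])
  show ?thesis
    unfolding *[OF assms(4,5)] *[OF assms(6,7)] using assms(1-3) by (auto intro!: sum mult)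
qed

text \<open>Invertibility of the Cartan matrix of type A over the rationals. Starting from the
  boundary value at 0, second differences determine d_i - i d_1; the boundary value at n + 1 then
  yields d_1 after division by n + 1.\<close>

lemma second_difference:
  fixes n i :: nat
  assumes d: "d 0 = 0" "d (n + 1) = 0" and e: "e 0 = 0" "e (n + 1) = 0"
    and R: "\<And>i. i \<in> {1..n} \<Longrightarrow> R (d (i - 1) + d (i + 1) - (d i + d i)) (e (i - 1) + e (i + 1) - (e i + e i))"
    and i: "i \<in> {1..n}"
  shows "R (d i) (e i)"
proof -
  have *: "i \<le> n + 1 \<Longrightarrow> R (d i - of_nat i *\<^sub>C d 1) (e i - of_nat i *\<^sub>C e 1)" for i
  proof (induction i rule: less_induct)
    case (less i)
    consider "i = 0" | "i = 1" | j where "i = Suc (Suc j)" by (metis One_nat_def nat.exhaust)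
    then show ?case
    proof cases
      case 3
      have eq: "f i - of_nat i *\<^sub>C f 1 = (f j + f i - (f (Suc j) + f (Suc j)))
          + (f (Suc j) - of_nat (Suc j) *\<^sub>C f 1) + (f (Suc j) - of_nat (Suc j) *\<^sub>C f 1)
          - (f j - of_nat j *\<^sub>C f 1)" for f :: "nat \<Rightarrow> 'c::complex_algebra_1"
        by (simp add: 3 algebra_simps scaleC_add_left scaleC_numeral mult_2)
      have "R (d j + d i - (d (Suc j) + d (Suc j))) (e j + e i - (e (Suc j) + e (Suc j)))"
        using R[of "Suc j"] less.prems 3 by simp
      moreover have "R (d (Suc j) - of_nat (Suc j) *\<^sub>C d 1) (e (Suc j) - of_nat (Suc j) *\<^sub>C e 1)"
        and "R (d j - of_nat j *\<^sub>C d 1) (e j - of_nat j *\<^sub>C e 1)"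
        using less.IH[of "Suc j"] less.IH[of j] less.prems 3 by simp_all
      ultimately show ?thesis unfolding eq[of d] eq[of e] by (blast intro: diff[OF add[OF add]])
    qed (auto simp: d e zero)
  qed
  have "R (- (of_nat (n + 1) *\<^sub>C d 1)) (- (of_nat (n + 1) *\<^sub>C e 1))"
    using *[of "n + 1"] unfolding d e by simp
  from scale[OF this, of "- 1 / of_nat (n + 1)"] have "R (d 1) (e 1)"
    by (simp add: scaleC_scaleC del: of_nat_Suc)
  from add[OF *[of i] scale[OF this, of "of_nat i"]] i show ?thesis by simp
qed

text \<open>Induction on the degree. Up to products of lower coefficients, the equation at z^-m
  reads X_i + 2 U_i = U_(i-1) + U_(i+1). Hence the second differences of the m-th coefficients are
  related, and \<open>second_difference\<close> applies. \<open>U\<close> and \<open>V\<close> are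
  linked only by the common shape of their equations and the related inputs.\<close>

lemma GKLO:
  fixes n i :: nat
  assumes U: "U 0 = 1" "U (n + 1) = 1" "\<And>i. i \<in> {1..n} \<Longrightarrow> U i $ 0 = 1"
    and V: "V 0 = 1" "V (n + 1) = 1" "\<And>i. i \<in> {1..n} \<Longrightarrow> V i $ 0 = 1"
    and X: "\<And>i. i \<in> {1..n} \<Longrightarrow> X i $ 0 = 1" "\<And>i. i \<in> {1..n} \<Longrightarrow> X' i $ 0 = 1"
    and eqU: "\<And>i. i \<in> {1..n} \<Longrightarrow> X i * (U i * z_shift (- 1) (U i))
        = z_shift (- 1 / 2) (U (i - 1)) * z_shift (- 1 / 2) (U (i + 1))"
    and eqV: "\<And>i. i \<in> {1..n} \<Longrightarrow> X' i * (V i * z_shift (- 1) (V i))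
        = z_shift (- 1 / 2) (V (i - 1)) * z_shift (- 1 / 2) (V (i + 1))"
    and R: "\<And>i m. i \<in> {1..n} \<Longrightarrow> R (X i $ m) (X' i $ m)"
    and i: "i \<in> {1..n}"
  shows "R (U i $ m) (V i $ m)"
proof -
  have U0: "U i $ 0 = 1" if "i \<le> n + 1" for i
    using that U by (cases "i = 0 \<or> i = n + 1") auto
  have V0: "V i $ 0 = 1" if "i \<le> n + 1" for i
    using that V by (cases "i = 0 \<or> i = n + 1") auto
  have "i \<le> n + 1 \<Longrightarrow> R (U i $ m) (V i $ m)" for i
  proof (induction m arbitrary: i rule: less_induct)
    case (less m)
    show ?case
    proof (cases "m = 0 \<or> i = 0 \<or> i = n + 1")
      case True
      then show ?thesis using U0[OF less.prems] V0[OF less.prems] U V by (auto simp: one zero)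
    next
      case False
      \<comment> \<open>\<open>U i\<close> and its shift contribute one \<open>U i $ m\<close> each,
        the only unknowns of degree \<open>m\<close>; \<open>X i $ m\<close> is related by
        hypothesis and is absorbed.\<close>
      have low: "R (((X i * (U i * z_shift (- 1) (U i))) $ m - (U i $ m + U i $ m)))
          ((X' i * (V i * z_shift (- 1) (V i))) $ m - (V i $ m + V i $ m))" if i: "i \<in> {1..n}" for i
      proof -
        have IH: "R (U i $ k) (V i $ k)" if "k < m" for k using less.IH[OF that, of i] i by simp
        have U0': "U i $ 0 = 1" "V i $ 0 = 1" using U0 V0 i by auto
        have sh: "R (z_shift (- 1) (U i) $ k) (z_shift (- 1) (V i) $ k)" if "k < m" for k
          by (rule shift_lt[OF IH that])
        note 2 = mult_low[OF IH sh]
        have pr: "R ((U i * z_shift (- 1) (U i)) $ k) ((V i * z_shift (- 1) (V i)) $ k)"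
            if "k < m" for k
          by (rule mult_lt[OF IH sh that])
        note 3 = mult_low[OF R[OF i] pr]
        have "R ((X i * (U i * z_shift (- 1) (U i))) $ m - (X i $ m
            + (U i * z_shift (- 1) (U i)) $ m))
            ((X' i * (V i * z_shift (- 1) (V i))) $ m - (X' i $ m + (V i * z_shift (- 1) (V i)) $ m))"
          using 3 False X i U0' by simp
        moreover have "R ((U i * z_shift (- 1) (U i)) $ m - (U i $ m + z_shift (- 1) (U i) $ m))
            ((V i * z_shift (- 1) (V i)) $ m - (V i $ m + z_shift (- 1) (V i) $ m))"
          using 2 False U0' by simp
        moreover have "R (z_shift (- 1) (U i) $ m - U i $ m) (z_shift (- 1) (V i) $ m - V i $ m)"
          by (rule shift_low[OF IH])
        ultimately have "R
          (((X i * (U i * z_shift (- 1) (U i))) $ m - (X i $ m + (U i * z_shift (- 1) (U i)) $ m))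
            + (((U i * z_shift (- 1) (U i)) $ m - (U i $ m + z_shift (- 1) (U i) $ m))
            + ((z_shift (- 1) (U i) $ m - U i $ m) + X i $ m)))
          (((X' i * (V i * z_shift (- 1) (V i))) $ m - (X' i $ m + (V i * z_shift (- 1) (V i)) $ m))
            + (((V i * z_shift (- 1) (V i)) $ m - (V i $ m + z_shift (- 1) (V i) $ m))
            + ((z_shift (- 1) (V i) $ m - V i $ m) + X' i $ m)))"
          by (intro add R[OF i])
        then show ?thesis by (simp add: algebra_simps)
      qed
      have low': "R ((z_shift (- 1 / 2) (U (i - 1)) * z_shift (- 1 / 2) (U (i + 1))) $ m
            - (U (i - 1) $ m + U (i + 1) $ m))
          ((z_shift (- 1 / 2) (V (i - 1)) * z_shift (- 1 / 2) (V (i + 1))) $ m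
            - (V (i - 1) $ m + V (i + 1) $ m))" if i: "i \<in> {1..n}" for i
      proof -
        have IH: "R (U j $ k) (V j $ k)" if "k < m" "j \<in> {i - 1, i + 1}" for k j
          using less.IH[OF that(1), of j] that i by auto
        have sh: "R (z_shift (- 1 / 2) (U j) $ k) (z_shift (- 1 / 2) (V j) $ k)"
          if "j \<in> {i - 1, i + 1}" "k < m" for j k
          by (rule shift_lt[OF IH that(2)]) (use that in auto)
        have 1: "R (z_shift (- 1 / 2) (U (i - 1)) $ m - U (i - 1) $ m) (z_shift (- 1 / 2) (V (i - 1)) $ m - V (i - 1) $ m)"
          and 2: "R (z_shift (- 1 / 2) (U (i + 1)) $ m - U (i + 1) $ m) (z_shift (- 1 / 2) (V (i + 1)) $ m - V (i + 1) $ m)"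
          using IH by (auto intro!: shift_low)
        note 3 = mult_low[OF sh[of "i - 1"] sh[of "i + 1"]]
        have "R ((z_shift (- 1 / 2) (U (i - 1)) * z_shift (- 1 / 2) (U (i + 1))) $ m
            - (z_shift (- 1 / 2) (U (i - 1)) $ m + z_shift (- 1 / 2) (U (i + 1)) $ m))
          ((z_shift (- 1 / 2) (V (i - 1)) * z_shift (- 1 / 2) (V (i + 1))) $ m
            - (z_shift (- 1 / 2) (V (i - 1)) $ m + z_shift (- 1 / 2) (V (i + 1)) $ m))"
        proof (rule 3)
          have "i - 1 \<le> n + 1" "i + 1 \<le> n + 1" using i by auto
          then show "z_shift (- 1 / 2) (U (i - 1)) $ 0 = 1" "z_shift (- 1 / 2) (U (i + 1)) $ 0 = 1"
            "z_shift (- 1 / 2) (V (i - 1)) $ 0 = 1" "z_shift (- 1 / 2) (V (i + 1)) $ 0 = 1"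
            using U0 V0 by (simp_all del: One_nat_def)
        qed (use False in auto)
        from add[OF add[OF this 1] 2] show ?thesis by (simp add: algebra_simps)
      qed
      have "R (U (i - 1) $ m + U (i + 1) $ m - (U i $ m + U i $ m))
          (V (i - 1) $ m + V (i + 1) $ m - (V i $ m + V i $ m))" if i: "i \<in> {1..n}" for i
        using diff[OF low[OF i] low'[OF i]] unfolding eqU[OF i] eqV[OF i] by (simp add: algebra_simps)
      from second_difference[where d = "\<lambda>i. U i $ m" and e = "\<lambda>i. V i $ m" and n = n, OF _ _ _ _ this]
      show ?thesis using False less.prems U V by auto
    qed
  qed
  then show ?thesis using i by simp
qed

lemma binomial:
  assumes "binomial_recursion a G" "binomial_recursion b G'" "R a b"
  shows "R (G $ m) (G' $ m)"
proof (induction m)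
  case 0
  then show ?case using assms one by (simp add: binomial_recursion_def)
next
  case (Suc m)
  have "R (of_nat (Suc m) *\<^sub>C (G $ Suc m)) (of_nat (Suc m) *\<^sub>C (G' $ Suc m))"
    using assms Suc unfolding binomial_recursion_def by (auto intro!: diff minus mult scale)
  from scale[OF this, of "1 / of_nat (Suc m)"] show ?case
    by (simp add: scaleC_scaleC del: of_nat_Suc)
qed

text \<open>
  In degree \<open>m + 1\<close> the terms \<open>S\<^sub>m\<^sub>+\<^sub>1\<close> cancel, and so do the terms \<open>S\<^sub>m a\<^sub>0\<close> because \<open>G\<^sub>1 = - a\<^sub>0\<close>;
  what remains is \<open>- m S\<^sub>m\<close>, coming from the shift.
\<close>

lemma shift_equation:
  assumes S: "S $ 0 = 1" "S' $ 0 = 1"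
    and H: "H $ 0 = 1" "H' $ 0 = 1" "H $ 1 = 0" "H' $ 1 = 0" "\<And>m. R (H $ m) (H' $ m)"
    and eq: "z_shift 1 S = S * H" "z_shift 1 S' = S' * H'"
  shows "R (S $ m) (S' $ m)"
proof (induction m rule: less_induct)
  case (less m)
  show ?case
  proof (cases "m = 0")
    case True
    then show ?thesis using S one by simp
  next
    case False
    have *: "(- of_nat m) *\<^sub>C (S $ m)
        = (\<Sum>k<m. S $ k * H $ (Suc m - k)) - (\<Sum>k<m. (shift_power 1 k $ Suc m) *\<^sub>C (S $ k))"
      if "H $ 0 = 1" "H $ 1 = 0" "z_shift 1 S = S * H" for S H :: "'c::complex_algebra_1 fps"
    proof -
      have "z_shift 1 S $ Suc m
          = S $ Suc m + ((- of_nat m) *\<^sub>C (S $ m) + (\<Sum>k<m. (shift_power 1 k $ Suc m) *\<^sub>C (S $ k)))"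
        by (simp add: z_shift_split shift_power_nth)
      moreover have "(S * H) $ Suc m = S $ Suc m + (\<Sum>k<m. S $ k * H $ (Suc m - k))"
        using that False
        by (simp add: fps_mult_nth atLeast0AtMost flip: lessThan_Suc_atMost)
      ultimately show ?thesis using that(3) by (simp add: algebra_simps)
    qed
    have "R ((- of_nat m) *\<^sub>C (S $ m)) ((- of_nat m) *\<^sub>C (S' $ m))"
      unfolding *[OF H(1,3) eq(1)] *[OF H(2,4) eq(2)] using less H(5)
      by (intro diff sum mult scale) auto
    from scale[OF this, of "- 1 / of_nat m"] False show ?thesis by (simp add: scaleC_scaleC)
  qed
qed

end


section \<open>Moving Cartan elements past a sequence of root vectors\<close>

lemma poly_mapping_single_induct [case_names single add]:
  fixes p :: "'m::monoid_add \<Rightarrow>\<^sub>0 'c::ring_1"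
  assumes "\<And>w c. P (Poly_Mapping.single w c)" "\<And>p q. P p \<Longrightarrow> P q \<Longrightarrow> P (p + q)"
  shows "P p"
proof (induction p rule: Poly_Mapping.update_induct)
  case const
  show ?case using assms(1)[of 0 0] by simp
next
  case (update f a b)
  have "Poly_Mapping.update a b f = f + Poly_Mapping.single a b"
    using update(1) by (intro poly_mapping_eqI)
      (auto simp: lookup_update lookup_add lookup_single in_keys_iff when_def)
  then show ?case using assms update by simp
qed

text \<open>
  An element \<open>p\<close> of \<open>nat \<Rightarrow>\<^sub>0 'a\<close> is a polynomial in a central variable \<open>tau\<close>, and it acts on a
  sequence \<open>x\<close> from the right, \<open>tau\<close> acting by \<open>x\<^sub>p \<mapsto> x\<^sub>p\<^sub>+\<^sub>1\<close>.  Then \<open>exchange x h p\<close> says that moving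
  \<open>h\<close> to the right past \<open>x\<close> turns it into \<open>p\<close>.
\<close>

instantiation poly_mapping :: (monoid_add, complex_algebra_1) complex_algebra_1
begin

definition scaleC_poly_mapping :: "complex \<Rightarrow> ('a \<Rightarrow>\<^sub>0 'b) \<Rightarrow> ('a \<Rightarrow>\<^sub>0 'b)" where
  "c *\<^sub>C p = Poly_Mapping.single 0 (c *\<^sub>C 1) * p"

instance
proof
  fix x y :: "'a \<Rightarrow>\<^sub>0 'b" and c d :: complex
  have central: "Poly_Mapping.single 0 (c *\<^sub>C 1) * p = p * Poly_Mapping.single 0 (c *\<^sub>C 1)"
    for p :: "'a \<Rightarrow>\<^sub>0 'b" and c
    by (induction p rule: poly_mapping_single_induct)
      (simp_all add: mult_single distrib_left distrib_right scaleC_simps)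
  show "c *\<^sub>C (x + y) = c *\<^sub>C x + c *\<^sub>C y"
    by (simp add: scaleC_poly_mapping_def distrib_left)
  show "(c + d) *\<^sub>C x = c *\<^sub>C x + d *\<^sub>C x"
    by (simp add: scaleC_poly_mapping_def distrib_right scaleC_add_left single_add)
  show "c *\<^sub>C d *\<^sub>C x = (c * d) *\<^sub>C x"
    by (simp add: scaleC_poly_mapping_def scaleC_simps mult_single mult.commute[of d] flip: mult.assoc)
  show "1 *\<^sub>C x = x"
    by (simp add: scaleC_poly_mapping_def)
  show "c *\<^sub>C x * y = c *\<^sub>C (x * y)"
    by (simp add: scaleC_poly_mapping_def mult.assoc)
  show "x * c *\<^sub>C y = c *\<^sub>C (x * y)"
    unfolding scaleC_poly_mapping_def mult.assoc[symmetric] central[of c x] ..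
qed

end

abbreviation const_poly :: "'a::complex_algebra_1 \<Rightarrow> nat \<Rightarrow>\<^sub>0 'a" where
  "const_poly \<equiv> Poly_Mapping.single 0"

definition tau :: "nat \<Rightarrow>\<^sub>0 'a::complex_algebra_1" where
  "tau = Poly_Mapping.single 1 1"

lemma tau_central: "tau * p = p * tau"
  by (induction p rule: poly_mapping_single_induct)
    (simp_all add: mult_single distrib_left distrib_right tau_def)

lemma const_poly_hom: "algebra_hom const_poly"
  by (simp add: algebra_hom_def single_add mult_single scaleC_poly_mapping_def mult_scaleC_left)

definition act :: "(nat \<Rightarrow> 'a::complex_algebra_1) \<Rightarrow> nat \<Rightarrow> (nat \<Rightarrow>\<^sub>0 'a) \<Rightarrow> 'a" where
  "act x p \<psi> = (\<Sum>q\<in>Poly_Mapping.keys \<psi>. x (p + q) * Poly_Mapping.lookup \<psi> q)"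

lemma act_superset:
  "finite K \<Longrightarrow> Poly_Mapping.keys \<psi> \<subseteq> K \<Longrightarrow> act x p \<psi> = (\<Sum>q\<in>K. x (p + q) * Poly_Mapping.lookup \<psi> q)"
  unfolding act_def by (rule sum.mono_neutral_left) (auto simp: in_keys_iff)

lemma act_add: "act x p (\<psi> + \<phi>) = act x p \<psi> + act x p \<phi>"
  using Poly_Mapping.keys_add[of \<psi> \<phi>]
  by (simp add: act_superset[of "Poly_Mapping.keys \<psi> \<union> Poly_Mapping.keys \<phi>"] lookup_add
      distrib_left sum.distrib)

lemma act_single: "act x p (Poly_Mapping.single q c) = x (p + q) * c"
  by (simp add: act_def)

lemma act_scaleC: "act x p (c *\<^sub>C \<psi>) = c *\<^sub>C act x p \<psi>"
  by (induction \<psi> rule: poly_mapping_single_induct)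
    (simp_all add: act_single act_add scaleC_add_right scaleC_poly_mapping_def mult_single
      distrib_left mult_scaleC_left mult_scaleC_right)

lemma act_uminus: "act x p (- \<psi>) = - act x p \<psi>"
  using act_scaleC[of x p "- 1" \<psi>] by simp

lemma act_diff: "act x p (\<psi> - \<phi>) = act x p \<psi> - act x p \<phi>"
  using act_add[of x p \<psi> "- \<phi>"] by (simp add: act_uminus)

lemma act_tau: "act x p (tau * \<psi>) = act x (Suc p) \<psi>"
  by (induction \<psi> rule: poly_mapping_single_induct)
    (simp_all add: act_single act_add tau_def mult_single distrib_left)

lemma act_mult_single: "act x p (\<psi> * Poly_Mapping.single q c) = act x (p + q) \<psi> * c"
  by (induction \<psi> rule: poly_mapping_single_induct)
    (simp_all add: act_single act_add mult_single distrib_right mult.assoc add_ac)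

definition exchange :: "(nat \<Rightarrow> 'a::complex_algebra_1) \<Rightarrow> 'a \<Rightarrow> (nat \<Rightarrow>\<^sub>0 'a) \<Rightarrow> bool" where
  "exchange x h \<psi> \<longleftrightarrow> (\<forall>p. h * x p = act x p \<psi>)"

lemma exchange_act: "exchange x h \<psi> \<Longrightarrow> h * act x p \<phi> = act x p (\<psi> * \<phi>)"
  by (induction \<phi> rule: poly_mapping_single_induct)
    (simp_all add: act_single act_add act_mult_single exchange_def distrib_left flip: mult.assoc)

text \<open>For a product, h' is moved past the sequence first and h afterwards. The index shifts
  add up and the coefficients multiply as \<psi> \<psi>', because coefficients are written to the
  right of x.\<close>

lemma algebra_rel_exchange: "algebra_rel (exchange x)"
proof
  show "exchange x 1 1"
    by (simp add: exchange_def act_single flip: single_one)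
  show "exchange x (h * h') (\<psi> * \<psi>')" if "exchange x h \<psi>" "exchange x h' \<psi>'" for h \<psi> h' \<psi>'
    using that(2) exchange_act[OF that(1)] by (simp add: exchange_def mult.assoc)
qed (auto simp: exchange_def distrib_right act_add act_scaleC mult_scaleC_left)

lemma exchange_const: "exchange x h (const_poly h) \<longleftrightarrow> (\<forall>p. bracket h (x p) = 0)"
  by (simp add: exchange_def act_single bracket_eq_0_iff)


text \<open>In terms of \<open>z\<close>, \<open>ell c\<close> is \<open>(z - tau - c) / z\<close> and \<open>geo c\<close> is its inverse.\<close>

definition ell :: "complex \<Rightarrow> (nat \<Rightarrow>\<^sub>0 'a::complex_algebra_1) fps" where
  "ell c = 1 - fps_const (tau + c *\<^sub>C 1) * fps_X"

definition geo :: "complex \<Rightarrow> (nat \<Rightarrow>\<^sub>0 'a::complex_algebra_1) fps" where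
  "geo c = Abs_fps (\<lambda>m. (tau + c *\<^sub>C 1) ^ m)"

text \<open>The fraction (z - tau - c) / (z - tau - d). All factors produced by moving Cartan series
  past root vectors have this form.\<close>

definition ratio :: "complex \<Rightarrow> complex \<Rightarrow> (nat \<Rightarrow>\<^sub>0 'a::complex_algebra_1) fps" where
  "ratio c d = ell c * geo d"

lemma fps_const_central:
  fixes F :: "'a::ring_1 fps"
  assumes "\<And>y. a * y = y * a"
  shows "fps_const a * F = F * fps_const a"
  by (simp add: fps_eq_iff assms)

lemma fps_X_central: "fps_X * F = F * (fps_X :: 'a::ring_1 fps)"
  by (simp add: fps_eq_iff)

lemma fps_const_X_central:
  fixes F :: "'a::ring_1 fps"
  assumes "\<And>y. a * y = y * a"
  shows "fps_const a * fps_X * F = F * (fps_const a * fps_X)"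
proof -
  have "fps_const a * fps_X * F = (fps_const a * F) * fps_X"
    by (simp only: mult.assoc fps_X_central[of F])
  then show ?thesis by (simp only: fps_const_central[OF assms] mult.assoc)
qed

lemma tau_shift_central: "(tau + c *\<^sub>C 1) * p = p * (tau + c *\<^sub>C 1)"
  by (simp add: distrib_left distrib_right tau_central mult_scaleC_left mult_scaleC_right)

lemma ell_central: "ell c * F = F * ell c"
proof -
  have "fps_const (tau + c *\<^sub>C 1) * fps_X * F = F * (fps_const (tau + c *\<^sub>C 1) * fps_X)"
    by (rule fps_const_X_central[OF tau_shift_central])
  then show ?thesis by (simp add: ell_def algebra_simps)
qed

lemma ell_geo: "ell c * geo c = 1"
proof (rule fps_ext)
  fix m show "(ell c * geo c) $ m = 1 $ m"
    by (cases m) (simp_all add: ell_def geo_def left_diff_distrib mult.assoc)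
qed

lemma geo_ell: "geo c * ell c = 1"
  using ell_geo ell_central by metis

lemma geo_central: "geo c * F = F * geo c"
proof -
  have "geo c * F = geo c * (F * ell c) * geo c"
    by (simp add: mult.assoc ell_geo)
  also have "\<dots> = (geo c * ell c) * F * geo c"
    by (simp only: ell_central[of c F, symmetric] mult.assoc)
  finally show ?thesis by (simp add: geo_ell)
qed

lemma ratio_central: "ratio c d * F = F * ratio c d"
proof -
  have "ratio c d * F = (ell c * F) * geo d"
    by (simp only: ratio_def mult.assoc geo_central[of d F])
  then show ?thesis by (simp only: ell_central[of c F] ratio_def mult.assoc)
qed

lemma ratio_left_commute: "ratio c d * (F * G) = F * (ratio c d * G)"
  by (simp only: mult.assoc[symmetric] ratio_central[of c d F])

lemma ratio_trans: "ratio b c * ratio c d = ratio b d"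
proof -
  have "ratio b c * ratio c d = ell b * (geo c * ell c) * geo d"
    by (simp only: ratio_def mult.assoc)
  then show ?thesis by (simp add: geo_ell ratio_def)
qed

lemma ratio_same: "ratio c c = 1"
  by (simp add: ratio_def ell_geo)

lemma ratio_nth_0: "ratio c d $ 0 = 1"
  by (simp add: ratio_def ell_def geo_def)

lemma ratio_nth_1: "ratio c d $ 1 = (d - c) *\<^sub>C 1"
proof -
  have "{0..1::nat} = {0, 1}" by auto
  then show ?thesis by (simp add: ratio_def ell_def geo_def fps_mult_nth scaleC_simps)
qed

lemma mult_ell_nth_Suc: "(F * ell c) $ Suc m = F $ Suc m - (tau + c *\<^sub>C 1) * F $ m"
proof -
  have "F $ m * (tau + c *\<^sub>C 1) = (tau + c *\<^sub>C 1) * F $ m"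
    by (rule tau_shift_central[symmetric])
  then show ?thesis by (simp add: ell_def right_diff_distrib flip: mult.assoc)
qed

text \<open>The fraction (z + d) / z, which restores the denominator z after \<open>ell\<close> has
  been translated by d.\<close>

definition shift_unit :: "complex \<Rightarrow> 'a::complex_algebra_1 fps" where
  "shift_unit d = 1 + fps_const (d *\<^sub>C 1) * fps_X"

lemma z_shift_diff: "z_shift c (F - G) = z_shift c F - z_shift c G"
  by (simp add: fps_eq_iff z_shift_def scaleC_simps sum_subtractf)

lemma z_shift_const_mult: "z_shift c (fps_const a * F) = fps_const a * z_shift c F"
  by (simp add: fps_eq_iff z_shift_def mult_scaleC_right sum_distrib_left)

lemma z_shift_X: "z_shift d fps_X * shift_unit d = (fps_X :: 'a::complex_algebra_1 fps)"
proof -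
  have "(- 1 gchoose k) = ((- 1) ^ k :: complex)" for k
    by (simp add: gbinomial_pochhammer flip: pochhammer_fact)
  then have X: "z_shift d (fps_X :: 'a fps) $ Suc m = ((- d) ^ m) *\<^sub>C 1" for m
    by (simp add: z_shift_nth[OF order_refl] fps_X_def if_distrib shift_power_nth
        flip: power_mult_distrib cong: if_cong)
  show ?thesis
  proof (rule fps_ext)
    fix m show "(z_shift d fps_X * shift_unit d) $ m = (fps_X :: 'a fps) $ m"
    proof (cases m)
      case (Suc k)
      then show ?thesis
        by (cases k) (simp_all add: shift_unit_def distrib_left X scaleC_simps flip: mult.assoc)
    qed (simp add: shift_unit_def)
  qed
qed

lemma z_shift_ell: "z_shift d (ell u) * shift_unit d = ell (u - d)"
proof -
  have "z_shift d (ell u) * shift_unit d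
      = shift_unit d - fps_const (tau + u *\<^sub>C 1) * (z_shift d fps_X * shift_unit d)"
    by (simp add: ell_def z_shift_diff z_shift_const_mult left_diff_distrib mult.assoc)
  also have "\<dots> = ell (u - d)"
    unfolding z_shift_X
    by (simp add: ell_def shift_unit_def scaleC_simps algebra_simps flip: fps_const_add fps_const_sub)
  finally show ?thesis .
qed

lemma z_shift_geo:
  "z_shift d (geo v) = (shift_unit d * geo (v - d) :: (nat \<Rightarrow>\<^sub>0 'a::complex_algebra_1) fps)"
proof -
  have "z_shift d (geo v) * z_shift d (ell v) = (1 :: (nat \<Rightarrow>\<^sub>0 'a) fps)"
    by (simp add: geo_ell flip: z_shift_mult)
  then have "z_shift d (geo v) * (z_shift d (ell v) * shift_unit d) * geo (v - d)
      = (shift_unit d * geo (v - d) :: (nat \<Rightarrow>\<^sub>0 'a) fps)"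
    by (simp only: mult.assoc[symmetric] mult_1)
  then show ?thesis
    unfolding z_shift_ell by (simp add: mult.assoc ell_geo)
qed

lemma z_shift_ratio: "z_shift d (ratio u v) = ratio (u - d) (v - d)"
  unfolding ratio_def z_shift_mult z_shift_geo by (simp add: z_shift_ell flip: mult.assoc)


section \<open>Exchange relations of the GKLO-series and S-series\<close>

lemma xi_series_nth: "xi_series i $ 0 = 1" "xi_series i $ Suc m = xi_gen i m"
  by (simp_all add: xi_series_def)

text \<open>The relation for \<xi>_{i,0} becomes the case m = 0 of the general one: the constant
  term 1 of the series acts as a central \<xi>_{i,-1}.\<close>

lemma xi_series_step:
  fixes i j :: nat
  fixes s :: pm
  assumes "i \<in> {1..CARD('n::finite)}" "j \<in> {1..CARD('n)}"
  defines "a \<equiv> pm_sgn s * ycartan i j / 2"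
  shows "bracket (xi_series i $ Suc m) (x_gen s j p) - bracket (xi_series i $ m) (x_gen s j (Suc p))
    = a *\<^sub>C (xi_series i $ m * x_gen s j p + x_gen s j p * xi_series i $ m :: 'n yangian)"
proof (cases m)
  case 0
  then show ?thesis
    by (simp add: xi_series_nth xi_zero_x[OF assms(1,2)] a_def scaleC_add_right flip: scaleC_add_left)
next
  case (Suc k)
  then show ?thesis
    by (simp add: xi_series_nth xi_x_step[OF assms(1,2)] a_def)
qed

text \<open>The defining relations in generating form: past x^s_j, the series \<xi>_i(z) acquires
  the factor (z - tau + a) / (z - tau - a), where a is s c_ij / 2.\<close>

definition xi_exchanged :: "pm \<Rightarrow> nat \<Rightarrow> nat \<Rightarrow> (nat \<Rightarrow>\<^sub>0 'n::finite yangian) fps" where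
  "xi_exchanged s j i = fps_map const_poly (xi_series i)
     * ratio (- (pm_sgn s * ycartan i j / 2)) (pm_sgn s * ycartan i j / 2)"

lemma xi_exchanged:
  fixes i j :: nat
  assumes "i \<in> {1..CARD('n::finite)}" "j \<in> {1..CARD('n)}"
  shows "exchange (x_gen s j) (xi_series i $ m :: 'n yangian) (xi_exchanged s j i $ m)"
proof (induction m)
  case 0
  then show ?case
    using algebra_rel.one[OF algebra_rel_exchange] by (simp add: xi_exchanged_def xi_series_nth ratio_nth_0)
next
  case (Suc m)
  define a where "a = pm_sgn s * ycartan i j / 2"
  let ?X = "xi_exchanged s j i :: (nat \<Rightarrow>\<^sub>0 'n yangian) fps"
  let ?C = "fps_map const_poly (xi_series i) :: (nat \<Rightarrow>\<^sub>0 'n yangian) fps"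
  \<comment> \<open>Clearing the denominator z - tau - a leaves a one-step recursion in the degree,
    which is \<open>xi_series_step\<close>.\<close>
  have "?X * ell a = ?C * ell (- a)"
    by (simp add: xi_exchanged_def ratio_def a_def mult.assoc geo_ell)
  then have "(?X * ell a) $ Suc m = (?C * ell (- a)) $ Suc m" by simp
  then have X: "?X $ Suc m
      = tau * ?X $ m + a *\<^sub>C (?X $ m) + ?C $ Suc m - tau * ?C $ m + a *\<^sub>C (?C $ m)"
    unfolding mult_ell_nth_Suc by (simp add: algebra_simps scaleC_simps)
  show ?case unfolding exchange_def
  proof
    fix p
    let ?x = "x_gen s j :: nat \<Rightarrow> 'n yangian" and ?h = "\<lambda>m. xi_series i $ m :: 'n yangian"
    have IH: "act ?x p (?X $ m) = ?h m * ?x p" for p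
      using Suc unfolding exchange_def by simp
    have "act ?x p (?X $ Suc m) = ?h m * ?x (Suc p) + a *\<^sub>C (?h m * ?x p) + ?x p * ?h (Suc m)
        - ?x (Suc p) * ?h m + a *\<^sub>C (?x p * ?h m)"
      unfolding X by (simp add: act_add act_diff act_scaleC act_tau act_single IH)
    also have "\<dots> = ?h (Suc m) * ?x p"
      using xi_series_step[OF assms, of m s p]
      by (simp add: bracket_def a_def scaleC_add_right algebra_simps)
    finally show "?h (Suc m) * ?x p = act ?x p (?X $ Suc m)" ..
  qed
qed

text \<open>The solution of the GKLO equations with \<open>xi_exchanged\<close> as input: A_i
  acquires (z - tau) / (z - tau + 1) past x^+_i, the inverse fraction past x^-_i, and nothing past
  x_j for j \<noteq> i.\<close>

definition A_exchanged :: "(nat \<Rightarrow> 'n::finite yangian fps) \<Rightarrow> pm \<Rightarrow> nat \<Rightarrow> nat \<Rightarrow> (nat \<Rightarrow>\<^sub>0 'n yangian) fps" where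
  "A_exchanged A s j i = fps_map const_poly (A i)
     * (if i = j then (case s of Plus \<Rightarrow> ratio 0 (- 1) | Minus \<Rightarrow> ratio (- 1) 0) else 1)"

lemma mult_ratio_mult:
  "P * ratio a b * ((Q * ratio c d) * (S * ratio e f))
      = P * (Q * S) * (ratio a b * (ratio c d * ratio e f))"
  by (simp only: mult.assoc ratio_left_commute[of c d S] ratio_left_commute[of a b Q] ratio_left_commute[of a b S])

text \<open>The fractions balance: for j = i the three on the left telescope to 1; for neighbouring
  nodes the fraction of \<xi>_i equals that of A_j translated by -1/2; otherwise none
  occurs.\<close>

lemma A_exchanged_GKLO:
  fixes i j :: nat
  assumes A: "GKLO_series (A :: nat \<Rightarrow> 'n::finite yangian fps)"
    and i: "i \<in> {1..CARD('n)}" and j: "j \<in> {1..CARD('n)}"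
  shows "xi_exchanged s j i * (A_exchanged A s j i * z_shift (- 1) (A_exchanged A s j i))
    = z_shift (- 1 / 2) (A_exchanged A s j (i - 1)) * z_shift (- 1 / 2) (A_exchanged A s j (i + 1))"
proof -
  let ?c = "fps_map const_poly :: 'n yangian fps \<Rightarrow> _"
  have eq: "xi_series i * (A i * z_shift (- 1) (A i))
      = z_shift (- 1 / 2) (A (i - 1)) * z_shift (- 1 / 2) (A (i + 1))"
    using A i by (auto simp: GKLO_series_def)
  note hom = fps_map_hom[OF const_poly_hom]
  have eq': "?c (xi_series i) * (?c (A i) * z_shift (- 1) (?c (A i)))
      = z_shift (- 1 / 2) (?c (A (i - 1))) * z_shift (- 1 / 2) (?c (A (i + 1)))"
    unfolding hom[symmetric] eq ..
  consider "i = j" | "i = Suc j" | "j = Suc i" | "i \<noteq> j" "cartan i j = 0" "i \<noteq> Suc j" "j \<noteq> Suc i"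
    by (auto simp: cartan_def)
  then show ?thesis
  proof cases
    case 1
    have ne: "i - 1 \<noteq> i" using i by auto
    show ?thesis
    proof (cases s)
      case Plus
      have "ratio (- 1) 1 * (ratio 0 (- 1) * ratio 1 0) = (1 :: (nat \<Rightarrow>\<^sub>0 'n yangian) fps)"
        by (simp only: ratio_central[of 0 "- 1" "ratio 1 0"] ratio_trans ratio_same)
      then show ?thesis using 1 ne Plus eq'
        by (simp add: xi_exchanged_def A_exchanged_def z_shift_mult z_shift_ratio mult_ratio_mult)
    next
      case Minus
      have "ratio 1 (- 1) * (ratio (- 1) 0 * ratio 0 1) = (1 :: (nat \<Rightarrow>\<^sub>0 'n yangian) fps)"
        by (simp add: ratio_trans ratio_same)
      then show ?thesis using 1 ne Minus eq'
        by (simp add: xi_exchanged_def A_exchanged_def z_shift_mult z_shift_ratio mult_ratio_mult)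
    qed
  next
    case 2
    have move: "P * ratio c d * T = P * T * ratio c d" for P T :: "(nat \<Rightarrow>\<^sub>0 'n yangian) fps" and c d
      by (simp only: mult.assoc ratio_central[of c d T])
    show ?thesis using 2 eq'
      by (cases s) (simp_all add: xi_exchanged_def A_exchanged_def z_shift_mult z_shift_ratio move)
  next
    case 3
    define h where "h = pm_sgn s / 2"
    have xi: "xi_exchanged s j i = ?c (xi_series i) * ratio h (- h)"
      using 3 by (simp add: xi_exchanged_def h_def)
    have f: "z_shift (- 1 / 2) (case s of Plus \<Rightarrow> ratio 0 (- 1) | Minus \<Rightarrow> ratio (- 1) 0)
        = (ratio h (- h) :: (nat \<Rightarrow>\<^sub>0 'n yangian) fps)"
      by (cases s) (simp_all add: z_shift_ratio h_def)
    have Ai: "A_exchanged A s j i = ?c (A i)" "A_exchanged A s j (i - 1) = ?c (A (i - 1))"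
      using 3 by (auto simp: A_exchanged_def)
    have Aj: "z_shift (- 1 / 2) (A_exchanged A s j (i + 1))
        = z_shift (- 1 / 2) (?c (A (i + 1))) * ratio h (- h)"
      unfolding A_exchanged_def z_shift_mult using f 3 by simp
    show ?thesis
      unfolding xi Ai Aj mult.assoc[of "?c (xi_series i)"] ratio_central[of h "- h"]
      unfolding mult.assoc[symmetric] eq'[unfolded mult.assoc[symmetric]] ..
  next
    case 4
    have "i - 1 \<noteq> j" using 4 i by auto
    then show ?thesis using 4 eq'
      by (simp add: xi_exchanged_def A_exchanged_def ratio_same)
  qed
qed

lemma A_exchanged:
  fixes i j :: nat
  assumes A: "GKLO_series (A :: nat \<Rightarrow> 'n::finite yangian fps)"
    and i: "i \<in> {1..CARD('n)}" and j: "j \<in> {1..CARD('n)}"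
  shows "exchange (x_gen s j) (A i $ m) (A_exchanged A s j i $ m)"
proof -
  interpret algebra_rel "exchange (x_gen s j :: nat \<Rightarrow> 'n yangian)" by (rule algebra_rel_exchange)
  note A' = A[unfolded GKLO_series_def]
  have nth0: "A_exchanged A s j i $ 0 = 1" if "i \<in> {1..CARD('n)}" for i
    using A' that by (auto simp: A_exchanged_def ratio_nth_0 split: pm.split)
  show ?thesis
  proof (rule GKLO[where n = "CARD('n)" and U = A and V = "A_exchanged A s j" and X = xi_series
        and X' = "xi_exchanged s j"])
    show "A_exchanged A s j 0 = 1" "A_exchanged A s j (CARD('n) + 1) = 1"
      using A' j by (auto simp: A_exchanged_def fps_map_hom[OF const_poly_hom])
  qed (use A' i j nth0 A_exchanged_GKLO[OF A _ j] xi_exchanged[OF _ j] in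
      \<open>auto simp: xi_series_nth xi_exchanged_def ratio_nth_0\<close>)
qed

lemma binomial_recursion_hom:
  "algebra_hom f \<Longrightarrow> binomial_recursion a G \<Longrightarrow> binomial_recursion (f a) (fps_map f G)"
  by (simp add: binomial_recursion_def fps_map_nth del: of_nat_Suc
      flip: algebra_homD(1,3,4,6,7)[of f])

text \<open>a_0 is the coefficient of z^-1 in A_i, so the correction factor (1 + z^-1)^-a_0 is
  determined by A_i itself and the logarithm can be discarded.\<close>

lemma S_seriesE:
  assumes "S_series A (S :: nat \<Rightarrow> 'n::finite yangian fps)" "i \<in> {1..CARD('n)}"
  obtains G where "S i $ 0 = 1" "binomial_recursion (A i $ 1) G" "z_shift 1 (S i) = S i * (A i * G)"
proof -
  from assms obtain a where *: "S i $ 0 = 1" "A i = fps_exponential (fps_X * Abs_fps a)"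
    "z_shift 1 (S i) = S i * A i * fps_exponential (fps_const (a 0) * neg_log_series)"
    unfolding S_series_def by blast
  have "A i $ 1 = a 0" unfolding *(2) by (rule fps_exponential_X_nth_1)
  then show thesis
    using that[of "fps_exponential (fps_const (a 0) * neg_log_series)"] * binomial_recursion_exp[of "a 0"]
    by (simp add: mult.assoc)
qed

lemma binomial_recursion_nth_1: "binomial_recursion a G \<Longrightarrow> G $ 1 = - a"
  unfolding binomial_recursion_def by (auto dest: spec[of _ 0])

lemma fps_mult_nth_1: "F $ 0 = 1 \<Longrightarrow> G $ 0 = 1 \<Longrightarrow> (F * G) $ 1 = F $ 1 + (G $ 1 :: 'b::ring_1)"
proof -
  have "{0..1::nat} = {0, 1}" by auto
  then show "F $ 0 = 1 \<Longrightarrow> G $ 0 = 1 \<Longrightarrow> (F * G) $ 1 = F $ 1 + G $ 1"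
    by (simp add: fps_mult_nth add.commute)
qed

context
  fixes A S :: "nat \<Rightarrow> 'n::finite yangian fps" and i :: nat
  assumes A: "GKLO_series A" and S: "S_series A S" and i: "i \<in> {1..CARD('n)}"
begin

lemma A_nth_0: "A i $ 0 = 1"
  using A i unfolding GKLO_series_def by blast

text \<open>For j \<noteq> i both A_i and the correction factor exchange with x_j through constant
  polynomials. The equation for S_i passes this on, and a constant polynomial means
  commutation.\<close>

lemma S_commute_x:
  assumes "j \<in> {1..CARD('n)}" "j \<noteq> i"
  shows "bracket (S i $ m) (x_gen s j p) = 0"
proof -
  interpret algebra_rel "exchange (x_gen s j :: nat \<Rightarrow> 'n yangian)" by (rule algebra_rel_exchange)
  let ?c = "fps_map const_poly :: 'n yangian fps \<Rightarrow> _"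
  obtain G where G: "S i $ 0 = 1" "binomial_recursion (A i $ 1) G" "z_shift 1 (S i) = S i * (A i * G)"
    by (rule S_seriesE[OF S i])
  have RA: "exchange (x_gen s j) (A i $ m) (?c (A i) $ m)" for m
    using A_exchanged[OF A i assms(1), of s m] assms(2) by (simp add: A_exchanged_def)
  have RG: "exchange (x_gen s j) (G $ m) (?c G $ m)" for m
    using binomial[OF G(2) binomial_recursion_hom[OF const_poly_hom G(2)]] RA[of 1] by simp
  have RH: "exchange (x_gen s j) ((A i * G) $ m) (?c (A i * G) $ m)" for m
    unfolding fps_map_hom[OF const_poly_hom] by (rule mult_lt[of "Suc m"]) (use RA RG in auto)
  have G0: "G $ 0 = 1" using G(2) by (simp add: binomial_recursion_def)
  have H: "(A i * G) $ 0 = 1" "(A i * G) $ 1 = 0"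
    using A_nth_0 G0 fps_mult_nth_1[OF A_nth_0 G0] binomial_recursion_nth_1[OF G(2)] by simp_all
  have "exchange (x_gen s j) (S i $ m) (?c (S i) $ m)"
  proof (rule shift_equation[OF G(1) _ H(1) _ H(2) _ RH G(3)])
    show "z_shift 1 (?c (S i)) = ?c (S i) * ?c (A i * G)"
      unfolding fps_map_hom[OF const_poly_hom, symmetric] G(3) ..
  qed (use G H in simp_all)
  then show ?thesis by (simp add: exchange_const)
qed

text \<open>The polynomial attached to S_i is the coefficient of S_i(z) f(z) with f(z) = z / (z -
  tau). Indeed, past x^+_i the series A_i gains (z - tau) / (z - tau + 1), and a_0 drops by 1, so
  the correction factor gains (z + 1) / z. The product of both gains is f(z + 1) / f(z).\<close>

lemma S_exchange_x:
  "S i $ Suc m * x_gen Plus i p = S i $ m * x_gen Plus i (Suc p) + x_gen Plus i p * S i $ Suc m"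
proof -
  interpret algebra_rel "exchange (x_gen Plus i :: nat \<Rightarrow> 'n yangian)" by (rule algebra_rel_exchange)
  let ?c = "fps_map const_poly :: 'n yangian fps \<Rightarrow> _"
  obtain G where G: "S i $ 0 = 1" "binomial_recursion (A i $ 1) G" "z_shift 1 (S i) = S i * (A i * G)"
    by (rule S_seriesE[OF S i])
  let ?A = "?c (A i) * ratio 0 (- 1)"
  let ?G = "?c G * (1 + fps_X)"
  let ?S = "?c (S i) * geo 0"
  have RA: "exchange (x_gen Plus i) (A i $ m) (?A $ m)" for m
    using A_exchanged[OF A i i, of Plus m] by (simp add: A_exchanged_def)
  have A'0: "?A $ 0 = 1" by (simp add: A_nth_0 ratio_nth_0)
  have A'1: "?A $ 1 = const_poly (A i $ 1) + (- 1)"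
    by (subst fps_mult_nth_1) (simp_all add: A_nth_0 ratio_nth_0 ratio_nth_1 del: One_nat_def)
  have bG: "binomial_recursion (const_poly (A i $ 1) + (- 1)) ?G"
    by (rule binomial_recursion_mult[OF binomial_recursion_hom[OF const_poly_hom G(2)]
          binomial_recursion_minus_one]) simp
  have RG: "exchange (x_gen Plus i) (G $ m) (?G $ m)" for m
    using binomial[OF G(2) bG] RA[of 1] unfolding A'1 by blast
  have RH: "exchange (x_gen Plus i) ((A i * G) $ m) ((?A * ?G) $ m)" for m
    by (rule mult_lt[of "Suc m"]) (use RA RG in auto)
  have G0: "G $ 0 = 1" "?G $ 0 = 1" using G(2) bG by (simp_all add: binomial_recursion_def)
  have H: "(A i * G) $ 0 = 1" "(A i * G) $ 1 = 0"
    using A_nth_0 G0 fps_mult_nth_1[OF A_nth_0 G0(1)] binomial_recursion_nth_1[OF G(2)] by simp_all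
  have H': "(?A * ?G) $ 1 = 0" "(?A * ?G) $ 0 = 1"
    using fps_mult_nth_1[OF A'0 G0(2)] A'1 binomial_recursion_nth_1[OF bG] A'0 G0(2) by simp_all
  have unit: "shift_unit 1 = (1 + fps_X :: (nat \<Rightarrow>\<^sub>0 'n yangian) fps)"
    by (simp add: shift_unit_def)
  have "exchange (x_gen Plus i) (S i $ m) (?S $ m)" for m
  proof (rule shift_equation[OF G(1) _ H(1) H'(2) H(2) H'(1) RH G(3)])
    have "z_shift 1 ?S = ?c (S i * (A i * G)) * ((1 + fps_X) * geo (- 1))"
      by (simp add: z_shift_mult z_shift_geo unit G(3) flip: fps_map_hom(4)[OF const_poly_hom])
    also have "\<dots> = ?c (S i) * (?c (A i) * ?c G * ((1 + fps_X) * geo (- 1)))"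
      by (simp add: fps_map_hom[OF const_poly_hom] mult.assoc)
    also have "\<dots> = ?c (S i) * (?c (A i) * geo (- 1) * ?G)"
      by (simp only: mult.assoc geo_central[of "- 1" "?c G * (1 + fps_X)"])
    also have "?c (A i) * geo (- 1) = geo 0 * ?A"
    proof -
      have "geo 0 * ?A = ?c (A i) * (geo 0 * ell 0) * geo (- 1)"
        by (simp only: ratio_def mult.assoc[symmetric] geo_central[of 0 "?c (A i)"])
      then show ?thesis by (simp add: geo_ell)
    qed
    also have "?c (S i) * (geo 0 * ?A * ?G) = ?S * (?A * ?G)"
      by (simp add: mult.assoc)
    finally show "z_shift 1 ?S = ?S * (?A * ?G)" .
  qed (simp add: G geo_def)
  then have ex: "S i $ m * x_gen Plus i p = act (x_gen Plus i) p (?S $ m)" for m p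
    by (simp add: exchange_def)
  \<comment> \<open>Multiplying by (z - tau) / z removes the geometric series and leaves the
    two-term relation of the statement.\<close>
  have "?S * ell 0 = ?c (S i)" by (simp add: mult.assoc geo_ell)
  then have "(?S * ell 0) $ Suc m = ?c (S i) $ Suc m" by simp
  then have "?S $ Suc m = tau * ?S $ m + const_poly (S i $ Suc m)"
    unfolding mult_ell_nth_Suc by (simp add: algebra_simps)
  then have "S i $ Suc m * x_gen Plus i p
      = act (x_gen Plus i) (Suc p) (?S $ m) + x_gen Plus i p * S i $ Suc m"
    using ex[of "Suc m" p] by (simp add: act_add act_tau act_single)
  then show ?thesis using ex[of m "Suc p"] by simp
qed

end


section \<open>Root vectors\<close>

lemma elem_in_sl: "a \<in> {1..N} \<Longrightarrow> b \<in> {1..N} \<Longrightarrow> a \<noteq> b \<Longrightarrow> elem a b \<in> sl N"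
  unfolding sl_def elem_def by (auto intro!: sum.neutral)

lemma elem_diff_in_sl:
  assumes "a \<in> {1..N}" "b \<in> {1..N}"
  shows "(\<lambda>x y. elem a a x y - elem b b x y) \<in> sl N"
proof -
  have "(\<Sum>x=1..N. elem a a x x) = 1" if "a \<in> {1..N}" for a
    using that by (simp add: elem_def)
  then show ?thesis
    using assms unfolding sl_def by (auto simp: elem_def sum_subtractf split: if_splits)
qed

lemma mat_mult_elem:
  "b \<in> {1..N} \<Longrightarrow> mat_mult N (elem a b) M = (\<lambda>x y. if x = a then M b y else 0)"
  "a \<in> {1..N} \<Longrightarrow> mat_mult N M (elem a b) = (\<lambda>x y. if y = b then M x a else 0)"
proof -
  have "(\<Sum>c=1..N. elem a b x c * M c y) = (\<Sum>c=1..N. if c = b then (if x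
      = a then M b y else 0) else 0)"
    and "(\<Sum>c=1..N. M x c * elem a b c y) = (\<Sum>c=1..N. if c = a then (if y = b then M x a else 0) else 0)"
    for x y by (rule sum.cong; auto simp: elem_def)+
  then show "b \<in> {1..N} \<Longrightarrow> mat_mult N (elem a b) M = (\<lambda>x y. if x = a then M b y else 0)"
    "a \<in> {1..N} \<Longrightarrow> mat_mult N M (elem a b) = (\<lambda>x y. if y = b then M x a else 0)"
    by (simp_all add: mat_mult_def fun_eq_iff)
qed

lemma mat_mult_elem_elem:
  "b \<in> {1..N} \<Longrightarrow> mat_mult N (elem a b) (elem c d) = (if b = c then elem a d else (\<lambda>x y. 0))"
  unfolding mat_mult_elem(1) by (auto simp: elem_def fun_eq_iff)

locale yangian_context =
  fixes \<iota> :: "cmat \<Rightarrow> 'n::finite yangian"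
    and \<Delta> :: "'n yangian \<Rightarrow> 'n yangian2"
    and A S :: "nat \<Rightarrow> 'n yangian fps"
  assumes \<iota>: "sl_embedding \<iota>"
    and \<Delta>: "yangian_coproduct \<iota> \<Delta>"
    and A: "GKLO_series A"
    and S: "S_series A S"
begin

abbreviation E :: "nat \<Rightarrow> nat \<Rightarrow> 'n yangian" where "E a b \<equiv> \<iota> (elem a b)"

abbreviation H :: "nat \<Rightarrow> nat \<Rightarrow> 'n yangian" where
  "H a b \<equiv> \<iota> (\<lambda>x y. elem a a x y - elem b b x y)"

abbreviation xp :: "nat \<Rightarrow> nat \<Rightarrow> 'n yangian" where "xp \<equiv> x_gen Plus"
abbreviation xm :: "nat \<Rightarrow> nat \<Rightarrow> 'n yangian" where "xm \<equiv> x_gen Minus"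

lemma \<iota>_scale: "M \<in> sl (Suc CARD('n)) \<Longrightarrow> \<iota> (\<lambda>a b. c * M a b) = c *\<^sub>C \<iota> M"
  and \<iota>_bracket: "M \<in> sl (Suc CARD('n)) \<Longrightarrow> M' \<in> sl (Suc CARD('n)) \<Longrightarrow>
    bracket (\<iota> M) (\<iota> M') = \<iota> (\<lambda>a b. mat_mult (Suc CARD('n)) M M' a b - mat_mult (Suc CARD('n)) M' M a b)"
  and E_simple: "i \<in> {1..CARD('n)} \<Longrightarrow> E i (Suc i) = xp i 0" "i \<in> {1..CARD('n)} \<Longrightarrow> E (Suc i) i = xm i 0"
    "i \<in> {1..CARD('n)} \<Longrightarrow> H i (Suc i) = xi_gen i 0"
  using \<iota> by (simp_all add: sl_embedding_def Let_def)

lemma \<iota>_zero: "\<iota> (\<lambda>a b. 0) = 0"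
proof -
  have "(\<lambda>a b. 0) \<in> sl (Suc CARD('n))" by (simp add: sl_def)
  from \<iota>_scale[OF this, of 0] show ?thesis by simp
qed

lemma E_bracket:
  assumes "a \<in> {1..Suc CARD('n)}" "b \<in> {1..Suc CARD('n)}" "c \<in> {1..Suc CARD('n)}" "a \<noteq> b" "b \<noteq> c" "a \<noteq> c"
  shows "bracket (E a b) (E b c) = E a c"
proof -
  have "(\<lambda>x y. mat_mult (Suc CARD('n)) (elem a b) (elem b c) x y - mat_mult (Suc CARD('n)) (elem b c) (elem a b) x y)
      = elem a c"
    using assms by (simp add: mat_mult_elem_elem)
  then show ?thesis using assms by (simp add: \<iota>_bracket elem_in_sl)
qed

lemma E_bracket_zero:
  assumes "a \<in> {1..Suc CARD('n)}" "b \<in> {1..Suc CARD('n)}" "c \<in> {1..Suc CARD('n)}" "d \<in> {1..Suc CARD('n)}"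
    "a \<noteq> b" "c \<noteq> d" "b \<noteq> c" "a \<noteq> d"
  shows "bracket (E a b) (E c d) = 0"
proof -
  have "(\<lambda>x y. mat_mult (Suc CARD('n)) (elem a b) (elem c d) x y - mat_mult (Suc CARD('n)) (elem c d) (elem a b) x y)
      = (\<lambda>x y. 0)"
    using assms by (simp add: mat_mult_elem_elem)
  then show ?thesis using assms by (simp add: \<iota>_bracket elem_in_sl \<iota>_zero)
qed

lemma E_bracket_opposite:
  assumes "a \<in> {1..Suc CARD('n)}" "b \<in> {1..Suc CARD('n)}" "a \<noteq> b"
  shows "bracket (E a b) (E b a) = H a b"
proof -
  have "(\<lambda>x y. mat_mult (Suc CARD('n)) (elem a b) (elem b a) x y - mat_mult (Suc CARD('n)) (elem b a) (elem a b) x y)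
      = (\<lambda>x y. elem a a x y - elem b b x y)"
    using assms by (simp add: mat_mult_elem_elem)
  then show ?thesis using assms by (simp add: \<iota>_bracket elem_in_sl)
qed

lemma E_bracket_H:
  assumes "a \<in> {1..Suc CARD('n)}" "b \<in> {1..Suc CARD('n)}" "c \<in> {1..Suc CARD('n)}" "d \<in> {1..Suc CARD('n)}" "c \<noteq> d"
  shows "bracket (E c d) (H a b)
    = (of_bool (d = a) - of_bool (d = b) - of_bool (c = a) + of_bool (c = b)) *\<^sub>C E c d"
proof -
  have "(\<lambda>x y. mat_mult (Suc CARD('n)) (elem c d) (\<lambda>x y. elem a a x y - elem b b x y) x y
        - mat_mult (Suc CARD('n)) (\<lambda>x y. elem a a x y - elem b b x y) (elem c d) x y)
      = (\<lambda>x y. (of_bool (d = a) - of_bool (d = b) - of_bool (c = a) + of_bool (c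
          = b)) * elem c d x y)"
    unfolding mat_mult_elem(1)[OF assms(4)] mat_mult_elem(2)[OF assms(3)]
    using assms by (auto simp: fun_eq_iff elem_def)
  then show ?thesis using assms by (simp add: \<iota>_bracket elem_in_sl elem_diff_in_sl \<iota>_scale)
qed

text \<open>Root vectors are iterated brackets, each adjoining one simple root vector on the right.
  \<open>P\<close> carries the end points so that it may depend on the root.\<close>

lemma E_upper_induct [consumes 3, case_names simple bracket]:
  assumes "j < k" "1 \<le> j" "k \<le> Suc CARD('n)"
    and simple: "\<And>l. j \<le> l \<Longrightarrow> l < k \<Longrightarrow> P l (Suc l) (xp l 0)"
    and step: "\<And>l. j < l \<Longrightarrow> l < k \<Longrightarrow> P j l (E j l) \<Longrightarrow> P l (Suc l) (xp l 0) \<Longrightarrow>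
      P j (Suc l) (bracket (E j l) (xp l 0))"
  shows "P j k (E j k)"
proof -
  have "j < l \<Longrightarrow> l \<le> k \<Longrightarrow> P j l (E j l)" for l
  proof (induction l)
    case (Suc l)
    show ?case
    proof (cases "j = l")
      case True
      then show ?thesis using simple[of l] Suc.prems assms E_simple(1)[of l] by simp
    next
      case False
      have "E j (Suc l) = bracket (E j l) (xp l 0)"
        using False Suc.prems assms E_bracket[of j l "Suc l"] E_simple(1)[of l] by simp
      then show ?thesis using step[of l] simple[of l] Suc False by simp
    qed
  qed simp
  then show ?thesis using assms by simp
qed

lemma E_lower_induct [consumes 3, case_names simple bracket]:
  assumes "j < k" "1 \<le> j" "k \<le> Suc CARD('n)"
    and simple: "\<And>l. j \<le> l \<Longrightarrow> l < k \<Longrightarrow> P l (Suc l) (xm l 0)"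
    and step: "\<And>l. j < l \<Longrightarrow> l < k \<Longrightarrow> P j l (E l j) \<Longrightarrow> P l (Suc l) (xm l 0) \<Longrightarrow>
      P j (Suc l) (bracket (xm l 0) (E l j))"
  shows "P j k (E k j)"
proof -
  have "j < l \<Longrightarrow> l \<le> k \<Longrightarrow> P j l (E l j)" for l
  proof (induction l)
    case (Suc l)
    show ?case
    proof (cases "j = l")
      case True
      then show ?thesis using simple[of l] Suc.prems assms E_simple(2)[of l] by simp
    next
      case False
      have "E (Suc l) j = bracket (xm l 0) (E l j)"
        using False Suc.prems assms E_bracket[of "Suc l" l j] E_simple(2)[of l] by simp
      then show ?thesis using step[of l] simple[of l] Suc False by simp
    qed
  qed simp
  then show ?thesis using assms by simp
qed

section \<open>Brackets of root vectors with S_i and with x^+_{i,1}\<close>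

lemma bracket_commutes: "bracket s a = 0 \<Longrightarrow> bracket s b = 0 \<Longrightarrow> bracket s (bracket a b) = 0"
  by (simp add: bracket_jacobi[of s])

text \<open>Such root vectors are built from simple root vectors of nodes other than i.\<close>

lemma S_commute_E:
  assumes "i \<in> {1..CARD('n)}" "1 \<le> j" "j < k" "k \<le> Suc CARD('n)" "k \<le> i \<or> i < j"
  shows "bracket (S i $ m) (E j k) = 0" "bracket (S i $ m) (E k j) = 0"
proof -
  have x: "bracket (S i $ m) (x_gen s l 0) = 0" if "j \<le> l" "l < k" for l s
    using that assms by (intro S_commute_x[OF A S]) auto
  show "bracket (S i $ m) (E j k) = 0"
    using assms(3,2,4) by (induction rule: E_upper_induct) (auto simp: x bracket_commutes)
  show "bracket (S i $ m) (E k j) = 0"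
    using assms(3,2,4) by (induction rule: E_lower_induct) (auto simp: x bracket_commutes)
qed

lemma S_1_x: "i \<in> {1..CARD('n)} \<Longrightarrow> bracket (S i $ 1) (xp i p) = xp i (Suc p)"
  using S_exchange_x[OF A S, of i 0 p] S unfolding S_series_def by (simp add: bracket_def)

lemma bracket_xp1_xp0:
  assumes "i \<in> {1..CARD('n)}"
  shows "bracket (xp i 1) (xp i 0) = xp i 0 * xp i 0"
proof -
  have "bracket (xp i 1) (xp i 0) + bracket (xp i 1) (xp i 0) = xp i 0 * xp i 0 + xp i 0 * xp i 0"
    using x_x_step[OF assms assms, of Plus 0 0] bracket_anti[of "xp i 0" "xp i 1"] by simp
  then have "2 *\<^sub>C bracket (xp i 1) (xp i 0) = 2 *\<^sub>C (xp i 0 * xp i 0)"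
    by (simp add: scaleC_numeral mult_2)
  then show ?thesis by simp
qed

text \<open>
  The derivation \<open>bracket (S i $ 1)\<close> turns \<open>x\<^sup>+\<^sub>i\<^sub>,\<^sub>0\<close> into \<open>x\<^sup>+\<^sub>i\<^sub>,\<^sub>1\<close> and kills the other simple root
  vectors.  Applied to relations of \<open>sl\<close> it yields the brackets with \<open>x\<^sup>+\<^sub>i\<^sub>,\<^sub>1\<close>.
\<close>

lemma bracket_left_xp1:
  assumes i: "i \<in> {1..CARD('n)}" and j: "1 \<le> j" "j < i"
  shows "bracket (E j (Suc i)) (xp i 1) = - (xp i 0 * E j (Suc i))"
proof -
  define e a y x d where [simp]: "e = E j (Suc i)" "a = E j i" "y = xp i 1" "x = xp i 0" "d = S i $ 1"
  have x: "x = E i (Suc i)" using E_simple i by simp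
  have ax: "bracket a x = e" unfolding x using E_bracket[of j i "Suc i"] i j by simp
  have ex: "bracket e x = 0" unfolding x using E_bracket_zero[of j "Suc i" i "Suc i"] i j by simp
  have dx: "bracket d x = y" using S_1_x[OF i, of 0] by simp
  have da: "bracket d a = 0" using S_commute_E(1)[OF i, of j i 1] i j by simp
  have de: "bracket d e = bracket a y"
    unfolding ax[symmetric] bracket_jacobi[of d] da dx by simp
  \<comment> \<open>The derivation \<open>bracket d\<close> applied to [e, x] = 0.\<close>
  have "bracket (bracket a y) x + bracket e y = 0"
    using bracket_jacobi[of d e x] unfolding ex dx de by simp
  then have 1: "bracket (bracket a y) x = - bracket e y"
    by (simp add: add_eq_0_iff2)
  \<comment> \<open>A second equation for the same brackets, from ad a applied to x^2 = [y, x];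
    together they determine [e, y].\<close>
  have "e * x + x * e = bracket a (x * x)"
    by (simp add: bracket_mult_right ax del: e_a_y_x_d_def(2,4) e_a_y_x_d_def(1))
  also have "\<dots> = bracket a (bracket y x)" using bracket_xp1_xp0[OF i] by simp
  also have "\<dots> = - bracket e y + bracket y e" unfolding bracket_jacobi[of a] 1 ax ..
  finally have "x * e + x * e = - bracket e y + - bracket e y"
    using ex unfolding bracket_anti[of y e] bracket_eq_0_iff by simp
  from half_eq[OF this] have "bracket e y = - (x * e)" by simp
  then show ?thesis by simp
qed

text \<open>The mirror image of \<open>bracket_left_xp1\<close>, with E_{i+1,k} extending the root
  on the other side.\<close>

lemma bracket_right_xp1:
  assumes i: "i \<in> {1..CARD('n)}" and k: "Suc i < k" "k \<le> Suc CARD('n)"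
  shows "bracket (E i k) (xp i 1) = - (xp i 0 * E i k)"
proof -
  let ?g = "E i k" and ?b = "E (Suc i) k" and ?y = "xp i 1" and ?x = "xp i 0" and ?d = "S i $ 1"
  have x: "?x = E i (Suc i)" using E_simple i by simp
  have xb: "bracket ?x ?b = ?g" unfolding x using E_bracket[of i "Suc i" k] i k by simp
  have xg: "bracket ?x ?g = 0" unfolding x using E_bracket_zero[of i "Suc i" i k] i k by simp
  have dx: "bracket ?d ?x = ?y" using S_1_x[OF i, of 0] by simp
  have db: "bracket ?d ?b = 0" using S_commute_E(1)[OF i, of "Suc i" k 1] i k by simp
  have dg: "bracket ?d ?g = bracket ?y ?b"
    unfolding xb[symmetric] bracket_jacobi[of ?d] db dx by simp
  have "bracket ?y ?g + bracket ?x (bracket ?y ?b) = 0"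
    using bracket_jacobi[of ?d ?x ?g] unfolding xg dx dg by simp
  then have 1: "bracket ?x (bracket ?y ?b) = bracket ?g ?y"
    using bracket_anti[of ?g ?y] by (simp add: add_eq_0_iff)
  have "?g * ?x + ?x * ?g = - bracket ?b (?x * ?x)"
    unfolding bracket_mult_right bracket_anti[of ?b ?x] xb by simp
  also have "\<dots> = - bracket ?b (bracket ?y ?x)" unfolding bracket_xp1_xp0[OF i] ..
  also have "\<dots> = - (bracket ?x (bracket ?y ?b) + bracket ?g ?y)"
    unfolding bracket_jacobi[of ?b] bracket_anti[of ?b ?y] bracket_anti[of ?b ?x] xb
      bracket_anti[of "- bracket ?y ?b" ?x] bracket_minus_right
    using bracket_anti[of ?g ?y] by simp
  finally have "bracket ?g ?y + bracket ?g ?y = (- (?x * ?g)) + (- (?x * ?g))"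
    unfolding 1 using xg
    by (simp add: bracket_eq_0_iff eq_neg_iff_add_eq_0 eq_diff_eq add_ac)
  then show ?thesis by (rule half_eq)
qed

lemma xp_commute_xp0:
  assumes i: "i \<in> {1..CARD('n)}" and l: "l \<in> {1..CARD('n)}" "i + 2 \<le> l"
  shows "bracket (xp i 1) (xp l 0) = 0"
proof -
  have "bracket (xp i 0) (xp l 0) = 0"
    using E_bracket_zero[of i "Suc i" l "Suc l"] E_simple(1)[OF i] E_simple(1)[OF l(1)] i l by simp
  moreover have "bracket (S i $ 1) (xp l 0) = 0" using S_commute_x[OF A S i l(1)] l by simp
  ultimately show ?thesis
    using bracket_jacobi[of "S i $ 1" "xp i 0" "xp l 0"] S_1_x[OF i, of 0] by simp
qed

text \<open>Here the derivation comes from S_{i+1,1}: it raises the mode of x^+_{i+1,0} and kills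
  E_{j,i+1} and x^+_{i,0}. The relation between neighbouring nodes then trades x^+_{i+1,1} for
  x^+_{i,1}, and its symmetric correction term produces the right-hand side.\<close>

lemma bracket_both_aux:
  assumes i: "i \<in> {1..CARD('n)}" and j: "1 \<le> j" "j < i" and k: "Suc i < k" "k \<le> Suc CARD('n)"
  shows "bracket (E j (Suc i)) (bracket (xp i 1) (E (Suc i) k)) = - (xp i 0 * E j k)"
proof -
  let ?e = "E j (Suc i)" and ?y = "xp i 1" and ?x = "xp i 0" and ?b = "xp (Suc i) 0"
    and ?c = "E (i + 2) k"
  have i': "Suc i \<in> {1..CARD('n)}" using i k by simp
  have x: "?x = E i (Suc i)" using E_simple i by simp
  have b: "?b = E (Suc i) (i + 2)" using E_simple i' by simp
  have eb: "bracket ?e ?b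
      = E j (i + 2)" unfolding b using E_bracket[of j "Suc i" "i + 2"] i' j by simp
  have xb: "bracket ?x ?b
      = E i (i + 2)" unfolding x b using E_bracket[of i "Suc i" "i + 2"] i' i by simp
  have ex: "bracket ?e ?x = 0" unfolding x using E_bracket_zero[of j "Suc i" i "Suc i"] i j by simp
  have exb: "bracket ?e (bracket ?x ?b) = 0"
    unfolding xb using E_bracket_zero[of j "Suc i" i "i + 2"] i i' j by simp
  have xE: "bracket ?x (E j (i + 2)) = 0"
    unfolding x using E_bracket_zero[of i "Suc i" j "i + 2"] i i' j by simp
  have d: "bracket (S (Suc i) $ 1) ?e = 0" "bracket (S (Suc i) $ 1) ?x = 0"
    "bracket (S (Suc i) $ 1) ?b = xp (Suc i) 1"
    using S_commute_E(1)[OF i', of j "Suc i" 1] S_commute_x[OF A S i' i] S_1_x[OF i', of 0] i j by simp_all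
  have "bracket ?e (bracket ?x (xp (Suc i) 1)) = 0"
    using bracket_jacobi[of "S (Suc i) $ 1" ?e "bracket ?x ?b"]
    unfolding exb d bracket_jacobi[of "S (Suc i) $ 1" ?x] by simp
  moreover have "bracket ?y ?b = bracket ?x (xp (Suc i) 1) - (1/2) *\<^sub>C (?x * ?b + ?b * ?x)"
    using x_x_step[OF i i', of Plus 0 0] by (simp add: algebra_simps)
  ultimately have "bracket ?e (bracket ?y ?b) = - ((1/2) *\<^sub>C bracket ?e (?x * ?b + ?b * ?x))"
    by (simp add: bracket_simps)
  also have "bracket ?e (?x * ?b + ?b * ?x) = ?x * E j (i + 2) + ?x * E j (i + 2)"
    using xE by (simp add: bracket_add_right bracket_mult_right ex eb bracket_eq_0_iff)
  also have "(1/2) *\<^sub>C (?x * E j (i + 2) + ?x * E j (i + 2)) = ?x * E j (i + 2)"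
    by (simp add: scaleC_numeral[symmetric] scaleC_scaleC flip: mult_2)
  finally have 2: "bracket ?e (bracket ?y ?b) = - (?x * E j (i + 2))" .
  show ?thesis
  proof (cases "k = i + 2")
    case True
    then show ?thesis using 2 b by simp
  next
    case False
    \<comment> \<open>E_{i+2,k} commutes with \<open>?e\<close>, \<open>?x\<close> and
      \<open>?y\<close>, so bracketing with it extends the case k = i + 2.\<close>
    have k': "i + 2 < k" using False k by simp
    have "1 \<le> i + 2" by simp
    with k' have yc: "bracket ?y ?c = 0"
      using k(2)
    proof (induction rule: E_upper_induct)
      case (simple l)
      then show ?case using xp_commute_xp0[OF i, of l] i k by simp
    next
      case (bracket l)
      then show ?case by (intro bracket_commutes)
    qed
    have "E (Suc i) k = bracket ?b ?c"
      unfolding b using E_bracket[of "Suc i" "i + 2" k] k k' by simp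
    then have "bracket ?y (E (Suc i) k) = bracket (bracket ?y ?b) ?c"
      using bracket_jacobi[of ?y ?b ?c] yc by simp
    moreover have ec: "bracket ?e ?c
        = 0" using E_bracket_zero[of j "Suc i" "i + 2" k] i j k k' by simp
    moreover have xc: "bracket ?x ?c
        = 0" unfolding x using E_bracket_zero[of i "Suc i" "i + 2" k] i j k k' by simp
    moreover have Ec: "bracket (E j (i + 2)) ?c
        = E j k" using E_bracket[of j "i + 2" k] i j k k' by simp
    ultimately show ?thesis
      using bracket_jacobi[of ?e "bracket ?y ?b" ?c] 2
      by (simp add: bracket_minus_left bracket_mult_left del: add_2_eq_Suc')
  qed
qed

lemma bracket_E_xp1:
  assumes i: "i \<in> {1..CARD('n)}" and j: "1 \<le> j" "j \<le> i" and k: "Suc i \<le> k" "k \<le> Suc CARD('n)"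
  shows "bracket (E j k) (xp i 1) = - (E j (Suc i) * E i k)"
proof -
  let ?e = "E j (Suc i)" and ?g = "E i k" and ?y = "xp i 1" and ?x = "xp i 0"
  have x: "?x = E i (Suc i)" using E_simple i by simp
  consider "j = i" "k = Suc i" | "j < i" "k = Suc i" | "j = i" "Suc i < k" | "j < i" "Suc i < k"
    using j k by linarith
  then show ?thesis
  proof cases
    case 1
    then show ?thesis using bracket_xp1_xp0[OF i] bracket_anti[of ?y ?x] by (simp add: x)
  next
    case 2
    have "bracket ?e ?x = 0" unfolding x using E_bracket_zero[of j "Suc i" i "Suc i"] i j 2 by simp
    then show ?thesis
      using 2 bracket_left_xp1[OF i j(1) 2(1)] by (simp add: bracket_eq_0_iff flip: x)
  next
    case 3
    then show ?thesis using bracket_right_xp1[OF i 3(2) k(2)] by (simp flip: x)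
  next
    case 4
    let ?b = "E (Suc i) k"
    have eb: "bracket ?e ?b = E j k" using E_bracket[of j "Suc i" k] i j k 4 by simp
    have xb: "bracket ?x ?b = ?g" unfolding x using E_bracket[of i "Suc i" k] i j k 4 by simp
    have eg: "bracket ?e ?g = 0" using E_bracket_zero[of j "Suc i" i k] i j k 4 by simp
    \<comment> \<open>This double bracket is evaluated twice, by \<open>bracket_left_xp1\<close> and
      by the Jacobi identity with \<open>bracket_both_aux\<close>; the terms x E_{jk}
      cancel.\<close>
    have "bracket ?b (bracket ?e ?y) = bracket ?b (- (?x * ?e))"
      using bracket_left_xp1[OF i j(1) 4(1)] by simp
    also have "\<dots> = ?g * ?e + ?x * E j k"
      unfolding bracket_minus_right bracket_mult_right bracket_anti[of ?b ?x] bracket_anti[of ?b ?e] xb eb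
      by simp
    finally have 1: "bracket ?b (bracket ?e ?y) = ?g * ?e + ?x * E j k" .
    have "bracket ?b (bracket ?e ?y) = - bracket (E j k) ?y + ?x * E j k"
      using bracket_both_aux[OF i j(1) 4(1,2) k(2)]
      unfolding bracket_jacobi[of ?b] bracket_anti[of ?b ?e] bracket_anti[of ?b ?y] eb
      by (simp add: bracket_simps)
    then have "- bracket (E j k) ?y = ?e * ?g" using 1 eg by (simp add: bracket_eq_0_iff)
    then show ?thesis by (metis minus_minus)
  qed
qed

end


section \<open>Intertwining property of the right-hand side\<close>

declare sum.cl_ivl_Suc [simp del]

lemma fps_exponential_linear_nth:
  "fps_exponential (- (fps_const a * fps_X)) $ m = ((- 1) ^ m / fact m) *\<^sub>C a ^ m"
proof -
  have step: "fps_const b * fps_X * (fps_const c * fps_X ^ k) = fps_const (b * c) * fps_X ^ Suc k"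
    for b c :: 'a and k
  proof -
    have "fps_const b * fps_X * (fps_const c * fps_X ^ k)
        = fps_const b * (fps_X * fps_const c) * fps_X ^ k"
      by (simp only: mult.assoc)
    then show ?thesis
      by (simp only: fps_X_central[of "fps_const c"] fps_const_mult[symmetric] power_Suc mult.assoc)
  qed
  have pow: "(- (fps_const a * fps_X)) ^ k = fps_const ((- a) ^ k) * fps_X ^ k" for k
  proof (induction k)
    case (Suc k)
    have neg: "- (fps_const a * fps_X) = fps_const (- a) * fps_X"
      by (simp flip: fps_const_neg)
    show ?case
      unfolding power_Suc[of "- (fps_const a * fps_X)"] Suc unfolding neg step power_Suc ..
  qed simp
  have "(- a) ^ k = (- 1) ^ k *\<^sub>C a ^ k" for k
    by (induction k) (simp_all add: scaleC_simps)
  note pow = pow[unfolded this]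
  have "fps_exponential (- (fps_const a * fps_X)) $ m
      = (\<Sum>k\<le>m. if k = m then ((- 1) ^ m / fact m) *\<^sub>C a ^ m else 0)"
    unfolding fps_exponential_def fps_nth_Abs_fps pow
    by (rule sum.cong) (auto simp: fps_X_power_mult_right_nth scaleC_scaleC)
  then show ?thesis by simp
qed

lemma fps_exponential_linear_step:
  fixes a :: "'a::complex_algebra_1"
  shows "a * fps_exponential (- (fps_const a * fps_X)) $ m
    = - (of_nat (Suc m) *\<^sub>C fps_exponential (- (fps_const a * fps_X)) $ Suc m)"
proof -
  have "of_nat (Suc m) * ((- 1) ^ Suc m / fact (Suc m)) = (- ((- 1) ^ m / fact m) :: complex)"
    by (simp add: field_simps del: of_nat_Suc)
  then show ?thesis
    unfolding fps_exponential_linear_nth by (simp add: scaleC_simps del: of_nat_Suc fact_Suc power_Suc) simp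
qed

text \<open>The series \<open>exp (- z\<^sup>-\<^sup>1 ad a) y\<close> breaks off after the quadratic term.\<close>

lemma fps_exponential_conjugate:
  fixes a y :: "'a::complex_algebra_1"
  defines "T \<equiv> fps_exponential (- (fps_const a * fps_X))"
  assumes w: "bracket a y = w" and v: "bracket a w = v" and 0: "bracket a v = 0"
  shows "T * fps_const y
    = (fps_const y - fps_const w * fps_X + fps_const ((1/2) *\<^sub>C v) * fps_X ^ 2) * T"
proof -
  define U where "U = T * fps_const y - (fps_const y - fps_const w * fps_X + fps_const ((1/2) *\<^sub>C v) * fps_X ^ 2) * T"
  have U: "U $ m = T $ m * y - y * T $ m + (if m = 0 then 0 else w * T $ (m - 1))
      - (if m < 2 then 0 else (1/2) *\<^sub>C (v * T $ (m - 2)))" for m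
    by (auto simp: U_def ring_distribs mult.assoc fps_X_power_mult_nth mult_scaleC_left)
  have T: "a * T $ m = - (of_nat (Suc m) *\<^sub>C T $ Suc m)" for m
    unfolding T_def by (rule fps_exponential_linear_step)
  have ay: "a * y = y * a + w" "a * w = w * a + v" "a * v = v * a"
    using w v 0 by (auto simp: bracket_def)
  \<comment> \<open>As T' = -a T, both sides of the claim obey the same first-order recursion. They
    agree in degree 0, so their difference \<open>U\<close> vanishes.\<close>
  have "of_nat (Suc m) *\<^sub>C (U $ Suc m) = - (a * U $ m)" for m
  proof -
    have l: "a * (T $ m * y) = - (of_nat (Suc m) *\<^sub>C (T $ Suc m * y))" for m
      unfolding mult.assoc[symmetric] T by (simp add: scaleC_simps del: of_nat_Suc)
    have ay': "a * (y * t) = y * (a * t) + w * t" "a * (w * t) = w * (a * t) + v * t" "a * (v * t)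
        = v * (a * t)" for t
      unfolding mult.assoc[symmetric] ay by (simp_all add: distrib_right)
    consider "m = 0" | "m = 1" | k where "m = Suc (Suc k)" by (metis One_nat_def nat.exhaust)
    then show ?thesis
    proof cases
      case 1
      have "a * T $ 0 = - (T $ Suc 0)" using T[of 0] by simp
      moreover have "a * (T $ 0 * y) = - (T $ Suc 0 * y)" using l[of 0] by simp
      ultimately show ?thesis unfolding U 1 by (simp add: ring_distribs ay')
    next
      case 2
      have "a * T $ 0 = - (T $ 1)" using T[of 0] by simp
      moreover have "a * T $ 1 = - (2 *\<^sub>C (T $ 2))" using T[of 1] by (simp add: numeral_2_eq_2)
      moreover have "a * (T $ 1 * y)
          = - (2 *\<^sub>C (T $ 2 * y))" using l[of 1] by (simp add: numeral_2_eq_2)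
      moreover have "U $ Suc m = T $ 2 * y - y * T $ 2 + w * T $ 1 - (1/2) *\<^sub>C (v * T $ 0)"
        unfolding U 2 by (simp add: numeral_2_eq_2)
      moreover have "U $ m = T $ 1 * y - y * T $ 1 + w * T $ 0" unfolding U 2 by simp
      moreover have "v * T $ 0 = (1/2) *\<^sub>C (v * T $ 0) + (1/2) *\<^sub>C (v * T $ 0)"
        by (simp flip: scaleC_add_left)
      moreover have "w * T $ 1 + w * T $ 1 = 2 *\<^sub>C (w * T $ 1)" by (simp add: scaleC_numeral mult_2)
      ultimately show ?thesis
        using 2 by (simp add: ring_distribs ay' scaleC_simps)
    next
      case (3 k)
      have 1: "a * T $ m = - (of_nat (Suc m) *\<^sub>C T $ Suc m)" "a * T $ Suc k = - (of_nat m *\<^sub>C T $ m)"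
        "a * T $ k = - (of_nat (Suc k) *\<^sub>C T $ Suc k)"
        using T 3 by simp_all
      have "of_nat (Suc m) = (of_nat m + 1 :: complex)" "of_nat m = (of_nat (Suc k) + 1 :: complex)"
        using 3 by simp_all
      note nat = this
      have U': "U $ Suc m = T $ Suc m * y - y * T $ Suc m + w * T $ m - (1/2) *\<^sub>C (v * T $ Suc k)"
        "U $ m = T $ m * y - y * T $ m + w * T $ Suc k - (1/2) *\<^sub>C (v * T $ k)"
        unfolding U using 3 by simp_all
      have "a * U $ m
          = - (of_nat (Suc m) *\<^sub>C (T $ Suc m * y)) + of_nat (Suc m) *\<^sub>C (y * T $ Suc m) - w * T $ m
          - of_nat m *\<^sub>C (w * T $ m) + v * T $ Suc k + (of_nat (Suc k) / 2) *\<^sub>C (v * T $ Suc k)"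
        unfolding U' by (simp add: ring_distribs l ay' 1 mult_scaleC_right scaleC_scaleC del: of_nat_Suc)
      moreover have "v * T $ Suc k = (1/2) *\<^sub>C (v * T $ Suc k) + (1/2) *\<^sub>C (v * T $ Suc k)"
        by (simp flip: scaleC_add_left)
      ultimately show ?thesis
        unfolding U' nat by (simp add: scaleC_simps add_divide_distrib scaleC_numeral mult_2 del: of_nat_Suc)
    qed
  qed
  then have step: "U $ m = 0 \<Longrightarrow> U $ Suc m = 0" for m
    by (metis cvs.scale_eq_0_iff mult_zero_right neg_0_equal_iff_equal of_nat_neq_0)
  have "U $ m = 0" for m
  proof (induction m)
    case 0
    show ?case unfolding U T_def fps_exponential_linear_nth by simp
  qed (rule step)
  then have "U = 0" by (simp add: fps_eq_iff)
  then show ?thesis by (simp add: U_def)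
qed

lemma fps_const_commute_exponential:
  assumes "bracket a y = 0"
  shows "fps_exponential (- (fps_const a * fps_X)) * fps_const y
    = fps_const y * fps_exponential (- (fps_const a * fps_X))"
  using fps_exponential_conjugate[OF assms] by simp

lemma fps_const_commute:
  "(\<And>m. bracket (F $ m) y = 0) \<Longrightarrow> F * fps_const y = fps_const y * F"
  by (simp add: fps_eq_iff bracket_eq_0_iff)

locale yangian_node = yangian_context \<iota> \<Delta> A S
  for \<iota> :: "cmat \<Rightarrow> 'n::finite yangian" and \<Delta> A S +
  fixes i :: nat
  assumes i: "i \<in> {1..CARD('n)}"
begin

text \<open>The part of \<Delta>(x^+_{i,1}) beyond the two primitive terms.\<close>

definition Q :: "'n yangian2" where
  "Q = xi_gen i 0 \<otimes> xp i 0 + (\<Sum>j\<in>{1..<i}. E i j \<otimes> E j (Suc i))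
     - (\<Sum>k\<in>{i+2..Suc CARD('n)}. E k (Suc i) \<otimes> E i k)"

text \<open>The term at which brackets with E end: ad E sends \<open>Q\<close> to 2
  \<open>G\<close>, sends 1 \<otimes> x^+_{i,1} to -\<open>G\<close>, and kills
  \<open>G\<close>.\<close>

definition G :: "'n yangian2" where
  "G = (\<Sum>j\<in>{1..i}. \<Sum>k\<in>{Suc i..Suc CARD('n)}. E k j \<otimes> (E j (Suc i) * E i k))"

section \<open>The adjoint action of E on the constituents of \<Delta>(x^+_{i,0}) and
  \<Delta>(x^+_{i,1})\<close>

lemma E_sum_alt: "E_sum \<iota> i = (\<Sum>j\<in>{1..i}. \<Sum>k\<in>{Suc i..Suc CARD('n)}. E k j \<otimes> E j k)"
  by (simp only: E_sum_def sum.cartesian_product Suc_eq_plus1)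

lemma bracket_E_sum:
  "bracket (E_sum \<iota> i) u = (\<Sum>j\<in>{1..i}. \<Sum>k\<in>{Suc i..Suc CARD('n)}. bracket (E k j \<otimes> E j k) u)"
  unfolding E_sum_alt bracket_sum_left ..

lemma E_upper_commute:
  assumes "j \<in> {1..i}" "k \<in> {Suc i..Suc CARD('n)}" "j' \<in> {1..i}" "k' \<in> {Suc i..Suc CARD('n)}"
  shows "bracket (E j k) (E j' k') = 0"
  using assms i by (intro E_bracket_zero) auto

lemma E_lower_commute:
  assumes "j \<in> {1..i}" "k \<in> {Suc i..Suc CARD('n)}" "j' \<in> {1..i}" "k' \<in> {Suc i..Suc CARD('n)}"
  shows "bracket (E k j) (E k' j') = 0"
  using assms i by (intro E_bracket_zero) auto

lemma x_eq_E: "xp i 0 = E i (Suc i)"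
  using E_simple(1)[OF i] ..

lemma bracket_E_lower_x:
  assumes "j \<in> {1..i}" "k \<in> {Suc i..Suc CARD('n)}"
  shows "bracket (E k j) (xp i 0) = (if j = i then if k = Suc i then - xi_gen i 0 else E k (Suc i)
     else if k = Suc i then - E i j else 0)"
proof -
  consider "j = i" "k = Suc i" | "j = i" "k \<noteq> Suc i" | "j \<noteq> i" "k = Suc i" | "j \<noteq> i" "k \<noteq> Suc i"
    by blast
  then show ?thesis
  proof cases
    case 1
    then show ?thesis unfolding x_eq_E using E_bracket_opposite[of i "Suc i"] E_simple(3)[OF i] i
        bracket_anti[of "E (Suc i) i" "E i (Suc i)"] by simp
  next
    case 2
    then show ?thesis unfolding x_eq_E using E_bracket[of k i "Suc i"] assms i by simp
  next
    case 3
    then show ?thesis unfolding x_eq_E using E_bracket[of i "Suc i" j] assms i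
        bracket_anti[of "E (Suc i) j" "E i (Suc i)"] by simp
  next
    case 4
    then show ?thesis unfolding x_eq_E using E_bracket_zero[of k j i "Suc i"] assms i by simp
  qed
qed

lemma JK_insert: "{1..i} = insert i {1..<i}" "{Suc i..Suc CARD('n)} = insert (Suc i) {i+2..Suc CARD('n)}"
  using i by auto

text \<open>E_{kj} fails to commute with E_{i,i+1} only if j = i or k = i + 1. Both equalities give
  the term with \<xi>_{i,0}; exactly one of them gives the one or the other sum in
  \<open>Q\<close>.\<close>

lemma bracket_E_sum_x: "bracket (E_sum \<iota> i) (xp i 0 \<otimes> 1) = - Q"
proof -
  let ?K = "{Suc i..Suc CARD('n)}"
  have "bracket (E_sum \<iota> i) (xp i 0 \<otimes> 1) = (\<Sum>j\<in>{1..i}. \<Sum>k\<in>?K. bracket (E k j) (xp i 0) \<otimes> E j k)"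
    unfolding bracket_E_sum by (simp add: bracket_tensor)
  also have "\<dots> = (\<Sum>j\<in>{1..i}. \<Sum>k\<in>?K. (if j = i then if k = Suc i then - xi_gen i 0 else E k (Suc i)
     else if k = Suc i then - E i j else 0) \<otimes> E j k)"
    by (intro sum.cong refl arg_cong2[where f = pure_tensor] bracket_E_lower_x)
  also have "\<dots> = - Q"
  proof -
    have "(\<Sum>k\<in>{i+2..Suc CARD('n)}. (if k = Suc i then - xi_gen i 0 else E k (Suc i)) \<otimes> E i k)
        = (\<Sum>k\<in>{i+2..Suc CARD('n)}. E k (Suc i) \<otimes> E i k)"
      by (rule sum.cong) auto
    moreover have "(\<Sum>k\<in>{i+2..Suc CARD('n)}. (if k = Suc i then - E i j else 0) \<otimes> E j k) = 0" for j
      by (rule sum.neutral) auto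
    moreover have "(\<Sum>j\<in>{1..<i}. f j) = (\<Sum>j\<in>{1..<i}. g j)"
      if "\<And>j. j < i \<Longrightarrow> f j = g j" for f g :: "nat \<Rightarrow> 'n yangian2"
      by (rule sum.cong) (use that in auto)
    ultimately show ?thesis
      unfolding JK_insert Q_def
      by (simp add: x_eq_E tensor_minus_left sum_negf del: add_2_eq_Suc' cong: if_cong)
  qed
  finally show ?thesis .
qed

lemma bracket_bracket_E_lower_x:
  assumes "j \<in> {1..i}" "k \<in> {Suc i..Suc CARD('n)}" "j' \<in> {1..i}" "k' \<in> {Suc i..Suc CARD('n)}"
  shows "bracket (E k' j') (bracket (E k j) (xp i 0))
    = - (if j = i \<and> k' = Suc i then E k j' else 0) - (if k = Suc i \<and> j' = i then E k' j else 0)"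
proof -
  consider "j = i" "k = Suc i" | "j = i" "k \<noteq> Suc i" | "j \<noteq> i" "k = Suc i" | "j \<noteq> i" "k \<noteq> Suc i"
    by blast
  then show ?thesis
  proof cases
    case 1
    have "bracket (E k' j') (xi_gen i 0) = (of_bool (j' = i) + of_bool (k' = Suc i)) *\<^sub>C E k' j'"
      unfolding E_simple(3)[OF i, symmetric] using assms i by (subst E_bracket_H) auto
    then show ?thesis unfolding bracket_E_lower_x[OF assms(1,2)] using 1
      by (auto simp: bracket_minus_right scaleC_add_left)
  next
    case 2
    have "bracket (E k' j') (E k (Suc i)) = (if k' = Suc i then - E k j' else 0)"
      using E_bracket[of k "Suc i" j'] bracket_anti[of "E (Suc i) j'" "E k (Suc i)"]
        E_bracket_zero[of k' j' k "Suc i"] assms 2 i by auto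
    then show ?thesis unfolding bracket_E_lower_x[OF assms(1,2)] using 2 by simp
  next
    case 3
    have "bracket (E k' j') (E i j) = (if j' = i then E k' j else 0)"
      using E_bracket[of k' i j] E_bracket_zero[of k' j' i j] assms 3 i by auto
    then show ?thesis unfolding bracket_E_lower_x[OF assms(1,2)] using 3
        by (simp add: bracket_minus_right)
  next
    case 4
    then show ?thesis unfolding bracket_E_lower_x[OF assms(1,2)] by simp
  qed
qed

text \<open>The double brackets live on two index patterns, j = i with k' = i + 1 and j' = i with k
  = i + 1. Each pattern sums to \<open>G\<close>, since upper root vectors crossing i commute; hence
  the factor 2.\<close>

lemma bracket_E_sum_Q: "bracket (E_sum \<iota> i) Q = 2 *\<^sub>C G"
proof -
  let ?K = "{Suc i..Suc CARD('n)}"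
  let ?q = "\<lambda>j k. bracket (E k j) (xp i 0)"
  have Q: "- Q = (\<Sum>j\<in>{1..i}. \<Sum>k\<in>?K. ?q j k \<otimes> E j k)"
    unfolding bracket_E_sum_x[symmetric] bracket_E_sum by (simp add: bracket_tensor)
  have "bracket (E_sum \<iota> i) (- Q)
      = (\<Sum>j'\<in>{1..i}. \<Sum>k'\<in>?K. \<Sum>j\<in>{1..i}. \<Sum>k\<in>?K. bracket (E k' j' \<otimes> E j' k') (?q j k \<otimes> E j k))"
    unfolding bracket_E_sum[of "- Q"] unfolding Q bracket_sum_right ..
  also have "\<dots> = (\<Sum>j'\<in>{1..i}. \<Sum>k'\<in>?K. \<Sum>j\<in>{1..i}. \<Sum>k\<in>?K.
      - (if k' = Suc i then if j = i then E k j' \<otimes> (E j' (Suc i) * E i k) else 0 else 0)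
      - (if j' = i then if k = Suc i then E k' j \<otimes> (E j (Suc i) * E i k') else 0 else 0))"
  proof (intro sum.cong refl)
    fix j k j' k' assume *: "j' \<in> {1..i}" "k' \<in> ?K" "j \<in> {1..i}" "k \<in> ?K"
    have "E i k' * E j (Suc i) = E j (Suc i) * E i k'"
      using E_upper_commute[of i k' j "Suc i"] * i by (simp add: bracket_eq_0_iff)
    then show "bracket (E k' j' \<otimes> E j' k') (?q j k \<otimes> E j k) =
      - (if k' = Suc i then if j = i then E k j' \<otimes> (E j' (Suc i) * E i k) else 0 else 0)
      - (if j' = i then if k = Suc i then E k' j \<otimes> (E j (Suc i) * E i k') else 0 else 0)"
      unfolding bracket_tensor bracket_bracket_E_lower_x[OF *(3,4,1,2)] E_upper_commute[OF *]
      by (auto simp: tensor_simps)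
  qed
  also have "\<dots> = - (G + G)"
  proof -
    have delta: "(\<Sum>k'\<in>?K. if k' = Suc i then x else 0) = x" "(\<Sum>j\<in>{1..i}. if j = i then x else 0)
        = x"
      for x :: "'n yangian2" using i by simp_all
    have "(\<Sum>j'\<in>{1..i}. \<Sum>k'\<in>?K. \<Sum>j\<in>{1..i}. \<Sum>k\<in>?K. if k' = Suc i then if j
        = i then E k j' \<otimes> (E j' (Suc i) * E i k) else 0 else 0)
        = (\<Sum>j'\<in>{1..i}. \<Sum>k\<in>?K. E k j' \<otimes> (E j' (Suc i) * E i k))"
    proof (rule sum.cong[OF refl])
      fix j'
      let ?f = "\<lambda>k. E k j' \<otimes> (E j' (Suc i) * E i k)"
      have "(\<Sum>k'\<in>?K. \<Sum>j\<in>{1..i}. \<Sum>k\<in>?K. if k' = Suc i then if j = i then ?f k else 0 else 0)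
          = (\<Sum>k'\<in>?K. if k' = Suc i then \<Sum>j\<in>{1..i}. if j = i then \<Sum>k\<in>?K. ?f k else 0 else 0)"
      proof (rule sum.cong[OF refl])
        fix k'
        have "(\<Sum>k\<in>?K. if j = i then ?f k else 0)
            = (if j = i then \<Sum>k\<in>?K. ?f k else 0)" for j
          by simp
        then show "(\<Sum>j\<in>{1..i}. \<Sum>k\<in>?K. if k' = Suc i then if j = i then ?f k else 0 else 0)
            = (if k' = Suc i then \<Sum>j\<in>{1..i}. if j = i then \<Sum>k\<in>?K. ?f k else 0 else 0)"
          by (cases "k' = Suc i") simp_all
      qed
      then show "(\<Sum>k'\<in>?K. \<Sum>j\<in>{1..i}. \<Sum>k\<in>?K. if k' = Suc i then if j = i then ?f k else 0 else 0)
          = (\<Sum>k\<in>?K. ?f k)"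
        unfolding delta .
    qed
    moreover have "(\<Sum>j'\<in>{1..i}. \<Sum>k'\<in>?K. \<Sum>j\<in>{1..i}. \<Sum>k\<in>?K. if j' = i then if k
        = Suc i then E k' j \<otimes> (E j (Suc i) * E i k') else 0 else 0)
        = (\<Sum>k'\<in>?K. \<Sum>j\<in>{1..i}. E k' j \<otimes> (E j (Suc i) * E i k'))"
    proof -
      have "(\<Sum>j'\<in>{1..i}. \<Sum>k'\<in>?K. \<Sum>j\<in>{1..i}. \<Sum>k\<in>?K. if j' = i then if k
          = Suc i then E k' j \<otimes> (E j (Suc i) * E i k') else 0 else 0)
          = (\<Sum>j'\<in>{1..i}. if j' = i then \<Sum>k'\<in>?K. \<Sum>j\<in>{1..i}. \<Sum>k\<in>?K. if k
              = Suc i then E k' j \<otimes> (E j (Suc i) * E i k') else 0 else 0)"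
        by (intro sum.cong refl) auto
      then show ?thesis unfolding delta .
    qed
    ultimately show ?thesis
      unfolding sum_subtractf sum_negf G_def
      by (simp add: sum.swap[of "\<lambda>k j. E k j \<otimes> (E j (Suc i) * E i k)" "{Suc 0..i}"])
  qed
  finally have "- bracket (E_sum \<iota> i) Q = - (2 *\<^sub>C G)"
    by (simp add: bracket_minus_right scaleC_numeral mult_2)
  then show ?thesis by (metis minus_minus)
qed

lemma bracket_E_sum_xp1: "bracket (E_sum \<iota> i) (1 \<otimes> xp i 1) = - G"
proof -
  let ?K = "{Suc i..Suc CARD('n)}"
  have "bracket (E_sum \<iota> i) (1 \<otimes> xp i 1) = (\<Sum>j\<in>{1..i}. \<Sum>k\<in>?K. E k j \<otimes> bracket (E j k) (xp i 1))"
    unfolding bracket_E_sum by (simp add: bracket_tensor)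
  also have "\<dots> = (\<Sum>j\<in>{1..i}. \<Sum>k\<in>?K. - (E k j \<otimes> (E j (Suc i) * E i k)))"
    using i bracket_E_xp1[OF i] by (intro sum.cong refl) (simp add: tensor_minus_right)
  finally show ?thesis by (simp add: G_def sum_negf)
qed

lemma bracket_E_sum_xp0: "bracket (E_sum \<iota> i) (1 \<otimes> xp i 0) = 0"
  unfolding bracket_E_sum x_eq_E using i
  by (intro sum.neutral ballI) (simp add: bracket_tensor E_upper_commute)

lemma bracket_E_sum_G: "bracket (E_sum \<iota> i) G = 0"
  unfolding G_def bracket_E_sum bracket_sum_right using i
  by (intro sum.neutral ballI)
    (simp add: bracket_tensor bracket_mult_right E_upper_commute E_lower_commute)

section \<open>Moving coproducts of generators through the factors of D\<close>

lemma \<Delta>_hom: "algebra_hom \<Delta>"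
  and \<Delta>_primitive: "M \<in> sl (Suc CARD('n)) \<Longrightarrow> \<Delta> (\<iota> M) = \<iota> M \<otimes> 1 + 1 \<otimes> \<iota> M"
  using \<Delta> by (simp_all add: yangian_coproduct_def Let_def)

lemma \<Delta>_xi0: "l \<in> {1..CARD('n)} \<Longrightarrow> \<Delta> (xi_gen l 0) = xi_gen l 0 \<otimes> 1 + 1 \<otimes> xi_gen l 0"
  using \<Delta>_primitive[OF elem_diff_in_sl[of l "Suc CARD('n)" "Suc l"]] by (simp add: E_simple)

lemma \<Delta>_x0: "l \<in> {1..CARD('n)} \<Longrightarrow> \<Delta> (x_gen s l 0) = x_gen s l 0 \<otimes> 1 + 1 \<otimes> x_gen s l 0"
  using \<Delta>_primitive[OF elem_in_sl[of l "Suc CARD('n)" "Suc l"]]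
    \<Delta>_primitive[OF elem_in_sl[of "Suc l" "Suc CARD('n)" l]]
  by (cases s) (simp_all add: E_simple)

lemma \<Delta>_x1: "\<Delta> (xp i 1) = xp i 1 \<otimes> 1 + 1 \<otimes> xp i 1 + Q"
  using \<Delta> i by (simp add: yangian_coproduct_def Let_def Q_def)

lemma xi_commute_S: "l \<in> {1..CARD('n)} \<Longrightarrow> bracket (S i $ m) (xi_gen l p) = 0"
proof (rule bracket_eq_0_sym)
  assume l: "l \<in> {1..CARD('n)}"
  have "S i $ m \<in> Y_zero" using S i unfolding S_series_def by blast
  from this[unfolded Y_zero_def] show "bracket (xi_gen l p) (S i $ m) = 0"
    by (rule subalgebra_gen_commute) (use l in \<open>auto simp: xi_xi\<close>)
qed

text \<open>The first factors in \<open>Q\<close> are \<xi>_{i,0} and lower root vectors whose roots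
  do not involve \<alpha>_i.\<close>

lemma S_commute_Q: "bracket (S i $ m \<otimes> 1) Q = 0"
proof -
  have "bracket (S i $ m) (E i j) = 0" if "j \<in> {1..<i}" for j
    using S_commute_E(2)[OF i, of j i m] that i by simp
  moreover have "bracket (S i $ m) (E k (Suc i)) = 0" if "k \<in> {i+2..Suc CARD('n)}" for k
    using S_commute_E(2)[OF i, of "Suc i" k m] that i by simp
  ultimately show ?thesis
    by (simp add: Q_def bracket_simps bracket_sum_right bracket_tensor_left xi_commute_S[OF i])
qed

definition SL :: "'n yangian2 fps" where "SL = fps_map (\<lambda>y. y \<otimes> 1) (S i)"
definition SR :: "'n yangian2 fps" where "SR = fps_map (\<lambda>y. 1 \<otimes> y) (S i)"
definition T :: "'n yangian2 fps" where "T = fps_exponential (- (fps_const (E_sum \<iota> i) * fps_X))"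

lemma S_exchange_series:
  "S i * (fps_const (xp i 0) - fps_const (xp i 1) * fps_X) = fps_const (xp i 0) * S i"
proof (rule fps_ext)
  fix m
  show "(S i * (fps_const (xp i 0) - fps_const (xp i 1) * fps_X)) $ m
      = (fps_const (xp i 0) * S i) $ m"
  proof (cases m)
    case 0
    have "S i $ 0 = 1" using S i unfolding S_series_def by blast
    then show ?thesis using 0 by simp
  next
    case (Suc k)
    then show ?thesis
      using S_exchange_x[OF A S i, of k 0] by (simp add: right_diff_distrib flip: mult.assoc)
  qed
qed

lemma fps_map_const: "f 0 = 0 \<Longrightarrow> fps_map f (fps_const a) = fps_const (f a)"
  by (simp add: fps_eq_iff)

lemma fps_map_X: "f 0 = 0 \<Longrightarrow> f 1 = 1 \<Longrightarrow> fps_map f fps_X = fps_X"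
  by (simp add: fps_eq_iff fps_X_def)

lemma fps_map_diff: "algebra_hom f \<Longrightarrow> fps_map f (F - F') = fps_map f F - fps_map f F'"
  by (simp add: fps_eq_iff algebra_homD(6))

lemma hom_S_exchange_series:
  assumes "algebra_hom f"
  shows "fps_map f (S i) * (fps_const (f (xp i 0)) - fps_const (f (xp i 1)) * fps_X)
    = fps_const (f (xp i 0)) * fps_map f (S i)"
  using arg_cong[OF S_exchange_series, of "fps_map f"]
  by (simp add: fps_map_hom[OF assms] fps_map_diff[OF assms] fps_map_const fps_map_X algebra_homD[OF assms])

definition D :: "'n yangian2 fps" where "D = SR * T * SL"

lemma SL_commute: "SL * fps_const (1 \<otimes> y) = fps_const (1 \<otimes> y) * SL"
  and SR_commute: "SR * fps_const (y \<otimes> 1) = fps_const (y \<otimes> 1) * SR"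
  by (rule fps_const_commute; simp add: SL_def SR_def bracket_tensor)+

lemma T_conjugate_x0: "T * fps_const (xp i 0 \<otimes> 1 + 1 \<otimes> xp i 0)
    = (fps_const (xp i 0 \<otimes> 1 + 1 \<otimes> xp i 0) + fps_const Q * fps_X - fps_const G * fps_X ^ 2) * T"
proof -
  have "bracket (E_sum \<iota> i) (xp i 0 \<otimes> 1 + 1 \<otimes> xp i 0) = - Q"
    by (simp add: bracket_add_right bracket_E_sum_x bracket_E_sum_xp0)
  from fps_exponential_conjugate[OF this refl]
  show ?thesis
    by (simp add: T_def bracket_minus_right bracket_E_sum_Q bracket_scaleC_right bracket_E_sum_G scaleC_simps
        flip: fps_const_neg)
qed

lemma T_conjugate_x1: "T * fps_const (1 \<otimes> xp i 1) = (fps_const (1 \<otimes> xp i 1) + fps_const G * fps_X) * T"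
  using fps_exponential_conjugate[OF bracket_E_sum_xp1 refl]
  by (simp add: T_def bracket_minus_right bracket_E_sum_G flip: fps_const_neg)

lemma T_conjugate_Q: "T * fps_const Q = (fps_const Q - fps_const (2 *\<^sub>C G) * fps_X) * T"
  using fps_exponential_conjugate[OF bracket_E_sum_Q refl]
  by (simp add: T_def bracket_scaleC_right bracket_E_sum_G)

text \<open>At z^-1 the terms in \<open>Q\<close> cancel. At z^-2 the coefficient of
  \<open>G\<close> is -1 from x^+_{i,0}, -1 from x^+_{i,1} and +2 from \<open>Q\<close>.\<close>

lemma T_intertwine:
  "T * (fps_const (xp i 0 \<otimes> 1 + 1 \<otimes> xp i 0) - fps_const (1 \<otimes> xp i 1) * fps_X - fps_const Q * fps_X)
    = (fps_const (xp i 0 \<otimes> 1 + 1 \<otimes> xp i 0) - fps_const (1 \<otimes> xp i 1) * fps_X) * T"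
proof -
  have X: "fps_X * T = T * fps_X" by (rule fps_X_central)
  have X': "fps_X * (T * F) = T * (fps_X * F)" for F by (simp only: X mult.assoc[symmetric])
  have "T * (fps_const (xp i 0 \<otimes> 1
      + 1 \<otimes> xp i 0) - fps_const (1 \<otimes> xp i 1) * fps_X - fps_const Q * fps_X)
      = T * fps_const (xp i 0 \<otimes> 1
          + 1 \<otimes> xp i 0) - T * fps_const (1 \<otimes> xp i 1) * fps_X - T * fps_const Q * fps_X"
    by (simp add: right_diff_distrib mult.assoc del: fps_const_add)
  also have "\<dots>
      = (fps_const (xp i 0 \<otimes> 1 + 1 \<otimes> xp i 0) + fps_const Q * fps_X - fps_const G * fps_X ^ 2
      - (fps_const (1 \<otimes> xp i 1) + fps_const G * fps_X) * fps_X
      - (fps_const Q - fps_const (2 *\<^sub>C G) * fps_X) * fps_X) * T"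
    unfolding T_conjugate_x0 T_conjugate_x1 T_conjugate_Q by (simp only: left_diff_distrib mult.assoc X X')
  also have "fps_const (xp i 0 \<otimes> 1 + 1 \<otimes> xp i 0) + fps_const Q * fps_X - fps_const G * fps_X ^ 2
      - (fps_const (1 \<otimes> xp i 1) + fps_const G * fps_X) * fps_X
      - (fps_const Q - fps_const (2 *\<^sub>C G) * fps_X) * fps_X
      = fps_const (xp i 0 \<otimes> 1 + 1 \<otimes> xp i 0) - fps_const (1 \<otimes> xp i 1) * fps_X"
    by (simp add: ring_distribs power2_eq_square mult.assoc scaleC_numeral mult_2
        del: fps_const_add flip: fps_const_add[of G G])
  finally show ?thesis .
qed

text \<open>Each factor handles one ingredient: \<open>SL\<close> exchanges the terms in the first
  tensor factor and commutes with \<open>Q\<close>, \<open>T\<close> removes \<open>Q\<close>, and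
  \<open>SR\<close> exchanges the terms in the second tensor factor.\<close>

lemma D_intertwine:
  "D * (fps_const (\<Delta> (xp i 0)) - fps_const (\<Delta> (xp i 1)) * fps_X) = fps_const (\<Delta> (xp i 0)) * D"
proof -
  let ?c = fps_const and ?x = "xp i 0" and ?y = "xp i 1"
  have hL: "SL * (?c (?x \<otimes> 1) - ?c (?y \<otimes> 1) * fps_X) = ?c (?x \<otimes> 1) * SL"
    unfolding SL_def by (rule hom_S_exchange_series[OF tensor_hom_left])
  have hR: "SR * (?c (1 \<otimes> ?x) - ?c (1 \<otimes> ?y) * fps_X) = ?c (1 \<otimes> ?x) * SR"
    unfolding SR_def by (rule hom_S_exchange_series[OF tensor_hom_right])
  have Q: "SL * ?c Q = ?c Q * SL"
    by (rule fps_const_commute) (simp add: SL_def S_commute_Q)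
  have "SL * (?c (\<Delta> ?x) - ?c (\<Delta> ?y) * fps_X)
      = SL * (?c (?x \<otimes> 1) - ?c (?y \<otimes> 1) * fps_X)
          + SL * ?c (1 \<otimes> ?x) - SL * ?c (1 \<otimes> ?y) * fps_X - SL * ?c Q * fps_X"
    by (simp add: \<Delta>_x0[OF i] \<Delta>_x1[unfolded One_nat_def] algebra_simps flip: fps_const_add)
  also have "\<dots> = (?c (?x \<otimes> 1 + 1 \<otimes> ?x) - ?c (1 \<otimes> ?y) * fps_X - ?c Q * fps_X) * SL"
    unfolding hL SL_commute Q
    by (simp add: mult.assoc fps_X_central[of SL, symmetric] ring_distribs flip: fps_const_add)
  finally have 1: "SL * (?c (\<Delta> ?x) - ?c (\<Delta> ?y) * fps_X)
      = (?c (?x \<otimes> 1 + 1 \<otimes> ?x) - ?c (1 \<otimes> ?y) * fps_X - ?c Q * fps_X) * SL" .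
  have 2: "SR * (?c (?x \<otimes> 1 + 1 \<otimes> ?x) - ?c (1 \<otimes> ?y) * fps_X) = ?c (\<Delta> ?x) * SR"
  proof -
    have "SR * (?c (?x \<otimes> 1 + 1 \<otimes> ?x) - ?c (1 \<otimes> ?y) * fps_X)
        = SR * ?c (?x \<otimes> 1) + SR * (?c (1 \<otimes> ?x) - ?c (1 \<otimes> ?y) * fps_X)"
      by (simp add: algebra_simps flip: fps_const_add)
    also have "\<dots> = ?c (\<Delta> ?x) * SR"
      unfolding hR SR_commute by (simp add: \<Delta>_x0[OF i] distrib_right flip: fps_const_add)
    finally show ?thesis .
  qed
  have "D * (?c (\<Delta> ?x) - ?c (\<Delta> ?y) * fps_X) = SR * (T * (SL * (?c (\<Delta> ?x) - ?c (\<Delta> ?y) * fps_X)))"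
    by (simp only: D_def mult.assoc)
  also have "\<dots> = SR * (T * (?c (?x \<otimes> 1 + 1 \<otimes> ?x) - ?c (1 \<otimes> ?y) * fps_X - ?c Q * fps_X)) * SL"
    unfolding 1 by (simp only: mult.assoc)
  also have "\<dots> = SR * (?c (?x \<otimes> 1 + 1 \<otimes> ?x) - ?c (1 \<otimes> ?y) * fps_X) * T * SL"
    unfolding T_intertwine by (simp only: mult.assoc)
  finally show ?thesis unfolding 2 by (simp only: D_def mult.assoc)
qed

lemma D_commute:
  assumes "\<And>m. bracket (S i $ m) y = 0" "bracket (E_sum \<iota> i) (y \<otimes> 1 + 1 \<otimes> y) = 0"
  shows "D * fps_const (y \<otimes> 1 + 1 \<otimes> y) = fps_const (y \<otimes> 1 + 1 \<otimes> y) * D"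
proof -
  let ?y = "fps_const (y \<otimes> 1 + 1 \<otimes> y)"
  have L: "SL * ?y = ?y * SL" and R: "SR * ?y = ?y * SR"
    by (rule fps_const_commute; simp add: SL_def SR_def bracket_add_right bracket_tensor assms(1))+
  have T: "T * ?y = ?y * T"
    unfolding T_def by (rule fps_const_commute_exponential[OF assms(2)])
  show ?thesis
    unfolding D_def mult.assoc L
    unfolding mult.assoc[symmetric] R[symmetric]
    unfolding mult.assoc T[symmetric] ..
qed

text \<open>E is invariant under the simple root vectors with l \<noteq> i: the bracket involves two
  adjacent values, l and l + 1, of one summation index, and their contributions cancel.\<close>

lemma D_commute_x:
  assumes l: "l \<in> {1..CARD('n)}" "l \<noteq> i"
  shows "D * fps_const (\<Delta> (xp l 0)) = fps_const (\<Delta> (xp l 0)) * D"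
  unfolding \<Delta>_x0[OF l(1)]
proof (rule D_commute)
  show "bracket (S i $ m) (xp l 0) = 0" for m by (rule S_commute_x[OF A S i l])
  have x: "xp l 0 = E l (Suc l)" using E_simple(1)[OF l(1)] ..
  have 1: "bracket (E_sum \<iota> i) (xp l 0 \<otimes> 1 + 1 \<otimes> xp l 0) = (\<Sum>j\<in>{1..i}. \<Sum>k\<in>{Suc i..Suc CARD('n)}.
      bracket (E k j) (E l (Suc l)) \<otimes> E j k + E k j \<otimes> bracket (E j k) (E l (Suc l)))"
    unfolding bracket_E_sum x by (simp add: bracket_add_right bracket_tensor)
  show "bracket (E_sum \<iota> i) (xp l 0 \<otimes> 1 + 1 \<otimes> xp l 0) = 0"
  proof (cases "l < i")
    case True
    let ?F = "\<lambda>k. E k (Suc l) \<otimes> E l k"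
    have "bracket (E_sum \<iota> i) (xp l 0 \<otimes> 1 + 1 \<otimes> xp l 0)
        = (\<Sum>j\<in>{1..i}. \<Sum>k\<in>{Suc i..Suc CARD('n)}. (if j = l then ?F k else 0) - (if j
            = Suc l then ?F k else 0))"
      unfolding 1
    proof (intro sum.cong refl)
      fix j k assume jk: "j \<in> {1..i}" "k \<in> {Suc i..Suc CARD('n)}"
      have "bracket (E k j) (E l (Suc l)) = (if j = l then E k (Suc l) else 0)"
        using E_bracket[of k l "Suc l"] E_bracket_zero[of k j l "Suc l"] jk True l i by auto
      moreover have "bracket (E j k) (E l (Suc l)) = (if j = Suc l then - E l k else 0)"
        using E_bracket[of l "Suc l" k] bracket_anti[of "E (Suc l) k" "E l (Suc l)"]
          E_bracket_zero[of j k l "Suc l"] jk True l i by auto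
      ultimately show "bracket (E k j) (E l (Suc l)) \<otimes> E j k + E k j \<otimes> bracket (E j k) (E l (Suc l))
          = (if j = l then ?F k else 0) - (if j = Suc l then ?F k else 0)"
        by (auto simp: tensor_minus_right)
    qed
    also have "\<dots> = (\<Sum>j\<in>{1..i}. (if j = l then \<Sum>k\<in>{Suc i..Suc CARD('n)}. ?F k else 0) - (if j
        = Suc l then \<Sum>k\<in>{Suc i..Suc CARD('n)}. ?F k else 0))"
      by (intro sum.cong refl) (auto simp: sum_negf)
    also have "\<dots> = 0"
      unfolding sum_subtractf using True l by simp
    finally show ?thesis .
  next
    case False
    let ?F = "\<lambda>j. E l j \<otimes> E j (Suc l)"
    have "bracket (E_sum \<iota> i) (xp l 0 \<otimes> 1 + 1 \<otimes> xp l 0)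
        = (\<Sum>j\<in>{1..i}. \<Sum>k\<in>{Suc i..Suc CARD('n)}. (if k = l then ?F j else 0) - (if k
            = Suc l then ?F j else 0))"
      unfolding 1
    proof (intro sum.cong refl)
      fix j k assume jk: "j \<in> {1..i}" "k \<in> {Suc i..Suc CARD('n)}"
      have "bracket (E k j) (E l (Suc l)) = (if k = Suc l then - E l j else 0)"
        using E_bracket[of l "Suc l" j] bracket_anti[of "E (Suc l) j" "E l (Suc l)"]
          E_bracket_zero[of k j l "Suc l"] jk False l i by auto
      moreover have "bracket (E j k) (E l (Suc l)) = (if k = l then E j (Suc l) else 0)"
        using E_bracket[of j l "Suc l"] E_bracket_zero[of j k l "Suc l"] jk False l i by auto
      ultimately show "bracket (E k j) (E l (Suc l)) \<otimes> E j k + E k j \<otimes> bracket (E j k) (E l (Suc l))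
          = (if k = l then ?F j else 0) - (if k = Suc l then ?F j else 0)"
        by (auto simp: tensor_minus_left)
    qed
    also have "\<dots> = 0"
      unfolding sum_subtractf using False l by simp
    finally show ?thesis .
  qed
qed

lemma D_commute_xi:
  assumes l: "l \<in> {1..CARD('n)}"
  shows "D * fps_const (\<Delta> (xi_gen l 0)) = fps_const (\<Delta> (xi_gen l 0)) * D"
  unfolding \<Delta>_xi0[OF l]
proof (rule D_commute)
  show "bracket (S i $ m) (xi_gen l 0) = 0" for m by (rule xi_commute_S[OF l])
  show "bracket (E_sum \<iota> i) (xi_gen l 0 \<otimes> 1 + 1 \<otimes> xi_gen l 0) = 0"
    unfolding bracket_E_sum E_simple(3)[OF l, symmetric]
  proof (intro sum.neutral ballI)
    fix j k assume jk: "j \<in> {1..i}" "k \<in> {Suc i..Suc CARD('n)}"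
    \<comment> \<open>E_{kj} and E_{jk} have opposite eigenvalues, so their tensor product has total
      weight 0.\<close>
    define c :: complex where "c = of_bool (j = l) - of_bool (j = Suc l) - of_bool (k = l) + of_bool (k = Suc l)"
    have "bracket (E k j) (H l (Suc l)) = c *\<^sub>C E k j"
      unfolding c_def using jk l i by (intro E_bracket_H) auto
    moreover have "bracket (E j k) (H l (Suc l)) = (- c) *\<^sub>C E j k"
    proof -
  let ?K = "{Suc i..Suc CARD('n)}"
      have "- c = of_bool (k = l) - of_bool (k = Suc l) - of_bool (j = l) + of_bool (j = Suc l)"
        by (simp add: c_def)
      then show ?thesis using E_bracket_H[of l "Suc l" j k] jk l i by simp
    qed
    ultimately show "bracket (E k j \<otimes> E j k) (H l (Suc l) \<otimes> 1 + 1 \<otimes> H l (Suc l)) = 0"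
      by (simp add: bracket_add_right bracket_tensor tensor_simps)
  qed
qed

end


section \<open>Weights\<close>

lemma Q_plus_add: "\<beta> \<in> Q_plus N \<Longrightarrow> \<gamma> \<in> Q_plus N \<Longrightarrow> \<beta> + \<gamma> \<in> Q_plus N"
  unfolding Q_plus_def using Poly_Mapping.keys_add[of \<beta> \<gamma>] by (auto simp: lookup_add)

lemma Q_plus_zero: "0 \<in> Q_plus N"
  by (simp add: Q_plus_def)

lemma Q_plus_simple_root: "i \<in> {1..N} \<Longrightarrow> simple_root i \<in> Q_plus N"
  by (auto simp: Q_plus_def lookup_single when_def)

lemma Q_plus_sum: "(\<And>a. a \<in> I \<Longrightarrow> f a \<in> Q_plus N) \<Longrightarrow> (\<Sum>a\<in>I. f a) \<in> Q_plus N"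
  by (induction I rule: infinite_finite_induct) (auto simp: Q_plus_zero Q_plus_add)

lemma Q_plus_nonneg: "\<beta> \<in> Q_plus N \<Longrightarrow> 0 \<le> coweight_pairing j \<beta>"
  by (simp add: Q_plus_def)

lemma Q_plus_outside: "\<beta> \<in> Q_plus N \<Longrightarrow> j \<notin> {1..N} \<Longrightarrow> coweight_pairing j \<beta> = 0"
  by (auto simp: Q_plus_def in_keys_iff)

lemma Q_plus_I:
  "(\<And>j. 0 \<le> coweight_pairing j \<beta>) \<Longrightarrow> (\<And>j. j \<notin> {1..N} \<Longrightarrow> coweight_pairing j \<beta> = 0) \<Longrightarrow> \<beta> \<in> Q_plus N"
  unfolding Q_plus_def in_keys_iff subset_iff mem_Collect_eq by blast

definition Q_pos :: "nat \<Rightarrow> weight set" where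
  "Q_pos N = Q_plus N - {0}"

text \<open>
  \<open>Q_above N i\<close> will contain the weights, other than \<open>0\<close> and \<open>\<alpha>\<^sub>i\<close>, of the second factors in
  \<open>\<Delta> x\<^sup>+\<^sub>i\<^sub>,\<^sub>m\<close>.  As the coefficient of \<open>\<alpha>\<^sub>i\<close> is positive, taking the bracket with \<open>x\<^sup>-\<^sub>i\<^sub>,\<^sub>0\<close> does not
  lead out of \<open>Q_plus N\<close>.
\<close>

definition Q_above :: "nat \<Rightarrow> nat \<Rightarrow> weight set" where
  "Q_above N i = {\<beta> \<in> Q_plus N. 1 \<le> coweight_pairing i \<beta>} - {simple_root i}"

lemma Q_plus_add_eq_0:
  assumes "\<beta> \<in> Q_plus N" "\<gamma> \<in> Q_plus N" "\<beta> + \<gamma> = 0"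
  shows "\<beta> = 0"
proof (rule poly_mapping_eqI)
  fix j
  have "coweight_pairing j \<beta> + coweight_pairing j \<gamma> = 0"
    using assms(3) by (simp flip: lookup_add)
  then show "coweight_pairing j \<beta> = coweight_pairing j 0"
    using Q_plus_nonneg[OF assms(1), of j] Q_plus_nonneg[OF assms(2), of j] by simp
qed

lemma Q_pos_add: "\<beta> \<in> Q_pos N \<Longrightarrow> \<gamma> \<in> Q_plus N \<Longrightarrow> \<beta> + \<gamma> \<in> Q_pos N"
  using Q_plus_add_eq_0 by (auto simp: Q_pos_def Q_plus_add)

lemma Q_plus_add_pos: "\<beta> \<in> Q_plus N \<Longrightarrow> \<gamma> \<in> Q_pos N \<Longrightarrow> \<beta> + \<gamma> \<in> Q_pos N"
  using Q_pos_add[of \<gamma> N \<beta>] by (simp add: add.commute)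

lemma simple_root_add_Q_pos_above:
  assumes i: "i \<in> {1..N}" and "\<beta> \<in> Q_pos N"
  shows "simple_root i + \<beta> \<in> Q_above N i"
  using assms Q_plus_add[OF Q_plus_simple_root[OF i], of \<beta>] Q_plus_nonneg[of \<beta> N i]
  by (auto simp: Q_above_def Q_pos_def lookup_add)

lemma Q_above_add: "\<beta> \<in> Q_above N i \<Longrightarrow> \<gamma> \<in> Q_plus N \<Longrightarrow> \<beta> + \<gamma> \<in> Q_above N i"
proof -
  assume \<beta>: "\<beta> \<in> Q_above N i" and \<gamma>: "\<gamma> \<in> Q_plus N"
  have 1: "\<beta> \<in> Q_plus N" "1 \<le> coweight_pairing i \<beta>" "\<beta> \<noteq> simple_root i"
    using \<beta> by (auto simp: Q_above_def)
  have "\<beta> + \<gamma> \<noteq> simple_root i"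
  proof
    assume *: "\<beta> + \<gamma> = simple_root i"
    have "\<beta> = simple_root i"
    proof (rule poly_mapping_eqI)
      fix j
      have "coweight_pairing j \<beta> + coweight_pairing j \<gamma> = coweight_pairing j (simple_root i)"
        using * by (simp flip: lookup_add)
      then show "coweight_pairing j \<beta> = coweight_pairing j (simple_root i)"
        using Q_plus_nonneg[OF 1(1), of j] Q_plus_nonneg[OF \<gamma>, of j] 1(2)
        by (cases "j = i") (auto simp: lookup_single when_def)
    qed
    with 1 show False by simp
  qed
  then show ?thesis
    using 1 \<gamma> Q_plus_nonneg[OF \<gamma>, of i] by (auto simp: Q_above_def Q_plus_add lookup_add)
qed

lemma Q_above_add': "\<gamma> \<in> Q_plus N \<Longrightarrow> \<beta> \<in> Q_above N i \<Longrightarrow> \<gamma> + \<beta> \<in> Q_above N i"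
  using Q_above_add[of \<beta> N i \<gamma>] by (simp add: add.commute)

lemma Q_above_subset: "i \<in> {1..N} \<Longrightarrow> Q_above N i \<subseteq> Q_pos N"
  by (auto simp: Q_above_def Q_pos_def)

lemma Q_above_diff:
  assumes "\<beta> \<in> Q_above N i" "i \<in> {1..N}"
  shows "\<beta> - simple_root i \<in> Q_pos N"
proof -
  have "\<beta> - simple_root i \<in> Q_plus N"
  proof (rule Q_plus_I)
    fix j
    show "0 \<le> coweight_pairing j (\<beta> - simple_root i)"
      using assms Q_plus_nonneg[of \<beta> N j] by (auto simp: Q_above_def lookup_minus lookup_single when_def)
    show "coweight_pairing j (\<beta> - simple_root i) = 0" if "j \<notin> {1..N}"
      using assms that Q_plus_outside[of \<beta> N j] by (auto simp: Q_above_def lookup_minus lookup_single when_def)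
  qed
  then show ?thesis using assms by (auto simp: Q_pos_def Q_above_def)
qed

abbreviation root_sum :: "nat \<Rightarrow> nat \<Rightarrow> weight" where
  "root_sum j k \<equiv> (\<Sum>l=j..<k. simple_root l)"

lemma lookup_root_sum: "coweight_pairing i (root_sum j k) = (if i \<in> {j..<k} then 1 else 0)"
  by (simp add: lookup_sum lookup_single when_def)

lemma root_sum_Q_pos: "1 \<le> j \<Longrightarrow> j < k \<Longrightarrow> k \<le> Suc N \<Longrightarrow> root_sum j k \<in> Q_pos N"
proof -
  assume *: "1 \<le> j" "j < k" "k \<le> Suc N"
  have "root_sum j k \<noteq> 0"
  proof
    assume "root_sum j k = 0"
    then have "coweight_pairing j (root_sum j k) = 0" by (simp only: lookup_zero)
    then show False unfolding lookup_root_sum using * by simp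
  qed
  moreover have "root_sum j k \<in> Q_plus N"
    using * by (intro Q_plus_sum Q_plus_simple_root) auto
  ultimately show ?thesis by (simp add: Q_pos_def)
qed

lemma root_sum_Q_above:
  assumes "1 \<le> j" "j \<le> i" "i < k" "k \<le> Suc N" "j < i \<or> Suc i < k"
  shows "root_sum j k \<in> Q_above N i"
proof -
  have "root_sum j k \<noteq> simple_root i"
  proof
    assume "root_sum j k = simple_root i"
    then have *: "coweight_pairing l (root_sum j k) = coweight_pairing l (simple_root i)" for l
      by simp
    show False
      using *[of j] *[of "Suc i"] assms unfolding lookup_root_sum
      by (auto simp: lookup_single when_def split: if_splits)
  qed
  moreover have "root_sum j k \<in> Q_plus N"
    using root_sum_Q_pos[of j k N] assms by (simp add: Q_pos_def)
  moreover have "1 \<le> coweight_pairing i (root_sum j k)"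
    unfolding lookup_root_sum using assms by simp
  ultimately show ?thesis unfolding Q_above_def by blast
qed

section \<open>The root lattice grading of Y\<close>

lemma Y_wt_span: "cvs.subspace (Y_wt \<beta>)"
  by (simp add: Y_wt_def)

lemma Y_wt_induct [consumes 1, case_names word zero add scale]:
  assumes "y \<in> Y_wt \<beta>"
    and "\<And>w. word_wt w = \<beta> \<Longrightarrow> P (abs_yangian (mon w))" "P 0"
    "\<And>x y. P x \<Longrightarrow> P y \<Longrightarrow> P (x + y)" "\<And>c x. P x \<Longrightarrow> P (c *\<^sub>C x)"
  shows "P y"
  using assms(1) unfolding Y_wt_def
proof (induction rule: cvs.span_induct_alt)
  case (step c x y)
  then show ?case using assms by auto
qed (rule assms)

lemma word_wt_add: "word_wt (v + w) = word_wt v + word_wt w"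
  by (cases v; cases w) simp

lemma Y_wt_mult:
  assumes "x \<in> Y_wt \<beta>" "y \<in> Y_wt \<gamma>"
  shows "x * y \<in> Y_wt (\<beta> + \<gamma>)"
  using assms(1)
proof (induction rule: Y_wt_induct)
  case (word v)
  from assms(2) show ?case
  proof (induction rule: Y_wt_induct)
    case (word w)
    have "abs_yangian (mon v) * abs_yangian (mon w) = abs_yangian (mon (v + w))"
      by (simp add: mult_single flip: abs_yangian_hom)
    moreover have "word_wt (v + w) = \<beta> + \<gamma>" using word \<open>word_wt v = \<beta>\<close> by (simp add: word_wt_add)
    ultimately show ?case unfolding Y_wt_def by (auto intro: cvs.span_base)
  qed (auto simp: distrib_left mult_scaleC_right intro: cvs.subspace_0 cvs.subspace_add cvs.subspace_scale Y_wt_span)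
qed (auto simp: distrib_right mult_scaleC_left intro: cvs.subspace_0 cvs.subspace_add cvs.subspace_scale Y_wt_span)

lemma Y_wt_one: "(1 :: 'n::finite yangian) \<in> Y_wt 0"
proof -
  have "mon (Word []) = (1 :: 'n gen free_algebra)" by (simp flip: zero_word_def)
  then have "(1 :: 'n yangian) = abs_yangian (mon (Word []))" by (simp add: abs_yangian_hom)
  then show ?thesis unfolding Y_wt_def by (auto intro!: cvs.span_base exI[of _ "Word []"])
qed

lemma Y_wt_x: "i \<in> {1..CARD('n::finite)} \<Longrightarrow>
    (x_gen s i m :: 'n yangian) \<in> Y_wt (if s = Plus then simple_root i else - simple_root i)"
  unfolding Y_wt_def x_gen_def free_x_def
  by (auto intro!: cvs.span_base exI[of _ "Word [GX s (node i) m]"] simp: label_node)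

lemma Y_wt_xi: "(xi_gen i m :: 'n::finite yangian) \<in> Y_wt 0"
  unfolding Y_wt_def xi_gen_def free_xi_def
  by (auto intro!: cvs.span_base exI[of _ "Word [GXi (node i) m]"])

lemma Y_wt_bracket: "x \<in> Y_wt \<beta> \<Longrightarrow> y \<in> Y_wt \<gamma> \<Longrightarrow> bracket x y \<in> Y_wt (\<beta> + \<gamma>)"
  using Y_wt_mult[of y \<gamma> x \<beta>]
  by (auto simp: bracket_def add.commute intro: cvs.subspace_diff Y_wt_span Y_wt_mult)

lemma Y_zero_wt: "y \<in> Y_zero \<Longrightarrow> y \<in> Y_wt 0"
  unfolding Y_zero_def
proof (induction rule: subalgebra_gen.induct)
  case (mult x y)
  then show ?case using Y_wt_mult[of x 0 y 0] by simp
qed (auto intro: Y_wt_one Y_wt_xi cvs.subspace_add cvs.subspace_scale Y_wt_span)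


subsection \<open>Tensors graded by the weight of the second factor\<close>

text \<open>The first factor is left unrestricted, which makes these spaces stable under products
  with x \<otimes> 1 for every x.\<close>

definition VS :: "weight set \<Rightarrow> 'n::finite yangian2 set" where
  "VS \<Gamma> = cvs.span {x \<otimes> y | x y \<gamma>. \<gamma> \<in> \<Gamma> \<and> y \<in> Y_wt \<gamma>}"

lemma VS_subspace: "cvs.subspace (VS \<Gamma>)"
  by (simp add: VS_def)

lemmas VS_zero = cvs.subspace_0[OF VS_subspace]
  and VS_add = cvs.subspace_add[OF VS_subspace]
  and VS_diff = cvs.subspace_diff[OF VS_subspace]
  and VS_scale = cvs.subspace_scale[OF VS_subspace]
  and VS_sum = cvs.subspace_sum[OF VS_subspace]

lemma VS_tensor: "y \<in> Y_wt \<gamma> \<Longrightarrow> \<gamma> \<in> \<Gamma> \<Longrightarrow> x \<otimes> y \<in> VS \<Gamma>"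
  unfolding VS_def by (rule cvs.span_base) auto

lemma VS_mono: "\<Gamma> \<subseteq> \<Gamma>' \<Longrightarrow> VS \<Gamma> \<subseteq> VS \<Gamma>'"
  unfolding VS_def by (rule cvs.span_mono) auto

lemma VS_induct [consumes 1, case_names tensor zero add scale]:
  assumes "u \<in> VS \<Gamma>"
    and "\<And>x y \<gamma>. \<gamma> \<in> \<Gamma> \<Longrightarrow> y \<in> Y_wt \<gamma> \<Longrightarrow> P (x \<otimes> y)" "P 0"
    "\<And>x y. P x \<Longrightarrow> P y \<Longrightarrow> P (x + y)" "\<And>c x. P x \<Longrightarrow> P (c *\<^sub>C x)"
  shows "P u"
  using assms(1) unfolding VS_def
proof (induction rule: cvs.span_induct_alt)
  case (step c x y)
  then show ?case using assms by auto
qed (rule assms)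

lemma VS_mult:
  assumes "u \<in> VS \<Gamma>" "v \<in> VS \<Gamma>'" "\<And>\<gamma> \<gamma>'. \<gamma> \<in> \<Gamma> \<Longrightarrow> \<gamma>' \<in> \<Gamma>' \<Longrightarrow> \<gamma> + \<gamma>' \<in> \<Gamma>''"
  shows "u * v \<in> VS \<Gamma>''"
  using assms(1)
proof (induction rule: VS_induct)
  case (tensor x y \<gamma>)
  note xy = tensor
  from assms(2) show ?case
  proof (induction rule: VS_induct)
    case (tensor x' y' \<gamma>')
    then show ?case using xy assms(3) Y_wt_mult by (auto simp: tensor_mult intro!: VS_tensor)
  qed (auto simp: distrib_left mult_scaleC_right VS_zero VS_add VS_scale)
qed (auto simp: distrib_right mult_scaleC_left VS_zero VS_add VS_scale)

lemma VS_bracket: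
  assumes "u \<in> VS \<Gamma>" "v \<in> VS \<Gamma>'" "\<And>\<gamma> \<gamma>'. \<gamma> \<in> \<Gamma> \<Longrightarrow> \<gamma>' \<in> \<Gamma>' \<Longrightarrow> \<gamma> + \<gamma>' \<in> \<Gamma>''"
  shows "bracket u v \<in> VS \<Gamma>''"
  unfolding bracket_def
proof (rule VS_diff[OF VS_mult[OF assms(1-3)] VS_mult[OF assms(2,1)]])
  show "\<gamma> + \<gamma>' \<in> \<Gamma>''" if "\<gamma> \<in> \<Gamma>'" "\<gamma>' \<in> \<Gamma>" for \<gamma> \<gamma>'
    using assms(3)[OF that(2,1)] by (simp add: add.commute)
qed

lemma VS_left: "x \<otimes> 1 \<in> VS {0}"
  by (rule VS_tensor[OF Y_wt_one]) simp


section \<open>The coproduct modulo lower terms\<close>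

text \<open>The series F(z) \<otimes> F(z), the expected leading part of the coproduct of
  F(z).\<close>

definition LR :: "'n::finite yangian fps \<Rightarrow> 'n yangian2 fps" where
  "LR F = fps_map (\<lambda>y. y \<otimes> 1) F * fps_map (\<lambda>y. 1 \<otimes> y) F"

lemma LR_commute: "fps_map (\<lambda>y. 1 \<otimes> y) F * fps_map (\<lambda>x. x \<otimes> 1) G
    = fps_map (\<lambda>x. x \<otimes> 1) G * fps_map (\<lambda>y. 1 \<otimes> y) F"
proof (rule fps_ext)
  fix m
  have "(\<Sum>i=0..m. (G $ (m - i)) \<otimes> (F $ i)) = (\<Sum>i=0..m. (G $ i) \<otimes> (F $ (m - i)))"
    by (subst sum.atLeastAtMost_rev) simp
  then show "(fps_map (\<lambda>y. 1 \<otimes> y) F * fps_map (\<lambda>x. x \<otimes> 1) G) $ m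
    = (fps_map (\<lambda>x. x \<otimes> 1) G * fps_map (\<lambda>y. 1 \<otimes> y) F) $ m"
    by (simp add: fps_mult_nth tensor_mult)
qed

lemma LR_nth: "LR F $ m = (\<Sum>p\<le>m. (F $ (m - p)) \<otimes> (F $ p))"
proof -
  have "LR F $ m = (\<Sum>i=0..m. (F $ i) \<otimes> (F $ (m - i)))"
    by (simp add: LR_def fps_mult_nth tensor_mult)
  also have "\<dots> = (\<Sum>i=0..m. (F $ (m - i)) \<otimes> (F $ i))"
    by (subst sum.atLeastAtMost_rev) simp
  finally show ?thesis by (simp add: atLeast0AtMost)
qed

text \<open>The two tensor factors commute with each other, so this holds although Y is
  noncommutative. Hence F \<otimes> F inherits the multiplicative equations satisfied by F.\<close>

lemma LR_mult: "LR (F * G) = LR F * LR G"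
proof -
  let ?l = "fps_map (\<lambda>x. x \<otimes> 1)" and ?r = "fps_map (\<lambda>x. 1 \<otimes> x)"
  have "LR (F * G) = ?l F * (?l G * ?r F) * ?r G"
    by (simp only: LR_def fps_map_hom[OF tensor_hom_left] fps_map_hom[OF tensor_hom_right] mult.assoc)
  then show ?thesis unfolding LR_commute[symmetric] by (simp only: LR_def mult.assoc)
qed

lemma LR_one: "LR 1 = 1"
  by (simp add: LR_def fps_map_hom[OF tensor_hom_left] fps_map_hom[OF tensor_hom_right])

lemma LR_shift: "LR (z_shift c F) = z_shift c (LR F)"
  by (simp add: LR_def fps_map_hom[OF tensor_hom_left] fps_map_hom[OF tensor_hom_right] z_shift_mult)

lemma LR_nth_0: "F $ 0 = 1 \<Longrightarrow> LR F $ 0 = 1"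
  by (simp add: LR_nth tensor_one)

lemma LR_nth_1: "F $ 0 = 1 \<Longrightarrow> LR F $ 1 = (F $ 1) \<otimes> 1 + 1 \<otimes> (F $ 1)"
  by (simp add: LR_nth)

lemma LR_binomial_recursion:
  assumes "binomial_recursion a G"
  shows "binomial_recursion (a \<otimes> 1 + 1 \<otimes> a) (LR G)"
  unfolding LR_def
  by (rule binomial_recursion_mult[OF binomial_recursion_hom[OF tensor_hom_left assms]
        binomial_recursion_hom[OF tensor_hom_right assms]])
    (simp add: tensor_mult)

text \<open>Positive second weights span an ideal in the algebra of second weights in Q_+. Requiring
  both elements to lie in that algebra makes the congruence compatible with products.\<close>

definition lower_equal :: "'n::finite yangian2 \<Rightarrow> 'n yangian2 \<Rightarrow> bool" where
  "lower_equal u v \<longleftrightarrow> u \<in> VS (Q_plus CARD('n)) \<and> v \<in> VS (Q_plus CARD('n))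
     \<and> u - v \<in> VS (Q_pos CARD('n))"

lemma algebra_rel_lower_equal: "algebra_rel (lower_equal :: 'n::finite yangian2 \<Rightarrow> _)"
proof
  show "lower_equal 1 (1 :: 'n yangian2)"
    using VS_left[of 1] VS_mono[of "{0}" "Q_plus CARD('n)"]
    by (auto simp: lower_equal_def VS_zero tensor_one Q_plus_zero)
  fix x y x' y' :: "'n yangian2" and c
  assume xy: "lower_equal x y"
  then show "lower_equal (c *\<^sub>C x) (c *\<^sub>C y)"
    by (auto simp: lower_equal_def VS_scale simp flip: cvs.scale_right_diff_distrib)
  assume xy': "lower_equal x' y'"
  note xy = xy[unfolded lower_equal_def] and xy' = xy'[unfolded lower_equal_def]
  have "x + x' - (y + y') = (x - y) + (x' - y')" by simp
  with xy xy' show "lower_equal (x + x') (y + y')"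
    unfolding lower_equal_def by (metis VS_add)
  have "x * x' - y * y' = (x - y) * x' + y * (x' - y')" by (simp add: algebra_simps)
  moreover have "(x - y) * x' \<in> VS (Q_pos CARD('n))" "y * (x' - y') \<in> VS (Q_pos CARD('n))"
    using xy xy' by (blast intro: VS_mult Q_pos_add Q_plus_add_pos)+
  moreover have "x * x' \<in> VS (Q_plus CARD('n))" "y * y' \<in> VS (Q_plus CARD('n))"
    using xy xy' by (blast intro: VS_mult Q_plus_add)+
  ultimately show "lower_equal (x * x') (y * y')"
    unfolding lower_equal_def by (metis VS_add)
qed

text \<open>The quadratic correction cancels the anticommutator in the relation for \<xi>_{i,1}, so
  that the bracket with x^s_{i,m} is a multiple of x^s_{i,m+1}.\<close>

definition xi_shifted :: "nat \<Rightarrow> 'n::finite yangian" where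
  "xi_shifted i = xi_gen i 1 - (1/2) *\<^sub>C (xi_gen i 0 * xi_gen i 0)"

lemma bracket_xi_shifted:
  fixes i :: nat
  assumes i: "i \<in> {1..CARD('n::finite)}"
  shows "bracket (xi_shifted i) (x_gen s i m) = (2 * pm_sgn s) *\<^sub>C (x_gen s i (Suc m) :: 'n yangian)"
proof -
  let ?x = "x_gen s i m :: 'n yangian" and ?y = "x_gen s i (Suc m) :: 'n yangian" and ?h = "xi_gen i 0 :: 'n yangian"
  have 0: "bracket ?h (x_gen s i p) = (2 * pm_sgn s) *\<^sub>C x_gen s i p" for p
    using xi_zero_x[OF i i, of s p] by (simp add: mult.commute)
  have "bracket (xi_gen i 1) ?x = (2 * pm_sgn s) *\<^sub>C ?y + pm_sgn s *\<^sub>C (?h * ?x + ?x * ?h)"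
    using xi_x_step[OF i i, of 0 s m] by (simp add: 0 algebra_simps)
  moreover have "bracket (?h * ?h) ?x = (2 * pm_sgn s) *\<^sub>C (?h * ?x + ?x * ?h)"
    by (simp add: bracket_mult_left 0 scaleC_simps)
  ultimately show ?thesis
    by (simp add: xi_shifted_def bracket_simps scaleC_simps)
qed

context yangian_node
begin

lemma E_weight:
  assumes "1 \<le> j" "j < k" "k \<le> Suc CARD('n)"
  shows "E j k \<in> Y_wt (root_sum j k)" "E k j \<in> Y_wt (- root_sum j k)"
proof -
  show "E j k \<in> Y_wt (root_sum j k)"
    using assms(2,1,3)
  proof (induction rule: E_upper_induct)
    case (simple l)
    then show ?case using Y_wt_x[where ?'n = 'n, of l Plus 0] assms by simp
  next
    case (bracket l)
    then show ?case using Y_wt_bracket[of "E j l" _ "xp l 0"] by simp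
  qed
  show "E k j \<in> Y_wt (- root_sum j k)"
    using assms(2,1,3)
  proof (induction rule: E_lower_induct)
    case (simple l)
    then show ?case using Y_wt_x[where ?'n = 'n, of l Minus 0] assms by simp
  next
    case (bracket l)
    then show ?case using Y_wt_bracket[of "xm l 0" "- simple_root l" "E l j" "- root_sum j l"]
      by (simp add: algebra_simps)
  qed
qed

lemma E_commute_xp:
  assumes "1 \<le> j" "j < k" "k \<le> Suc CARD('n)" "k \<le> i \<or> i < j"
  shows "bracket (E k j) (xp i m) = 0"
proof -
  have x: "bracket (xp i m) (xm l 0) = 0" if "j \<le> l" "l < k" for l
    using that assms i x_plus_x_minus[where ?'n = 'n, of i l m 0] by auto
  have "bracket (xp i m) (E k j) = 0"
    using assms(2,1,3) by (induction rule: E_lower_induct) (auto simp: x bracket_commutes)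
  then show ?thesis by (rule bracket_eq_0_sym)
qed

abbreviation t :: "'n yangian" where "t \<equiv> xi_shifted i"

lemma bracket_t_x: "bracket t (xp i m) = 2 *\<^sub>C xp i (Suc m)"
  using bracket_xi_shifted[OF i, of Plus m] by simp

lemma bracket_xi_t: "bracket (xi_gen i p) t = 0"
  by (simp add: xi_shifted_def bracket_simps bracket_mult_right xi_xi[OF i i])

lemma t_weight: "t \<in> Y_wt 0"
  unfolding xi_shifted_def using Y_wt_mult[OF Y_wt_xi Y_wt_xi, of i 0 i 0]
  by (auto intro!: cvs.subspace_diff cvs.subspace_scale Y_wt_span Y_wt_xi)

text \<open>
  The second factors of these terms of \<open>\<Delta> t\<close> have weights outside \<open>Q_above\<close>.  They do not contribute
  to \<open>\<Delta> x\<^sup>+\<^sub>i\<^sub>,\<^sub>m\<close> because their first factors commute with \<open>x\<^sup>+\<^sub>i\<^sub>,\<^sub>m\<close>.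
\<close>

definition t_rest :: "'n yangian2" where
  "t_rest = (\<Sum>j\<in>{1..<i}. E i j \<otimes> E j i) + (\<Sum>k\<in>{i+2..Suc CARD('n)}. E k (Suc i) \<otimes> E (Suc i) k)"

lemma t_rest_commute: "bracket t_rest (xp i m \<otimes> 1) = 0"
proof -
  have "bracket (E i j) (xp i m) = 0" if "j \<in> {1..<i}" for j
    using E_commute_xp[of j i m] that i by simp
  moreover have "bracket (E k (Suc i)) (xp i m) = 0" if "k \<in> {i+2..Suc CARD('n)}" for k
    using E_commute_xp[of "Suc i" k m] that i by simp
  ultimately show ?thesis
    by (simp add: t_rest_def bracket_simps bracket_sum_left bracket_tensor)
qed

lemma t_rest_weight: "t_rest \<in> VS (Q_pos CARD('n))"
  unfolding t_rest_def using i
  by (intro VS_add VS_sum VS_tensor[OF E_weight(1)] root_sum_Q_pos) auto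

text \<open>Computed from \<xi>_{i,1} = [x^+_{i,1}, x^-_{i,0}], both of whose coproducts are known.
  The term \<xi>_{i,0} \<otimes> \<xi>_{i,0} is removed by the quadratic correction in
  \<open>t\<close>.\<close>

lemma \<Delta>_t: "\<Delta> t - (t \<otimes> 1 + 1 \<otimes> t - 2 *\<^sub>C (xm i 0 \<otimes> xp i 0) + t_rest) \<in> VS (Q_above CARD('n) i)"
proof -
  let ?y = "xm i 0 \<otimes> 1 + 1 \<otimes> xm i 0"
  let ?xi = "xi_gen i 0" and ?n = "Suc CARD('n)"
  have xi0: "\<Delta> (xi_gen i 0) = ?xi \<otimes> 1 + 1 \<otimes> ?xi" by (rule \<Delta>_xi0[OF i])
  have xm: "xm i 0 = E (Suc i) i" using E_simple(2)[OF i] ..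
  have xx: "bracket (xp i p) (xm i 0) = xi_gen i p" for p
    using x_plus_x_minus[OF i i, of p 0] by simp
  have hm: "bracket ?xi (xm i 0) = - (2 *\<^sub>C xm i 0)" using xi_zero_x[OF i i, of Minus 0] by simp
  have a: "bracket (E i j \<otimes> E j (Suc i)) ?y
      = bracket (E i j) (xm i 0) \<otimes> E j (Suc i) + E i j \<otimes> E j i"
    if "j \<in> {1..<i}" for j
    using E_bracket[of j "Suc i" i] that i by (simp add: bracket_simps bracket_tensor flip: xm)
  have b: "bracket (E k (Suc i) \<otimes> E i k) ?y
      = bracket (E k (Suc i)) (xm i 0) \<otimes> E i k - E k (Suc i) \<otimes> E (Suc i) k"
    if "k \<in> {i+2..?n}" for k
    using E_bracket[of "Suc i" i k] that i bracket_anti[of "E i k" "E (Suc i) i"]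
    by (simp add: bracket_simps bracket_tensor tensor_minus_right flip: xm)
  let ?r1 = "(\<Sum>j\<in>{1..<i}. bracket (E i j) (xm i 0) \<otimes> E j (Suc i))"
  let ?r2 = "(\<Sum>k\<in>{i+2..?n}. bracket (E k (Suc i)) (xm i 0) \<otimes> E i k)"
  have "xi_gen i 1 = bracket (xp i 1) (xm i 0)" using xx ..
  then have "\<Delta> (xi_gen i 1) = bracket (\<Delta> (xp i 1)) (\<Delta> (xm i 0))"
    by (simp add: algebra_homD(9)[OF \<Delta>_hom])
  also have "\<dots> = bracket (xp i 1 \<otimes> 1) ?y + bracket (1 \<otimes> xp i 1) ?y + bracket (?xi \<otimes> xp i 0) ?y
      + (\<Sum>j\<in>{1..<i}. bracket (E i j \<otimes> E j (Suc i)) ?y)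
      - (\<Sum>k\<in>{i+2..?n}. bracket (E k (Suc i) \<otimes> E i k) ?y)"
    unfolding \<Delta>_x1 \<Delta>_x0[OF i] Q_def bracket_add_left bracket_diff_left bracket_sum_left
    by (simp only: add.assoc add_diff_eq)
  also have "bracket (xp i 1 \<otimes> 1) ?y = xi_gen i 1 \<otimes> 1"
    using xx[of 1] by (simp add: bracket_simps bracket_tensor)
  also have "bracket (1 \<otimes> xp i 1) ?y = 1 \<otimes> xi_gen i 1"
    using xx[of 1] by (simp add: bracket_simps bracket_tensor)
  also have "bracket (?xi \<otimes> xp i 0) ?y = ?xi \<otimes> ?xi - 2 *\<^sub>C (xm i 0 \<otimes> xp i 0)"
    by (simp add: bracket_simps bracket_tensor xx hm tensor_simps)
  also have "(\<Sum>j\<in>{1..<i}. bracket (E i j \<otimes> E j (Suc i)) ?y) = ?r1 + (\<Sum>j\<in>{1..<i}. E i j \<otimes> E j i)"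
    unfolding sum.distrib[symmetric] using a by (rule sum.cong[OF refl])
  also have "(\<Sum>k\<in>{i+2..?n}. bracket (E k (Suc i) \<otimes> E i k) ?y)
      = ?r2 - (\<Sum>k\<in>{i+2..?n}. E k (Suc i) \<otimes> E (Suc i) k)"
    unfolding sum_subtractf[symmetric] using b by (rule sum.cong[OF refl])
  finally have xi1: "\<Delta> (xi_gen i 1)
      = xi_gen i 1 \<otimes> 1 + 1 \<otimes> xi_gen i 1 + ?xi \<otimes> ?xi - 2 *\<^sub>C (xm i 0 \<otimes> xp i 0)
      + t_rest + (?r1 - ?r2)"
    by (simp add: t_rest_def algebra_simps)
  have "\<Delta> (?xi * ?xi) = (?xi * ?xi) \<otimes> 1 + 1 \<otimes> (?xi * ?xi) + 2 *\<^sub>C (?xi \<otimes> ?xi)"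
    unfolding algebra_homD(3)[OF \<Delta>_hom] xi0
    by (simp add: ring_distribs tensor_mult scaleC_numeral mult_2)
  then have "\<Delta> t - (t \<otimes> 1 + 1 \<otimes> t - 2 *\<^sub>C (xm i 0 \<otimes> xp i 0) + t_rest) = ?r1 - ?r2"
    unfolding xi_shifted_def algebra_homD[OF \<Delta>_hom] xi1 by (simp add: tensor_simps scaleC_simps)
  moreover have "?r1 - ?r2 \<in> VS (Q_above CARD('n) i)"
    using i by (intro VS_diff VS_sum VS_tensor[OF E_weight(1)] root_sum_Q_above) auto
  ultimately show ?thesis by simp
qed

text \<open>The coefficients of \<xi>_i(z) \<otimes> x^+_i(z), which form the part of
  \<Delta>(x^+_{i,m}) with second weight \<alpha>_i.\<close>

definition B :: "nat \<Rightarrow> 'n yangian2" where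
  "B m = (\<Sum>p\<le>m. (xi_series i $ (m - p)) \<otimes> xp i p)"

lemma B_weight: "B m \<in> VS {simple_root i}"
  unfolding B_def using Y_wt_x[OF i, of Plus] by (intro VS_sum VS_tensor) auto

text \<open>Induction through 2 x^+_{i,m+1} = [t, x^+_{i,m}]. Three brackets assemble the new
  leading terms; the others have second weights in \<open>Q_above\<close>.\<close>

lemma \<Delta>_xp: "\<Delta> (xp i m) - (xp i m \<otimes> 1 + B m) \<in> VS (Q_above CARD('n) i)"
proof (induction m)
  case 0
  then show ?case using \<Delta>_x0[OF i, of Plus] by (simp add: B_def xi_series_nth VS_zero)
next
  case (Suc m)
  let ?Q = "Q_above CARD('n) i" and ?\<alpha> = "simple_root i"
  define r where "r = \<Delta> (xp i m) - (xp i m \<otimes> 1 + B m)"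
  define s where "s = \<Delta> t - (t \<otimes> 1 + 1 \<otimes> t - 2 *\<^sub>C (xm i 0 \<otimes> xp i 0) + t_rest)"
  let ?T = "t \<otimes> 1 + 1 \<otimes> t" and ?u = "2 *\<^sub>C (xm i 0 \<otimes> xp i 0)" and ?x = "xp i m \<otimes> 1"
  have r: "r \<in> VS ?Q" and s: "s \<in> VS ?Q" using Suc \<Delta>_t by (simp_all add: r_def s_def)
  have \<alpha>: "?\<alpha> \<in> Q_plus CARD('n)" "?\<alpha> \<in> Q_pos CARD('n)"
    using Q_plus_simple_root[of i "CARD('n)"] i by (auto simp: Q_pos_def)
  have T: "?T \<in> VS {0}" using t_weight by (intro VS_add VS_left VS_tensor) auto
  have u: "?u \<in> VS {?\<alpha>}" using Y_wt_x[OF i, of Plus 0] by (intro VS_scale VS_tensor) auto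
  have TB: "bracket ?T (B m) = 2 *\<^sub>C (\<Sum>p\<le>m. (xi_series i $ (m - p)) \<otimes> xp i (Suc p))"
  proof -
    have "bracket (xi_series i $ k) t = 0" for k
      by (cases k) (simp_all add: xi_series_nth bracket_xi_t)
    then have "bracket t (xi_series i $ k) = 0" for k by (rule bracket_eq_0_sym)
    then show ?thesis unfolding B_def bracket_sum_right cvs.scale_sum_right
      by (intro sum.cong refl) (simp add: bracket_simps bracket_tensor bracket_t_x tensor_simps)
  qed
  have ux: "bracket ?u ?x = - (2 *\<^sub>C (xi_gen i m \<otimes> xp i 0))"
    using x_plus_x_minus[OF i i, of m 0] bracket_anti[of "xm i 0" "xp i m"]
    by (simp add: bracket_simps bracket_tensor tensor_simps)
  have "2 *\<^sub>C \<Delta> (xp i (Suc m)) = \<Delta> (bracket t (xp i m))"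
    by (simp add: bracket_t_x algebra_homD(4)[OF \<Delta>_hom])
  also have "\<dots> = bracket (?T - ?u + t_rest + s) (?x + B m + r)"
    by (simp add: algebra_homD(9)[OF \<Delta>_hom] r_def s_def)
  also have "\<dots> = bracket ?T ?x + bracket ?T (B m) - bracket ?u ?x
      + (bracket ?T r - bracket ?u (B m) - bracket ?u r + bracket t_rest (B m) + bracket t_rest r
        + bracket s ?x + bracket s (B m) + bracket s r)"
    by (simp add: bracket_add_left bracket_add_right bracket_diff_left t_rest_commute)
  also have "bracket ?T ?x = 2 *\<^sub>C (xp i (Suc m) \<otimes> 1)"
    by (simp add: bracket_simps bracket_tensor bracket_t_x tensor_simps)
  finally have "2 *\<^sub>C \<Delta> (xp i (Suc m)) = 2 *\<^sub>C (xp i (Suc m) \<otimes> 1 +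
      ((\<Sum>p\<le>m. (xi_series i $ (m - p)) \<otimes> xp i (Suc p)) + xi_gen i m \<otimes> xp i 0))
      + (bracket ?T r - bracket ?u (B m) - bracket ?u r + bracket t_rest (B m) + bracket t_rest r
        + bracket s ?x + bracket s (B m) + bracket s r)"
    unfolding TB ux by (simp add: scaleC_add_right)
  also have "(\<Sum>p\<le>m. (xi_series i $ (m - p)) \<otimes> xp i (Suc p)) + xi_gen i m \<otimes> xp i 0 = B (Suc m)"
    unfolding B_def sum.atMost_Suc_shift[of _ m] by (simp add: xi_series_nth add.commute)
  finally have eq: "2 *\<^sub>C (\<Delta> (xp i (Suc m)) - (xp i (Suc m) \<otimes> 1 + B (Suc m)))
      = bracket ?T r - bracket ?u (B m) - bracket ?u r + bracket t_rest (B m) + bracket t_rest r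
        + bracket s ?x + bracket s (B m) + bracket s r"
    by (simp add: cvs.scale_right_diff_distrib)
  have "bracket ?T r \<in> VS ?Q" by (rule VS_bracket[OF T r]) simp
  moreover have "bracket ?u (B m) \<in> VS ?Q"
    by (rule VS_bracket[OF u B_weight])
      (simp only: singleton_iff, rule simple_root_add_Q_pos_above[OF i \<alpha>(2)])
  moreover have "bracket ?u r \<in> VS ?Q"
    by (rule VS_bracket[OF u r]) (use Q_above_add' \<alpha> in auto)
  moreover have "bracket t_rest (B m) \<in> VS ?Q"
    by (rule VS_bracket[OF t_rest_weight B_weight])
      (use simple_root_add_Q_pos_above[of i "CARD('n)"] i in \<open>auto simp: add.commute\<close>)
  moreover have "bracket t_rest r \<in> VS ?Q"
    by (rule VS_bracket[OF t_rest_weight r]) (use Q_above_add' in \<open>auto simp: Q_pos_def\<close>)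
  moreover have "bracket s ?x \<in> VS ?Q" by (rule VS_bracket[OF s VS_left]) simp
  moreover have "bracket s (B m) \<in> VS ?Q"
    by (rule VS_bracket[OF s B_weight]) (use Q_above_add \<alpha> in auto)
  moreover have "bracket s r \<in> VS ?Q"
    by (rule VS_bracket[OF s r], rule Q_above_add) (simp_all add: Q_above_def)
  ultimately have "2 *\<^sub>C (\<Delta> (xp i (Suc m)) - (xp i (Suc m) \<otimes> 1 + B (Suc m))) \<in> VS ?Q"
    unfolding eq by (intro VS_add VS_diff)
  from VS_scale[OF this, of "1/2"] show ?case by (simp add: scaleC_scaleC)
qed

text \<open>The bracket of \<Delta>(x^+_{i,k}) with \<Delta>(x^-_{i,0}). Besides the first leading
  term, only \<open>B\<close> bracketed with 1 \<otimes> x^-_{i,0} returns to second weight 0; the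
  remainder loses at most \<alpha>_i and stays positive.\<close>

lemma \<Delta>_xi: "\<Delta> (xi_series i $ m) - LR (xi_series i) $ m \<in> VS (Q_pos CARD('n))"
proof (cases m)
  case 0
  then show ?thesis
    by (simp add: LR_nth xi_series_nth algebra_homD[OF \<Delta>_hom] tensor_one VS_zero)
next
  case (Suc k)
  define r where "r = \<Delta> (xp i k) - (xp i k \<otimes> 1 + B k)"
  have r: "r \<in> VS (Q_above CARD('n) i)" using \<Delta>_xp by (simp add: r_def)
  let ?y = "xm i 0"
  have xx: "bracket (xp i p) (xm i 0) = xi_gen i p" for p
    using x_plus_x_minus[OF i i, of p 0] by simp
  have "\<Delta> (xi_gen i k) = bracket (xp i k \<otimes> 1 + B k + r) (?y \<otimes> 1 + 1 \<otimes> ?y)"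
    using algebra_homD(9)[OF \<Delta>_hom, of "xp i k" ?y] \<Delta>_x0[OF i, of Minus] xx by (simp add: r_def)
  also have "\<dots> = xi_gen i k \<otimes> 1 + bracket (B k) (1 \<otimes> ?y)
      + (bracket (B k) (?y \<otimes> 1) + bracket r (?y \<otimes> 1) + bracket r (1 \<otimes> ?y))"
    by (simp add: bracket_add_left bracket_add_right bracket_tensor xx)
  also have "bracket (B k) (1 \<otimes> ?y) = (\<Sum>p\<le>k. (xi_series i $ (k - p)) \<otimes> xi_gen i p)"
    unfolding B_def bracket_sum_left by (simp add: bracket_tensor xx)
  also have "xi_gen i k \<otimes> 1 + (\<Sum>p\<le>k. (xi_series i $ (k - p)) \<otimes> xi_gen i p) = LR (xi_series i) $ m"
    unfolding LR_nth Suc by (subst sum.atMost_Suc_shift) (simp add: xi_series_nth)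
  finally have eq: "\<Delta> (xi_series i $ m) - LR (xi_series i) $ m
      = bracket (B k) (?y \<otimes> 1) + bracket r (?y \<otimes> 1) + bracket r (1 \<otimes> ?y)"
    by (simp add: Suc xi_series_nth)
  have \<alpha>: "simple_root i \<in> Q_pos CARD('n)"
    using Q_plus_simple_root[of i "CARD('n)"] i by (auto simp: Q_pos_def)
  have "bracket (B k) (?y \<otimes> 1) \<in> VS (Q_pos CARD('n))"
    by (rule VS_bracket[OF B_weight VS_left]) (simp add: \<alpha>)
  moreover have "bracket r (?y \<otimes> 1) \<in> VS (Q_pos CARD('n))"
    by (rule VS_bracket[OF r VS_left]) (use Q_above_subset i in auto)
  moreover have "1 \<otimes> ?y \<in> VS {- simple_root i}"
    using Y_wt_x[OF i, of Minus 0] by (intro VS_tensor) auto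
  then have "bracket r (1 \<otimes> ?y) \<in> VS (Q_pos CARD('n))"
    by (rule VS_bracket[OF r]) (use Q_above_diff[OF _ i] in auto)
  ultimately show ?thesis unfolding eq by (intro VS_add)
qed

end

section \<open>Transfer of leading terms from \<xi>_i to A_i and S_i\<close>

context yangian_context
begin

lemma lower_equal_xi:
  assumes "i \<in> {1..CARD('n)}"
  shows "lower_equal (\<Delta> (xi_series i $ m)) (LR (xi_series i) $ m)"
proof -
  interpret yangian_node \<iota> \<Delta> A S i by unfold_locales (rule assms)
  have "xi_series i $ p \<in> Y_wt 0" for p by (cases p) (auto simp: xi_series_nth Y_wt_one Y_wt_xi)
  then have LR: "LR (xi_series i) $ m \<in> VS (Q_plus CARD('n))"
    unfolding LR_nth by (intro VS_sum VS_tensor[of _ 0]) (auto simp: Q_plus_zero)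
  have d: "\<Delta> (xi_series i $ m) - LR (xi_series i) $ m \<in> VS (Q_pos CARD('n))" by (rule \<Delta>_xi)
  then have "\<Delta> (xi_series i $ m) - LR (xi_series i) $ m \<in> VS (Q_plus CARD('n))"
    using VS_mono[of "Q_pos CARD('n)" "Q_plus CARD('n)"] by (auto simp: Q_pos_def)
  from VS_add[OF this LR] show ?thesis using d LR by (simp add: lower_equal_def)
qed

lemma \<Delta>_algebra_hom: "algebra_hom \<Delta>"
  using \<Delta> by (simp add: yangian_coproduct_def Let_def)

lemma lower_equal_A:
  assumes i: "i \<in> {1..CARD('n)}"
  shows "lower_equal (\<Delta> (A i $ m)) (LR (A i) $ m)"
proof -
  interpret algebra_rel "lower_equal :: 'n yangian2 \<Rightarrow> _" by (rule algebra_rel_lower_equal)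
  note A' = A[unfolded GKLO_series_def]
  have A0: "A i $ 0 = 1" if "i \<in> {1..CARD('n)}" for i using A' that by blast
  have eq: "xi_series i * (A i * z_shift (- 1) (A i))
      = z_shift (- 1 / 2) (A (i - 1)) * z_shift (- 1 / 2) (A (i + 1))" if "i \<in> {1..CARD('n)}" for i
    using A' that by blast
  note hom = fps_map_hom[OF \<Delta>_algebra_hom]
  have "lower_equal (fps_map \<Delta> (A i) $ m) (LR (A i) $ m)"
  proof (rule GKLO[where n = "CARD('n)" and X = "\<lambda>i. fps_map \<Delta> (xi_series i)" and X' = "\<lambda>i. LR (xi_series i)"])
    show "fps_map \<Delta> (xi_series i) * (fps_map \<Delta> (A i) * z_shift (- 1) (fps_map \<Delta> (A i)))
        = z_shift (- 1 / 2) (fps_map \<Delta> (A (i - 1))) * z_shift (- 1 / 2) (fps_map \<Delta> (A (i + 1)))"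
      if "i \<in> {1..CARD('n)}" for i
      unfolding hom[symmetric] eq[OF that] ..
    show "LR (xi_series i) * (LR (A i) * z_shift (- 1) (LR (A i)))
        = z_shift (- 1 / 2) (LR (A (i - 1))) * z_shift (- 1 / 2) (LR (A (i + 1)))"
      if "i \<in> {1..CARD('n)}" for i
      unfolding LR_shift[symmetric] LR_mult[symmetric] eq[OF that] ..
    show "lower_equal (fps_map \<Delta> (xi_series i) $ m) (LR (xi_series i) $ m)" if "i \<in> {1..CARD('n)}"
        for i m
      using lower_equal_xi[OF that] by simp
  qed (use A' A0 i in \<open>simp_all add: hom LR_one LR_nth_0 xi_series_nth algebra_homD[OF \<Delta>_algebra_hom]\<close>)
  then show ?thesis by simp
qed

text \<open>\<Delta>(S_i) and S_i \<otimes> S_i solve the same difference equation with congruent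
  inputs. The parameter of the correction factor is \<Delta>(a_0) for the former and a_0 \<otimes> 1
  + 1 \<otimes> a_0 for the latter.\<close>

lemma lower_equal_S:
  assumes i: "i \<in> {1..CARD('n)}"
  shows "lower_equal (\<Delta> (S i $ m)) (LR (S i) $ m)"
proof -
  interpret algebra_rel "lower_equal :: 'n yangian2 \<Rightarrow> _" by (rule algebra_rel_lower_equal)
  note hom = fps_map_hom[OF \<Delta>_algebra_hom]
  obtain G where G: "S i $ 0 = 1" "binomial_recursion (A i $ 1) G" "z_shift 1 (S i) = S i * (A i * G)"
    by (rule S_seriesE[OF S i])
  have A0: "A i $ 0 = 1" using A i unfolding GKLO_series_def by blast
  have G0: "G $ 0 = 1" using G(2) by (simp add: binomial_recursion_def)
  have H: "(A i * G) $ 0 = 1" "(A i * G) $ 1 = 0"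
    using A0 G0 fps_mult_nth_1[OF A0 G0] binomial_recursion_nth_1[OF G(2)] by simp_all
  have RA: "lower_equal (fps_map \<Delta> (A i) $ m) (LR (A i) $ m)" for m
    using lower_equal_A[OF i] by simp
  have RG: "lower_equal (fps_map \<Delta> G $ m) (LR G $ m)" for m
    by (rule binomial[OF binomial_recursion_hom[OF \<Delta>_algebra_hom G(2)] LR_binomial_recursion[OF G(2)]])
      (use RA[of 1] LR_nth_1[OF A0] in simp)
  have RH: "lower_equal (fps_map \<Delta> (A i * G) $ m) (LR (A i * G) $ m)" for m
    unfolding hom LR_mult by (rule mult_lt[of "Suc m"]) (use RA RG in auto)
  have "lower_equal (fps_map \<Delta> (S i) $ m) (LR (S i) $ m)"
  proof (rule shift_equation[OF _ _ _ _ _ _ RH])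
    show "z_shift 1 (fps_map \<Delta> (S i)) = fps_map \<Delta> (S i) * fps_map \<Delta> (A i * G)"
      unfolding hom[symmetric] G(3) ..
    show "z_shift 1 (LR (S i)) = LR (S i) * LR (A i * G)"
      unfolding LR_shift[symmetric] LR_mult[symmetric] G(3) ..
    show "LR (A i * G) $ 1 = 0" unfolding LR_nth_1[OF H(1)] H(2) by simp
  qed (use G(1) H in \<open>simp_all add: LR_nth_0 algebra_homD[OF \<Delta>_algebra_hom]\<close>)
  then show ?thesis by simp
qed

end

context yangian_node
begin

lemma E_sum_weight: "E_sum \<iota> i \<in> VS (Q_pos CARD('n))"
  unfolding E_sum_alt using i
  by (intro VS_sum VS_tensor[OF E_weight(1)] root_sum_Q_pos) auto

lemma lower_equal_T: "lower_equal (T $ m) (1 $ m)"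
proof (cases m)
  case 0
  then show ?thesis
    using algebra_rel.one[OF algebra_rel_lower_equal] by (simp add: T_def fps_exponential_linear_nth)
next
  case (Suc k)
  have "E_sum \<iota> i ^ Suc k \<in> VS (Q_pos CARD('n))" for k
  proof (induction k)
    case (Suc k)
    then show ?case unfolding power_Suc[of _ "Suc k"]
      by (rule VS_mult[OF E_sum_weight]) (use Q_pos_add in \<open>auto simp: Q_pos_def\<close>)
  qed (simp add: E_sum_weight)
  then have T: "T $ m \<in> VS (Q_pos CARD('n))"
    unfolding T_def fps_exponential_linear_nth Suc by (intro VS_scale)
  then have "T $ m \<in> VS (Q_plus CARD('n))"
    using VS_mono[of "Q_pos CARD('n)" "Q_plus CARD('n)"] by (auto simp: Q_pos_def)
  then show ?thesis using T Suc by (simp add: lower_equal_def VS_zero)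
qed

lemma lower_equal_D: "lower_equal (D $ m) (LR (S i) $ m)"
proof -
  interpret algebra_rel "lower_equal :: 'n yangian2 \<Rightarrow> _" by (rule algebra_rel_lower_equal)
  have S0: "S i $ m \<in> Y_wt 0" for m
    using S i Y_zero_wt unfolding S_series_def by blast
  have R: "lower_equal (SR $ m) (SR $ m)" and L: "lower_equal (SL $ m) (SL $ m)" for m
    unfolding lower_equal_def SR_def SL_def
    by (auto intro!: VS_tensor[OF S0] VS_tensor[OF Y_wt_one] simp: Q_plus_zero VS_zero)
  have "lower_equal ((SR * T) $ m) ((SR * 1) $ m)" for m
    by (rule mult_lt[of "Suc m", OF R lower_equal_T]) simp
  then have "lower_equal ((SR * T * SL) $ m) ((SR * 1 * SL) $ m)"
    by (intro mult_lt[of "Suc m", OF _ L]) simp_all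
  then show ?thesis by (simp add: D_def SR_def SL_def LR_def LR_commute)
qed

lemma difference_lower: "\<Delta> (S i $ m) - D $ m \<in> VS (Q_pos CARD('n))"
proof -
  have "\<Delta> (S i $ m) - D $ m = (\<Delta> (S i $ m) - LR (S i) $ m) - (D $ m - LR (S i) $ m)" by simp
  then show ?thesis
    using lower_equal_S[OF i, of m] lower_equal_D[of m] VS_diff unfolding lower_equal_def by metis
qed

end


section \<open>Separation of weights\<close>

text \<open>The value of the simple coroot of node l on \<gamma>, that is, the eigenvalue of
  \<xi>_{l,0} on weight \<gamma>.\<close>

definition root_pairing :: "nat \<Rightarrow> nat \<Rightarrow> weight \<Rightarrow> int" where
  "root_pairing N l \<gamma> = (\<Sum>j=1..N. cartan l j * coweight_pairing j \<gamma>)"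

lemma root_pairing_simps:
  "root_pairing N l 0 = 0"
  "root_pairing N l (\<gamma> + \<delta>) = root_pairing N l \<gamma> + root_pairing N l \<delta>"
  "root_pairing N l (\<gamma> - \<delta>) = root_pairing N l \<gamma> - root_pairing N l \<delta>"
  "root_pairing N l (- \<gamma>) = - root_pairing N l \<gamma>"
  by (simp_all only: root_pairing_def lookup_zero mult_zero_right sum.neutral_const lookup_add
      lookup_minus lookup_uminus distrib_left right_diff_distrib mult_minus_right sum.distrib
      sum_subtractf sum_negf)

lemma root_pairing_simple_root: "j \<in> {1..N} \<Longrightarrow> root_pairing N l (simple_root j) = cartan l j"
proof -
  assume j: "j \<in> {1..N}"
  have "root_pairing N l (simple_root j) = (\<Sum>k=1..N. if k = j then cartan l j else 0)"
    unfolding root_pairing_def by (intro sum.cong refl) (auto simp: lookup_single when_def)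
  then show ?thesis using j by simp
qed

text \<open>The leftmost maximum of a family of integers with a positive entry pairs positively.\<close>

lemma root_pairing_pos:
  assumes "j \<in> {1..N}" "coweight_pairing j \<delta> > 0"
  obtains l where "l \<in> {1..N}" "root_pairing N l \<delta> > 0"
proof -
  define d where "d = (\<lambda>j. coweight_pairing j \<delta>)"
  define M where "M = Max (d ` {1..N})"
  have M: "d j \<le> M" if "j \<in> {1..N}" for j using that by (simp add: M_def)
  have "M \<in> d ` {1..N}" unfolding M_def using assms by (intro Max_in) auto
  then have ex: "\<exists>l. l \<in> {1..N} \<and> d l = M" by auto
  define l where "l = (LEAST l. l \<in> {1..N} \<and> d l = M)"
  have l: "l \<in> {1..N}" "d l = M" using LeastI_ex[OF ex] by (simp_all add: l_def)
  have less: "d k < M" if "k \<in> {1..N}" "k < l" for k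
    using not_less_Least[of k "\<lambda>l. l \<in> {1..N} \<and> d l = M"] that M[of k] by (force simp: l_def)
  have Mpos: "0 < M" using assms M[of j] by (simp add: d_def)
  have "root_pairing N l \<delta> = (\<Sum>j=1..N. (if j = l then 2 * d l else 0)
      - (if j = l - 1 then d (l - 1) else 0) - (if j = Suc l then d (Suc l) else 0))"
    unfolding root_pairing_def using l by (intro sum.cong refl) (auto simp: cartan_def d_def)
  also have "\<dots>
      = 2 * d l - (if l - 1 \<in> {1..N} then d (l - 1) else 0) - (if Suc l \<in> {1..N} then d (Suc l) else 0)"
    unfolding sum_subtractf using l by simp
  also have "\<dots> > 0"
    using M[of "Suc l"] less[of "l - 1"] Mpos l by (auto split: if_splits)
  finally show thesis using that l by blast
qed

text \<open>Nondegeneracy of the Cartan matrix: one of the two differences has a positive entry, so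
  some simple coroot is positive on it.\<close>

lemma root_pairing_separates:
  assumes "Poly_Mapping.keys \<gamma> \<subseteq> {1..N}" "Poly_Mapping.keys \<delta> \<subseteq> {1..N}" "\<gamma> \<noteq> \<delta>"
  obtains l where "l \<in> {1..N}" "root_pairing N l \<gamma> \<noteq> root_pairing N l \<delta>"
proof -
  have "\<exists>j. coweight_pairing j \<gamma> \<noteq> coweight_pairing j \<delta>"
    using assms(3) by (metis poly_mapping_eqI)
  then obtain j where j: "coweight_pairing j \<gamma> \<noteq> coweight_pairing j \<delta>" ..
  then have jN: "j \<in> {1..N}" using assms(1,2) by (metis in_keys_iff subsetD)
  consider "coweight_pairing j (\<gamma> - \<delta>) > 0" | "coweight_pairing j (\<delta> - \<gamma>) > 0"
    using j by (simp add: lookup_minus) linarith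
  then show thesis
  proof cases
    case 1
    from root_pairing_pos[OF jN this] obtain l where "l \<in> {1..N}" "root_pairing N l (\<gamma> - \<delta>) > 0" .
    then show thesis using that[of l] unfolding root_pairing_simps by linarith
  next
    case 2
    from root_pairing_pos[OF jN this] obtain l where "l \<in> {1..N}" "root_pairing N l (\<delta> - \<gamma>) > 0" .
    then show thesis using that[of l] unfolding root_pairing_simps by linarith
  qed
qed

text \<open>For a suitable l, subtracting from ad h_l its eigenvalue at \<gamma>0 kills that summand
  while multiplying the one at \<gamma> by a nonzero scalar.\<close>

lemma eigenvectors_independent:
  fixes v :: "weight \<Rightarrow> 'b::complex_algebra_1"
  assumes "finite \<Gamma>" "\<And>\<gamma>. \<gamma> \<in> \<Gamma> \<Longrightarrow> Poly_Mapping.keys \<gamma> \<subseteq> {1..N}"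
    and "\<And>\<gamma> l. \<gamma> \<in> \<Gamma> \<Longrightarrow> l \<in> {1..N} \<Longrightarrow> bracket (h l) (v \<gamma>) = of_int (root_pairing N l \<gamma>) *\<^sub>C v \<gamma>"
    and "(\<Sum>\<gamma>\<in>\<Gamma>. v \<gamma>) = 0" "\<gamma> \<in> \<Gamma>"
  shows "v \<gamma> = 0"
  using assms
proof (induction \<Gamma> arbitrary: v \<gamma> rule: finite_induct)
  case (insert \<gamma>0 \<Gamma>)
  have zero: "v \<gamma> = 0" if \<gamma>: "\<gamma> \<in> \<Gamma>" for \<gamma>
  proof -
    obtain l where l: "l \<in> {1..N}" "root_pairing N l \<gamma> \<noteq> root_pairing N l \<gamma>0"
      using root_pairing_separates[of \<gamma> N \<gamma>0] insert.prems(1)[of \<gamma>] insert.prems(1)[of \<gamma>0] insert.hyps \<gamma> by blast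
    define c where "c \<gamma> = (of_int (root_pairing N l \<gamma> - root_pairing N l \<gamma>0) :: complex)" for \<gamma>
    have "0
        = bracket (h l) (\<Sum>\<gamma>\<in>insert \<gamma>0 \<Gamma>. v \<gamma>) - of_int (root_pairing N l \<gamma>0) *\<^sub>C (\<Sum>\<gamma>\<in>insert \<gamma>0 \<Gamma>. v \<gamma>)"
      unfolding insert.prems(3) by simp
    also have "\<dots> = (\<Sum>\<gamma>\<in>insert \<gamma>0 \<Gamma>. c \<gamma> *\<^sub>C v \<gamma>)"
      unfolding bracket_sum_right cvs.scale_sum_right sum_subtractf[symmetric] c_def
    proof (rule sum.cong[OF refl])
      fix \<gamma> assume "\<gamma> \<in> insert \<gamma>0 \<Gamma>"
      then have "bracket (h l) (v \<gamma>) = of_int (root_pairing N l \<gamma>) *\<^sub>C v \<gamma>"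
        using insert.prems(2) l(1) by blast
      then show "bracket (h l) (v \<gamma>) - of_int (root_pairing N l \<gamma>0) *\<^sub>C v \<gamma>
          = of_int (root_pairing N l \<gamma> - root_pairing N l \<gamma>0) *\<^sub>C v \<gamma>"
        by (simp only: of_int_diff cvs.scale_left_diff_distrib)
    qed
    also have "\<dots> = (\<Sum>\<gamma>\<in>\<Gamma>. c \<gamma> *\<^sub>C v \<gamma>)"
      using insert.hyps by (simp add: c_def)
    finally have sum: "(\<Sum>\<gamma>\<in>\<Gamma>. c \<gamma> *\<^sub>C v \<gamma>) = 0" ..
    have "c \<gamma> *\<^sub>C v \<gamma> = 0"
    proof (rule insert.IH[where v = "\<lambda>\<gamma>. c \<gamma> *\<^sub>C v \<gamma>", OF _ _ sum \<gamma>])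
      show "bracket (h l) (c \<gamma> *\<^sub>C v \<gamma>) = of_int (root_pairing N l \<gamma>) *\<^sub>C c \<gamma> *\<^sub>C v \<gamma>"
        if "\<gamma> \<in> \<Gamma>" "l \<in> {1..N}" for \<gamma> l
        using insert.prems(2)[of \<gamma> l] that by (simp add: bracket_scaleC_right scaleC_scaleC mult.commute)
    qed (use insert.prems(1) in blast)
    moreover have "c \<gamma> \<noteq> 0" using l(2) by (simp add: c_def)
    ultimately show ?thesis by simp
  qed
  then have "(\<Sum>\<gamma>\<in>\<Gamma>. v \<gamma>) = 0" by (simp add: sum.neutral)
  then have "v \<gamma>0 = 0" using insert.prems(3) insert.hyps by simp
  then show ?case using zero insert.prems(4) by blast
qed simp

lemma Y_wt_eigen:
  fixes y :: "'n::finite yangian"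
  assumes l: "l \<in> {1..CARD('n)}" and "y \<in> Y_wt \<gamma>"
  shows "bracket (xi_gen l 0) y = of_int (root_pairing CARD('n) l \<gamma>) *\<^sub>C y"
  using assms(2)
proof (induction rule: Y_wt_induct)
  case (word w)
  have "bracket (xi_gen l 0) (abs_yangian (mon (Word gs)))
      = of_int (root_pairing CARD('n) l (word_wt (Word gs))) *\<^sub>C abs_yangian (mon (Word gs))"
    for gs :: "'n gen list"
  proof (induction gs)
    case Nil
    have "mon (Word []) = (1 :: 'n gen free_algebra)" by (simp flip: zero_word_def)
    then show ?case by (simp add: abs_yangian_hom root_pairing_simps)
  next
    case (Cons g gs)
    have *: "mon (Word (g # gs)) = mon (Word [g]) * (mon (Word gs) :: 'n gen free_algebra)"
      by (simp add: mult_single)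
    have "bracket (xi_gen l 0) (abs_yangian (mon (Word [g])))
        = of_int (root_pairing CARD('n) l (gen_wt g)) *\<^sub>C abs_yangian (mon (Word [g]))"
    proof (cases g)
      case (GX s j m)
      then have "abs_yangian (mon (Word [g])) = x_gen s (label j) m"
        by (simp add: x_gen_def free_x_def node_label)
      then show ?thesis using xi_zero_x[OF l label_range[of j], of s m] GX
        by (cases s) (simp_all add: root_pairing_simps root_pairing_simple_root[OF label_range])
    next
      case (GXi j m)
      then have "abs_yangian (mon (Word [g])) = xi_gen (label j) m"
        by (simp add: xi_gen_def free_xi_def node_label)
      then show ?thesis using xi_xi[OF l label_range[of j], of 0 m] GXi
          by (simp add: root_pairing_simps)
    qed
    then show ?case
      using Cons by (simp add: * abs_yangian_hom bracket_mult_right root_pairing_simps scaleC_simps)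
  qed
  then show ?case using word by (cases w) auto
qed (simp_all add: bracket_add_right bracket_scaleC_right scaleC_add_right scaleC_scaleC mult.commute)

lemma VS_eigen:
  fixes u :: "'n::finite yangian2"
  assumes l: "l \<in> {1..CARD('n)}" and "u \<in> VS {\<gamma>}"
  shows "bracket (1 \<otimes> xi_gen l 0) u = of_int (root_pairing CARD('n) l \<gamma>) *\<^sub>C u"
  using assms(2)
proof (induction rule: VS_induct)
  case (tensor x y \<gamma>')
  then show ?case using Y_wt_eigen[OF l, of y \<gamma>] by (simp add: bracket_tensor tensor_simps)
qed (simp_all add: bracket_add_right bracket_scaleC_right scaleC_add_right scaleC_scaleC mult.commute)

text \<open>Directness of the decomposition by second weights, read off from the eigenvalues of 1
  \<otimes> \<xi>_{l,0}.\<close>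

lemma VS_independent:
  fixes v :: "weight \<Rightarrow> 'n::finite yangian2"
  assumes "finite \<Gamma>" "\<Gamma> \<subseteq> Q_plus CARD('n)" "\<And>\<gamma>. \<gamma> \<in> \<Gamma> \<Longrightarrow> v \<gamma> \<in> VS {\<gamma>}"
    and "(\<Sum>\<gamma>\<in>\<Gamma>. v \<gamma>) = 0" "\<gamma> \<in> \<Gamma>"
  shows "v \<gamma> = 0"
proof (rule eigenvectors_independent[OF assms(1) _ _ assms(4,5), where h = "\<lambda>l. 1 \<otimes> xi_gen l 0" and N = "CARD('n)"])
  show "Poly_Mapping.keys \<gamma> \<subseteq> {1..CARD('n)}" if "\<gamma> \<in> \<Gamma>" for \<gamma>
    using assms(2) that unfolding Q_plus_def by blast
qed (use assms(3) VS_eigen in blast)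

lemma VS_decompose:
  assumes "u \<in> VS \<Gamma>"
  obtains B v where "finite B" "B \<subseteq> \<Gamma>" "\<And>\<gamma>. v \<gamma> \<in> VS {\<gamma>}" "\<And>\<gamma>. \<gamma> \<notin> B \<Longrightarrow> v \<gamma> = 0"
    "u = (\<Sum>\<gamma>\<in>B. v \<gamma>)"
proof -
  have "\<exists>B v. finite B \<and> B \<subseteq> \<Gamma> \<and> (\<forall>\<gamma>. v \<gamma> \<in> VS {\<gamma>}) \<and> (\<forall>\<gamma>. \<gamma> \<notin> B \<longrightarrow> v \<gamma> = 0) \<and> u = (\<Sum>\<gamma>\<in>B. v \<gamma>)"
    using assms
  proof (induction rule: VS_induct)
    case (tensor x y \<gamma>)
    then show ?case
      by (intro exI[of _ "{\<gamma>}"] exI[of _ "\<lambda>\<delta>. if \<delta> = \<gamma> then x \<otimes> y else 0"])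
        (auto simp: VS_zero VS_tensor)
  next
    case zero
    show ?case by (intro exI[of _ "{}"] exI[of _ "\<lambda>_. 0"]) (simp add: VS_zero)
  next
    case (add a b)
    then obtain B v B' v' where
      1: "finite B" "B \<subseteq> \<Gamma>" "\<And>\<gamma>. v \<gamma> \<in> VS {\<gamma>}" "\<And>\<gamma>. \<gamma> \<notin> B \<Longrightarrow> v \<gamma> = 0" "a = (\<Sum>\<gamma>\<in>B. v \<gamma>)" and
      2: "finite B'" "B' \<subseteq> \<Gamma>" "\<And>\<gamma>. v' \<gamma> \<in> VS {\<gamma>}" "\<And>\<gamma>. \<gamma> \<notin> B' \<Longrightarrow> v' \<gamma> = 0" "b = (\<Sum>\<gamma>\<in>B'. v' \<gamma>)"
      by blast
    have "a = (\<Sum>\<gamma>\<in>B \<union> B'. v \<gamma>)" "b = (\<Sum>\<gamma>\<in>B \<union> B'. v' \<gamma>)"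
      unfolding 1(5) 2(5) using 1 2 by (auto intro!: sum.mono_neutral_left)
    then have "a + b = (\<Sum>\<gamma>\<in>B \<union> B'. v \<gamma> + v' \<gamma>)" by (simp add: sum.distrib)
    then show ?case using 1 2
      by (intro exI[of _ "B \<union> B'"] exI[of _ "\<lambda>\<gamma>. v \<gamma> + v' \<gamma>"]) (auto simp: VS_add)
  next
    case (scale c a)
    then obtain B v where
      "finite B" "B \<subseteq> \<Gamma>" "\<And>\<gamma>. v \<gamma> \<in> VS {\<gamma>}" "\<And>\<gamma>. \<gamma> \<notin> B \<Longrightarrow> v \<gamma> = 0" "a = (\<Sum>\<gamma>\<in>B. v \<gamma>)"
      by blast
    then show ?case
      by (intro exI[of _ B] exI[of _ "\<lambda>\<gamma>. c *\<^sub>C v \<gamma>"]) (auto simp: VS_scale cvs.scale_sum_right)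
  qed
  then show thesis using that by blast
qed


section \<open>Local nilpotency\<close>

definition ad_nilpotent :: "'a::complex_algebra_1 \<Rightarrow> 'a \<Rightarrow> bool" where
  "ad_nilpotent f y \<longleftrightarrow> (\<exists>k. (bracket f ^^ k) y = 0)"

lemma funpow_bracket_zero: "(bracket f ^^ k) 0 = 0"
  by (induction k) simp_all

lemma funpow_bracket_add: "(bracket f ^^ k) (x + y) = (bracket f ^^ k) x + (bracket f ^^ k) y"
  by (induction k) (simp_all add: bracket_add_right)

lemma funpow_bracket_mono: "(bracket f ^^ k) x = 0 \<Longrightarrow> k \<le> l \<Longrightarrow> (bracket f ^^ l) x = 0"
  by (metis funpow_add funpow_bracket_zero le_add_diff_inverse2 o_apply)

lemma ad_nilpotent_zero: "ad_nilpotent f 0"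
  unfolding ad_nilpotent_def by (rule exI[of _ 0]) simp

lemma ad_nilpotent_add: "ad_nilpotent f x \<Longrightarrow> ad_nilpotent f y \<Longrightarrow> ad_nilpotent f (x + y)"
  unfolding ad_nilpotent_def
proof (elim exE)
  fix k l assume "(bracket f ^^ k) x = 0" "(bracket f ^^ l) y = 0"
  then have "(bracket f ^^ max k l) (x + y) = 0"
    using funpow_bracket_mono[of k f x "max k l"] funpow_bracket_mono[of l f y "max k l"]
    by (simp add: funpow_bracket_add)
  then show "\<exists>k. (bracket f ^^ k) (x + y) = 0" ..
qed

lemma ad_nilpotent_scale: "ad_nilpotent f x \<Longrightarrow> ad_nilpotent f (c *\<^sub>C x)"
proof -
  have "(bracket f ^^ k) (c *\<^sub>C x) = c *\<^sub>C (bracket f ^^ k) x" for k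
    by (induction k) (simp_all add: bracket_scaleC_right)
  then show "ad_nilpotent f x \<Longrightarrow> ad_nilpotent f (c *\<^sub>C x)"
    unfolding ad_nilpotent_def by auto
qed

lemma ad_nilpotent_step: "ad_nilpotent f (bracket f x) \<Longrightarrow> ad_nilpotent f x"
  unfolding ad_nilpotent_def
proof (elim exE)
  fix k assume "(bracket f ^^ k) (bracket f x) = 0"
  then have "(bracket f ^^ Suc k) x = 0" by (simp only: funpow_Suc_right o_apply)
  then show "\<exists>k. (bracket f ^^ k) x = 0" ..
qed

text \<open>By the Leibniz rule, ad f applied to x y gives two products, in each of which one of the
  nilpotency exponents has dropped.\<close>

lemma ad_nilpotent_mult_aux:
  "(bracket f ^^ k) x = 0 \<Longrightarrow> (bracket f ^^ l) y = 0 \<Longrightarrow> ad_nilpotent f (x * y)"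
proof (induction "k + l" arbitrary: k l x y rule: less_induct)
  case less
  show ?case
  proof (cases "k = 0 \<or> l = 0")
    case True
    then show ?thesis using less.prems by (auto simp: ad_nilpotent_zero)
  next
    case False
    then obtain k' l' where k: "k = Suc k'" "l = Suc l'" by (meson not0_implies_Suc)
    have "(bracket f ^^ k') (bracket f x) = 0" "(bracket f ^^ l') (bracket f y) = 0"
      using less.prems unfolding k by (simp_all only: funpow_Suc_right o_apply)
    then have "ad_nilpotent f (bracket f x * y)" "ad_nilpotent f (x * bracket f y)"
      using less.hyps[of k' l "bracket f x" y] less.hyps[of k l' x "bracket f y"] less.prems k by simp_all
    then have "ad_nilpotent f (bracket f (x * y))"
      unfolding bracket_mult_right by (rule ad_nilpotent_add)
    then show ?thesis by (rule ad_nilpotent_step)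
  qed
qed

lemma ad_nilpotent_mult: "ad_nilpotent f x \<Longrightarrow> ad_nilpotent f y \<Longrightarrow> ad_nilpotent f (x * y)"
  unfolding ad_nilpotent_def using ad_nilpotent_mult_aux unfolding ad_nilpotent_def by blast

lemma ad_nilpotent_diff: "ad_nilpotent f x \<Longrightarrow> ad_nilpotent f y \<Longrightarrow> ad_nilpotent f (x - y)"
  using ad_nilpotent_add[OF _ ad_nilpotent_scale[of f y "- 1"]] by fastforce

lemma ad_nilpotent_bracket: "ad_nilpotent f x \<Longrightarrow> ad_nilpotent f y \<Longrightarrow> ad_nilpotent f (bracket x y)"
  unfolding bracket_def by (intro ad_nilpotent_diff ad_nilpotent_mult)

lemma ad_nilpotent_step': "ad_nilpotent f (bracket x f) \<Longrightarrow> ad_nilpotent f x"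
  using ad_nilpotent_step[of f x] ad_nilpotent_scale[of f "bracket x f" "- 1"] bracket_anti[of f x] by simp

text \<open>The elements killed by a power of ad f form a subalgebra, so generators suffice. Mode 0
  follows from the defining and Serre relations, the elements \<open>xi_shifted j\<close> raise
  modes, and \<xi>_{j,m} is a bracket of root vectors.\<close>

lemma x_minus_ad_nilpotent:
  fixes y :: "'n::finite yangian"
  assumes l: "l \<in> {1..CARD('n)}"
  shows "ad_nilpotent (x_gen Minus l 0) y"
proof -
  let ?f = "x_gen Minus l 0 :: 'n yangian"
  let ?N = "ad_nilpotent ?f"
  have f: "?N ?f" by (rule ad_nilpotent_step) (simp add: ad_nilpotent_zero)
  have "x_gen Minus l 1 * ?f - ?f * x_gen Minus l 1 + (x_gen Minus l 1 * ?f - ?f * x_gen Minus l 1)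
      = - (?f * ?f) + - (?f * ?f)"
    using x_x_step[OF l l, of Minus 0 0] by (simp add: bracket_def algebra_simps)
  from half_eq[OF this] have "bracket (x_gen Minus l 1) ?f = (- 1) *\<^sub>C (?f * ?f)"
    by (simp add: bracket_def)
  then have f1: "?N (x_gen Minus l 1)"
    using ad_nilpotent_step'[of ?f "x_gen Minus l 1"] ad_nilpotent_scale[OF ad_nilpotent_mult[OF f f], of "- 1"] by simp
  have xi0: "?N (xi_gen j 0)" if "j \<in> {1..CARD('n)}" for j
    by (rule ad_nilpotent_step') (simp only: xi_zero_x[OF that l] ad_nilpotent_scale f)
  have xi1: "?N (xi_gen j 1)" if j: "j \<in> {1..CARD('n)}" for j
  proof (rule ad_nilpotent_step')
    have "bracket (xi_gen j 1) ?f = bracket (xi_gen j 0) (x_gen Minus l 1)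
        + (pm_sgn Minus * ycartan j l / 2) *\<^sub>C (xi_gen j 0 * ?f + ?f * xi_gen j 0)"
      using xi_x_step[OF j l, of 0 Minus 0] by (simp only: One_nat_def diff_eq_eq add.commute)
    then show "?N (bracket (xi_gen j 1) ?f)"
      using xi0[OF j] f f1
      by (simp only:) (intro ad_nilpotent_add ad_nilpotent_scale ad_nilpotent_mult ad_nilpotent_bracket)
  qed
  have t: "?N (xi_shifted j)" if "j \<in> {1..CARD('n)}" for j
    unfolding xi_shifted_def using xi0[OF that] xi1[OF that]
    by (intro ad_nilpotent_diff ad_nilpotent_scale ad_nilpotent_mult)
  have x: "?N (x_gen s j m)" if "?N (x_gen s j 0)" "j \<in> {1..CARD('n)}" for s j m
  proof (induction m)
    case (Suc m)
    have "?N (bracket (xi_shifted j) (x_gen s j m))" using t[OF that(2)] Suc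
        by (rule ad_nilpotent_bracket)
    then have "?N ((2 * pm_sgn s) *\<^sub>C x_gen s j (Suc m))"
        by (simp add: bracket_xi_shifted[OF that(2)])
    from ad_nilpotent_scale[OF this, of "1 / (2 * pm_sgn s)"] show ?case
      by (cases s) (simp_all add: scaleC_scaleC)
  qed (rule that)
  have x0: "?N (x_gen s j 0)" if j: "j \<in> {1..CARD('n)}" for s j
  proof (cases s)
    case Plus
    show ?thesis unfolding Plus
      by (rule ad_nilpotent_step') (auto simp: x_plus_x_minus[OF j l] xi0[OF l] ad_nilpotent_zero)
  next
    case Minus
    show ?thesis
    proof (cases "j = l")
      case False
      then show ?thesis using serre[OF l j, of Minus] Minus by (auto simp: ad_nilpotent_def)
    qed (simp add: Minus f)
  qed
  have xi: "?N (xi_gen j m)" if j: "j \<in> {1..CARD('n)}" for j m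
  proof -
    have "xi_gen j m = bracket (x_gen Plus j m) (x_gen Minus j 0 :: 'n yangian)"
      using x_plus_x_minus[OF j j, of m 0] by simp
    then show ?thesis using x[OF x0[OF j] j] by (simp add: ad_nilpotent_bracket)
  qed
  show ?thesis
  proof (induction y rule: yangian_induct)
    case one
    show ?case by (rule ad_nilpotent_step) (simp add: ad_nilpotent_zero)
  qed (blast intro: x x0 xi ad_nilpotent_add ad_nilpotent_mult ad_nilpotent_scale)+
qed

lemma x_minus_ad_nilpotent_tensor:
  fixes u :: "'n::finite yangian2"
  assumes l: "l \<in> {1..CARD('n)}"
  shows "ad_nilpotent (x_gen Minus l 0 \<otimes> 1) u"
proof (induction u rule: tensor_induct)
  case (tensor x y)
  have "(bracket (x_gen Minus l 0 \<otimes> 1) ^^ k) (x \<otimes> y) = (bracket (x_gen Minus l 0) ^^ k) x \<otimes> y" for k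
    by (induction k) (simp_all add: bracket_tensor)
  then show ?case using x_minus_ad_nilpotent[OF l, of x] unfolding ad_nilpotent_def
    by (metis tensor_zero_left)
qed (rule ad_nilpotent_add)

text \<open>For u_k = (ad f)^k v one has [e, u_(k+1)] = (k+1) (\<mu> - k) u_k, and the scalar never
  vanishes for \<mu> < 0. Hence u_k = 0 for some k descends to v = 0.\<close>

lemma highest_weight_negative_zero:
  fixes e f h v :: "'a::complex_algebra_1"
  assumes ef: "bracket e f = h" and hf: "bracket h f = (- 2) *\<^sub>C f"
    and ev: "bracket e v = 0" and hv: "bracket h v = of_int \<mu> *\<^sub>C v" and "\<mu> < 0"
    and nil: "ad_nilpotent f v"
  shows "v = 0"
proof -
  define u where "u k = (bracket f ^^ k) v" for k
  have u: "u (Suc k) = bracket f (u k)" for k by (simp add: u_def)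
  have h: "bracket h (u k) = (of_int \<mu> - 2 * of_nat k) *\<^sub>C u k" for k
  proof (induction k)
    case 0
    show ?case using hv by (simp add: u_def)
  next
    case (Suc k)
    have "bracket h (u (Suc k)) = (of_int \<mu> - 2 * of_nat k - 2) *\<^sub>C u (Suc k)"
      unfolding u bracket_jacobi[of h] hf Suc by (simp add: bracket_simps cvs.scale_left_diff_distrib)
    then show ?case by (simp add: algebra_simps)
  qed
  have e: "bracket e (u (Suc k)) = (of_nat (Suc k) * (of_int \<mu> - of_nat k)) *\<^sub>C u k" for k
  proof (induction k)
    case 0
    show ?case using h[of 0] ev unfolding u bracket_jacobi[of e] ef by (simp add: u_def)
  next
    case (Suc k)
    have "bracket e (u (Suc (Suc k)))
        = (of_int \<mu> - 2 * of_nat (Suc k) + of_nat (Suc k) * (of_int \<mu> - of_nat k)) *\<^sub>C u (Suc k)"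
      unfolding u[of "Suc k"] bracket_jacobi[of e] ef h Suc
      by (simp add: bracket_scaleC_right scaleC_add_left u[of k])
    then show ?case by (simp add: algebra_simps)
  qed
  have "u k = 0 \<Longrightarrow> v = 0" for k
  proof (induction k)
    case (Suc k)
    have "(of_nat (Suc k) * (of_int \<mu> - of_nat k) :: complex) = of_int (int (Suc k) * (\<mu> - int k))"
      by simp
    moreover have "int (Suc k) * (\<mu> - int k) \<noteq> 0" using \<open>\<mu> < 0\<close> by simp
    ultimately have "(of_nat (Suc k) * (of_int \<mu> - of_nat k) :: complex) \<noteq> 0"
      by (metis of_int_eq_0_iff)
    moreover have "(of_nat (Suc k) * (of_int \<mu> - of_nat k)) *\<^sub>C u k = 0"
      using e[of k] Suc.prems by simp
    ultimately have "u k = 0" by (metis cvs.scale_eq_0_iff)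
    then show ?case by (rule Suc.IH)
  qed (simp add: u_def)
  then show ?thesis using nil unfolding ad_nilpotent_def u_def by blast
qed


section \<open>Uniqueness\<close>

lemma invariant_lower_zero:
  fixes K :: "'n::finite yangian2"
  assumes K: "K \<in> VS (Q_pos CARD('n))"
    and x: "\<And>l. l \<in> {1..CARD('n)} \<Longrightarrow> bracket (x_gen Plus l 0 \<otimes> 1 + 1 \<otimes> x_gen Plus l 0) K = 0"
    and xi: "\<And>l. l \<in> {1..CARD('n)} \<Longrightarrow> bracket (xi_gen l 0 \<otimes> 1 + 1 \<otimes> xi_gen l 0) K = 0"
  shows "K = 0"
proof -
  obtain B v where B: "finite B" "B \<subseteq> Q_pos CARD('n)" and v: "\<And>\<gamma>. v \<gamma> \<in> VS {\<gamma>}" "\<And>\<gamma>. \<gamma> \<notin> B \<Longrightarrow> v \<gamma> = 0"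
    and Kv: "K = (\<Sum>\<gamma>\<in>B. v \<gamma>)"
    using VS_decompose[OF K] by metis
  have BQ: "B \<subseteq> Q_plus CARD('n)" using B by (auto simp: Q_pos_def)
  \<comment> \<open>\<open>K\<close> has total weight 0, so the component with second weight
    \<gamma> has first weight -\<gamma>.\<close>
  have xi_v: "bracket (xi_gen l 0 \<otimes> 1) (v \<gamma>) = of_int (- root_pairing CARD('n) l \<gamma>) *\<^sub>C v \<gamma>"
    if l: "l \<in> {1..CARD('n)}" and \<gamma>: "\<gamma> \<in> B" for l \<gamma>
  proof -
    let ?h = "xi_gen l 0 \<otimes> 1 + 1 \<otimes> xi_gen l 0 :: 'n yangian2"
    have "?h \<in> VS {0}" by (intro VS_add VS_left VS_tensor[OF Y_wt_xi]) simp
    then have "bracket ?h (v \<gamma>) \<in> VS {\<gamma>}" for \<gamma>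
      using v(1)[of \<gamma>] by (rule VS_bracket) simp
    note wt = this
    have "bracket ?h (v \<gamma>) = 0"
    proof (rule VS_independent[where v = "\<lambda>\<gamma>. bracket ?h (v \<gamma>)", OF B(1) BQ wt _ \<gamma>])
      show "(\<Sum>\<gamma>\<in>B. bracket ?h (v \<gamma>)) = 0"
        unfolding bracket_sum_right[symmetric] Kv[symmetric] by (rule xi[OF l])
    qed
    then have "bracket (xi_gen l 0 \<otimes> 1) (v \<gamma>) = - bracket (1 \<otimes> xi_gen l 0) (v \<gamma>)"
      by (simp only: bracket_add_left add_eq_0_iff2)
    then show ?thesis
      unfolding VS_eigen[OF l v(1)[of \<gamma>]] by (simp only: of_int_minus cvs.scale_minus_left)
  qed
  have x_v: "bracket (x_gen Plus l 0 \<otimes> 1) (v \<gamma>)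
      + bracket (1 \<otimes> x_gen Plus l 0) (v (\<gamma> - simple_root l)) = 0"
    if l: "l \<in> {1..CARD('n)}" and \<gamma>: "\<gamma> \<in> B" for l \<gamma>
  proof -
    let ?e = "x_gen Plus l 0 :: 'n yangian" and ?\<alpha> = "simple_root l"
    \<comment> \<open>The index set also contains the weights raised by the simple root, so that
      both sums below recover all of \<open>K\<close>.\<close>
    let ?\<Gamma> = "B \<union> (\<lambda>\<gamma>. \<gamma> + ?\<alpha>) ` B"
    show ?thesis
    proof (rule VS_independent[where \<Gamma> = ?\<Gamma> and v = "\<lambda>\<gamma>. bracket (?e \<otimes> 1) (v \<gamma>) + bracket (1 \<otimes> ?e) (v (\<gamma> - ?\<alpha>))"])
      show "finite ?\<Gamma>" using B by simp
      show "?\<Gamma> \<subseteq> Q_plus CARD('n)"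
        using BQ Q_plus_add[OF _ Q_plus_simple_root[OF l]] by blast
      show "bracket (?e \<otimes> 1) (v \<gamma>) + bracket (1 \<otimes> ?e) (v (\<gamma> - ?\<alpha>)) \<in> VS {\<gamma>}" for \<gamma>
      proof (rule VS_add)
        show "bracket (?e \<otimes> 1) (v \<gamma>) \<in> VS {\<gamma>}" by (rule VS_bracket[OF VS_left v(1)]) simp
        have "1 \<otimes> ?e \<in> VS {?\<alpha>}" using Y_wt_x[OF l, of Plus 0] by (intro VS_tensor) auto
        then show "bracket (1 \<otimes> ?e) (v (\<gamma> - ?\<alpha>)) \<in> VS {\<gamma>}"
          using v(1)[of "\<gamma> - ?\<alpha>"] by (rule VS_bracket) simp
      qed
      have s1: "(\<Sum>\<gamma>\<in>?\<Gamma>. v \<gamma>) = K"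
        unfolding Kv using B v(2) by (intro sum.mono_neutral_right) auto
      have s2: "(\<Sum>\<gamma>\<in>?\<Gamma>. v (\<gamma> - ?\<alpha>)) = K"
      proof -
        have "(\<Sum>\<gamma>\<in>?\<Gamma>. v (\<gamma> - ?\<alpha>)) = (\<Sum>\<gamma>\<in>(\<lambda>\<gamma>. \<gamma> + ?\<alpha>) ` B. v (\<gamma> - ?\<alpha>))"
        proof (rule sum.mono_neutral_right)
          show "\<forall>\<gamma>\<in>?\<Gamma> - (\<lambda>\<gamma>. \<gamma> + ?\<alpha>) ` B. v (\<gamma> - ?\<alpha>) = 0"
          proof
            fix \<gamma> assume "\<gamma> \<in> ?\<Gamma> - (\<lambda>\<gamma>. \<gamma> + ?\<alpha>) ` B"
            then have "\<gamma> - ?\<alpha> \<notin> B" by (metis DiffD2 diff_add_cancel image_eqI)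
            then show "v (\<gamma> - ?\<alpha>) = 0" by (rule v(2))
          qed
        qed (use B in auto)
        then show ?thesis by (simp add: sum.reindex inj_on_def Kv)
      qed
      show "(\<Sum>\<gamma>\<in>?\<Gamma>. bracket (?e \<otimes> 1) (v \<gamma>) + bracket (1 \<otimes> ?e) (v (\<gamma> - ?\<alpha>))) = 0"
        unfolding sum.distrib bracket_sum_right[symmetric] s1 s2 bracket_add_left[symmetric]
        by (rule x[OF l])
      show "\<gamma> \<in> ?\<Gamma>" using \<gamma> by simp
    qed
  qed
  define height where "height \<gamma> = (\<Sum>j=1..CARD('n). nat (coweight_pairing j \<gamma>))" for \<gamma> :: weight
  have "v \<gamma> = 0" for \<gamma>
  proof (induction "height \<gamma>" arbitrary: \<gamma> rule: less_induct)
    case less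
    show ?case
    proof (cases "\<gamma> \<in> B")
      case False
      then show ?thesis by (rule v(2))
    next
      case True
      then have \<gamma>: "\<gamma> \<in> Q_plus CARD('n)" "\<gamma> \<noteq> 0" using B by (auto simp: Q_pos_def)
      have ev: "bracket (x_gen Plus l 0 \<otimes> 1) (v \<gamma>) = 0" if l: "l \<in> {1..CARD('n)}" for l
      proof -
        have "v (\<gamma> - simple_root l) = 0"
        proof (cases "\<gamma> - simple_root l \<in> B")
          case inB: True
          then have "0 \<le> coweight_pairing l (\<gamma> - simple_root l)"
            using BQ Q_plus_nonneg by blast
          then have "1 \<le> coweight_pairing l \<gamma>" by (simp add: lookup_minus)
          then have "height (\<gamma> - simple_root l) < height \<gamma>"
            unfolding height_def using l
            by (intro sum_strict_mono_ex1 bexI[of _ l] ballI) (auto simp: lookup_minus lookup_single when_def)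
          then show ?thesis by (rule less)
        qed (rule v(2))
        then show ?thesis using x_v[OF l True] by simp
      qed
      have "\<exists>j. coweight_pairing j \<gamma> \<noteq> coweight_pairing j 0"
        using \<gamma>(2) by (metis poly_mapping_eqI)
      then obtain j where j: "coweight_pairing j \<gamma> \<noteq> coweight_pairing j 0" ..
      then have "coweight_pairing j \<gamma> > 0" "j \<in> {1..CARD('n)}"
        using Q_plus_nonneg[OF \<gamma>(1), of j] Q_plus_outside[OF \<gamma>(1), of j] by auto
      \<comment> \<open>For this l the first factors of \<open>v \<gamma>\<close> have negative
        weight under the corresponding sl_2, although they are annihilated by its raising
        operator.\<close>
      then obtain l where l: "l \<in> {1..CARD('n)}" "root_pairing CARD('n) l \<gamma> > 0"
        using root_pairing_pos by metis
      show ?thesis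
      proof (rule highest_weight_negative_zero)
        show "bracket (x_gen Plus l 0 \<otimes> 1) (x_gen Minus l 0 \<otimes> 1) = (xi_gen l 0 \<otimes> 1 :: 'n yangian2)"
          using x_plus_x_minus[where ?'n = 'n, OF l(1) l(1), of 0 0] by (simp add: bracket_tensor)
        show "bracket (xi_gen l 0 \<otimes> 1) (x_gen Minus l 0 \<otimes> 1)
            = (- 2) *\<^sub>C (x_gen Minus l 0 \<otimes> 1 :: 'n yangian2)"
          using xi_zero_x[where ?'n = 'n, OF l(1) l(1), of Minus 0] by (simp add: bracket_tensor tensor_simps)
        show "bracket (xi_gen l 0 \<otimes> 1) (v \<gamma>) = of_int (- root_pairing CARD('n) l \<gamma>) *\<^sub>C v \<gamma>"
          by (rule xi_v[OF l(1) True])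
        show "ad_nilpotent (x_gen Minus l 0 \<otimes> 1) (v \<gamma>)"
            by (rule x_minus_ad_nilpotent_tensor[OF l(1)])
      qed (use ev l in auto)
    qed
  qed
  then show ?thesis by (simp add: Kv)
qed

context yangian_node
begin

lemma D_intertwine_nth:
  "D $ 0 * \<Delta> (xp i 0) = \<Delta> (xp i 0) * D $ 0"
  "D $ Suc m * \<Delta> (xp i 0) - D $ m * \<Delta> (xp i 1) = \<Delta> (xp i 0) * D $ Suc m"
proof -
  have *: "(D * (fps_const (\<Delta> (xp i 0)) - fps_const (\<Delta> (xp i 1)) * fps_X)) $ m
      = (fps_const (\<Delta> (xp i 0)) * D) $ m" for m
    unfolding D_intertwine ..
  show "D $ 0 * \<Delta> (xp i 0) = \<Delta> (xp i 0) * D $ 0"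
    using *[of 0] by simp
  show "D $ Suc m * \<Delta> (xp i 0) - D $ m * \<Delta> (xp i 1) = \<Delta> (xp i 0) * D $ Suc m"
    using *[of "Suc m"] by (simp add: right_diff_distrib flip: mult.assoc)
qed

lemma coproduct_S_nth: "\<Delta> (S i $ m) = D $ m"
proof -
  define K where "K m = \<Delta> (S i $ m) - D $ m" for m
  note hom = algebra_homD[OF \<Delta>_algebra_hom]
  have xi: "bracket (xi_gen l 0 \<otimes> 1 + 1 \<otimes> xi_gen l 0) (K m) = 0" if l: "l \<in> {1..CARD('n)}" for l m
  proof -
    have "bracket (xi_gen l 0) (S i $ m) = 0" by (rule bracket_eq_0_sym[OF xi_commute_S[OF l]])
    then have "bracket (\<Delta> (xi_gen l 0)) (\<Delta> (S i $ m)) = 0" by (simp only: hom(9)[symmetric] hom(5))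
    moreover have "bracket (\<Delta> (xi_gen l 0)) (D $ m) = 0"
      using arg_cong[OF D_commute_xi[OF l], of "\<lambda>F. F $ m"] by (simp add: bracket_def)
    ultimately show ?thesis by (simp add: K_def bracket_diff_right \<Delta>_xi0[OF l])
  qed
  have x: "bracket (xp l 0 \<otimes> 1 + 1 \<otimes> xp l 0) (K m) = 0" if l: "l \<in> {1..CARD('n)}" "l \<noteq> i" for l m
  proof -
    have "bracket (xp l 0) (S i $ m) = 0" by (rule bracket_eq_0_sym[OF S_commute_x[OF A S i l]])
    then have "bracket (\<Delta> (xp l 0)) (\<Delta> (S i $ m)) = 0" by (simp only: hom(9)[symmetric] hom(5))
    moreover have "bracket (\<Delta> (xp l 0)) (D $ m) = 0"
      using arg_cong[OF D_commute_x[OF l], of "\<lambda>F. F $ m"] by (simp add: bracket_def)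
    ultimately show ?thesis by (simp add: K_def bracket_diff_right \<Delta>_x0[OF l(1)])
  qed
  have zero: "K m = 0" if "bracket (\<Delta> (xp i 0)) (K m) = 0" for m
  proof (rule invariant_lower_zero)
    show "K m \<in> VS (Q_pos CARD('n))" unfolding K_def by (rule difference_lower)
    show "bracket (xp l 0 \<otimes> 1 + 1 \<otimes> xp l 0) (K m) = 0" if "l \<in> {1..CARD('n)}" for l
      using x[OF that] \<open>bracket (\<Delta> (xp i 0)) (K m) = 0\<close> \<Delta>_x0[OF i, of Plus] by (cases "l = i") simp_all
  qed (rule xi)
  have "K m = 0"
  proof (induction m)
    case 0
    have "S i $ 0 = 1" using S i unfolding S_series_def by blast
    then have "bracket (\<Delta> (xp i 0)) (K 0) = 0"
      using D_intertwine_nth(1) by (simp add: K_def bracket_diff_right hom) (simp add: bracket_def)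
    then show ?case by (rule zero)
  next
    case (Suc m)
    have "\<Delta> (S i $ Suc m) * \<Delta> (xp i 0) - \<Delta> (S i $ m) * \<Delta> (xp i 1) = \<Delta> (xp i 0) * \<Delta> (S i $ Suc m)"
      using arg_cong[OF S_exchange_x[OF A S i, of m 0], of \<Delta>] by (simp add: hom)
    then have "K (Suc m) * \<Delta> (xp i 0) - K m * \<Delta> (xp i 1) = \<Delta> (xp i 0) * K (Suc m)"
      using D_intertwine_nth(2)[of m] by (simp add: K_def algebra_simps)
    \<comment> \<open>The term with \<open>K m\<close> vanishes by induction, and the intertwining
      relation becomes a commutation relation.\<close>
    then have "bracket (\<Delta> (xp i 0)) (K (Suc m)) = 0"
      using Suc by (simp add: bracket_def)
    then show ?case by (rule zero)
  qed
  then show ?thesis by (simp add: K_def)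
qed

lemma coproduct_S: "fps_map \<Delta> (S i) = SR * T * SL"
  by (simp add: fps_eq_iff coproduct_S_nth flip: D_def)

end


section \<open>Theta series\<close>

text \<open>A sum over an infinite set is 0 by convention, so the graded product is meaningful only
  with this. The coefficients of \<gamma> lie between 0 and those of \<beta>.\<close>

lemma finite_Q_plus_decompositions:
  "finite {(\<gamma>, \<delta>). \<gamma> \<in> Q_plus N \<and> \<delta> \<in> Q_plus N \<and> \<gamma> + \<delta> = \<beta>}"
proof -
  let ?P = "{(\<gamma>, \<delta>). \<gamma> \<in> Q_plus N \<and> \<delta> \<in> Q_plus N \<and> \<gamma> + \<delta> = \<beta>}"
  let ?B = "insert 0 (\<Union>j\<in>{1..N}. {0..coweight_pairing j \<beta>})"
  let ?F = "{f :: nat \<Rightarrow> int. \<forall>j. (j \<in> {1..N} \<longrightarrow> f j \<in> ?B) \<and> (j \<notin> {1..N} \<longrightarrow> f j = 0)}"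
  have "finite ?F" by (rule finite_set_of_finite_funs) auto
  moreover have "(\<lambda>p. Poly_Mapping.lookup (fst p)) ` ?P \<subseteq> ?F"
  proof clarify
    fix \<gamma> \<delta> assume *: "\<gamma> \<in> Q_plus N" "\<delta> \<in> Q_plus N" "\<beta> = \<gamma> + \<delta>"
    have "coweight_pairing j \<gamma> \<in> {0..coweight_pairing j (\<gamma> + \<delta>)}" for j
      using Q_plus_nonneg[OF *(1), of j] Q_plus_nonneg[OF *(2), of j] by (simp add: lookup_add)
    then show "(j \<in> {1..N} \<longrightarrow> coweight_pairing j (fst (\<gamma>, \<delta>)) \<in> insert 0 (\<Union>j\<in>{1..N}. {0..coweight_pairing j (\<gamma> + \<delta>)}))
        \<and> (j \<notin> {1..N} \<longrightarrow> coweight_pairing j (fst (\<gamma>, \<delta>)) = 0)" for j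
      using Q_plus_outside[OF *(1), of j] by (metis UN_iff fst_conv insertI2)
  qed
  moreover have "inj_on (\<lambda>p. Poly_Mapping.lookup (fst p)) ?P"
    by (auto simp: inj_on_def lookup_inject)
  ultimately show ?thesis by (metis (no_types, lifting) finite_subset inj_on_finite)
qed

lemma graded_mult_finite_support:
  fixes F G :: "weight \<Rightarrow> 'a::ring_1"
  assumes F: "finite A" "A \<subseteq> Q_plus N" "\<And>\<gamma>. \<gamma> \<notin> A \<Longrightarrow> F \<gamma> = 0"
    and G: "finite B" "B \<subseteq> Q_plus N" "\<And>\<gamma>. \<gamma> \<notin> B \<Longrightarrow> G \<gamma> = 0"
  shows "graded_mult N F G \<beta> = (\<Sum>(\<gamma>, \<delta>)\<in>{p \<in> A \<times> B. fst p + snd p = \<beta>}. F \<gamma> * G \<delta>)"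
  unfolding graded_mult_def
proof (rule sum.mono_neutral_right[OF finite_Q_plus_decompositions])
  show "{p \<in> A \<times> B. fst p + snd p = \<beta>} \<subseteq> {(\<gamma>, \<delta>). \<gamma> \<in> Q_plus N \<and> \<delta> \<in> Q_plus N \<and> \<gamma> + \<delta> = \<beta>}"
    using F G by auto
  show "\<forall>p\<in>{(\<gamma>, \<delta>). \<gamma> \<in> Q_plus N \<and> \<delta> \<in> Q_plus N \<and> \<gamma> + \<delta> = \<beta>} - {p \<in> A \<times> B. fst p + snd p = \<beta>}.
      (case p of (\<gamma>, \<delta>) \<Rightarrow> F \<gamma> * G \<delta>) = 0"
    using F(3) G(3) by force
qed

text \<open>Collapsing the grading turns the graded product into the ordinary one; \<open>C\<close>
  is a finite set containing its support.\<close>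

lemma sum_graded_mult:
  fixes F G :: "weight \<Rightarrow> 'a::ring_1"
  assumes F: "finite A" "A \<subseteq> Q_plus N" "\<And>\<gamma>. \<gamma> \<notin> A \<Longrightarrow> F \<gamma> = 0"
    and G: "finite B" "B \<subseteq> Q_plus N" "\<And>\<gamma>. \<gamma> \<notin> B \<Longrightarrow> G \<gamma> = 0"
  defines "C \<equiv> (\<lambda>p. fst p + snd p) ` (A \<times> B)"
  shows "(\<Sum>\<beta>\<in>C. graded_mult N F G \<beta>) = (\<Sum>\<gamma>\<in>A. F \<gamma>) * (\<Sum>\<delta>\<in>B. G \<delta>)"
    and "\<beta> \<notin> C \<Longrightarrow> graded_mult N F G \<beta> = 0"
proof -
  have eq: "graded_mult N F G \<beta> = (\<Sum>p\<in>{p \<in> A \<times> B. fst p + snd p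
      = \<beta>}. case p of (\<gamma>, \<delta>) \<Rightarrow> F \<gamma> * G \<delta>)" for \<beta>
    by (rule graded_mult_finite_support[OF F G])
  have "(\<Sum>\<beta>\<in>C. graded_mult N F G \<beta>) = (\<Sum>p\<in>A \<times> B. case p of (\<gamma>, \<delta>) \<Rightarrow> F \<gamma> * G \<delta>)"
    unfolding eq C_def by (rule sum.image_gen[symmetric]) (use F G in simp)
  then show "(\<Sum>\<beta>\<in>C. graded_mult N F G \<beta>) = (\<Sum>\<gamma>\<in>A. F \<gamma>) * (\<Sum>\<delta>\<in>B. G \<delta>)"
    by (simp add: sum_product sum.cartesian_product)
  assume "\<beta> \<notin> C"
  then have empty: "{p \<in> A \<times> B. fst p + snd p = \<beta>} = {}" unfolding C_def by blast
  show "graded_mult N F G \<beta> = 0" unfolding eq empty by simp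
qed

lemma Sum_any_subset: "finite A \<Longrightarrow> (\<And>a. a \<notin> A \<Longrightarrow> f a = 0) \<Longrightarrow> Sum_any f = (\<Sum>a\<in>A. f a)"
  by (rule Sum_any.expand_superset) auto

section \<open>Bigraded components of Y \<otimes> Y and cancellation of series\<close>

lemma YY_wt_subspace: "cvs.subspace (YY_wt \<beta> \<gamma>)"
  by (simp add: YY_wt_def)

lemma YY_wt_tensor: "x \<in> Y_wt \<beta> \<Longrightarrow> y \<in> Y_wt \<gamma> \<Longrightarrow> x \<otimes> y \<in> YY_wt \<beta> \<gamma>"
  unfolding YY_wt_def by (rule cvs.span_base) auto

lemma YY_wt_mult:
  assumes "u \<in> YY_wt \<beta> \<gamma>" "v \<in> YY_wt \<beta>' \<gamma>'"
  shows "u * v \<in> YY_wt (\<beta> + \<beta>') (\<gamma> + \<gamma>')"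
proof -
  note sub = cvs.subspace_0[OF YY_wt_subspace] cvs.subspace_add[OF YY_wt_subspace] cvs.subspace_scale[OF YY_wt_subspace]
  from assms(1)[unfolded YY_wt_def] show ?thesis
  proof (induction rule: cvs.span_induct_alt)
    case (step c p q)
    then obtain x y where p: "p = x \<otimes> y" "x \<in> Y_wt \<beta>" "y \<in> Y_wt \<gamma>" by blast
    from assms(2)[unfolded YY_wt_def] have "p * v \<in> YY_wt (\<beta> + \<beta>') (\<gamma> + \<gamma>')"
    proof (induction rule: cvs.span_induct_alt)
      case (step c r s)
      then show ?case using p
        by (auto simp: distrib_left mult_scaleC_right tensor_mult intro!: sub YY_wt_tensor Y_wt_mult)
    qed (simp add: sub)
    then show ?case using step by (auto simp: distrib_right mult_scaleC_left intro!: sub)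
  qed (simp add: sub)
qed

lemma YY_wt_VS: "u \<in> YY_wt \<beta> \<gamma> \<Longrightarrow> u \<in> VS {\<gamma>}"
  using cvs.span_mono[of "{x \<otimes> y | x y. x \<in> Y_wt \<beta> \<and> y \<in> Y_wt \<gamma>}" "{x \<otimes> y | x y \<gamma>'. \<gamma>' \<in> {\<gamma>} \<and> y \<in> Y_wt \<gamma>'}"]
  unfolding YY_wt_def VS_def by blast

lemma graded_mult_YY_wt:
  assumes "\<And>\<gamma>. F \<gamma> \<in> YY_wt (- \<gamma>) \<gamma>" "\<And>\<gamma>. G \<gamma> \<in> YY_wt (- \<gamma>) \<gamma>"
  shows "graded_mult N F G \<beta> \<in> YY_wt (- \<beta>) \<beta>"
  unfolding graded_mult_def
proof (rule cvs.subspace_sum[OF YY_wt_subspace])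
  fix p assume "p \<in> {(\<gamma>, \<delta>). \<gamma> \<in> Q_plus N \<and> \<delta> \<in> Q_plus N \<and> \<gamma> + \<delta> = \<beta>}"
  then obtain \<gamma> \<delta> where p: "p = (\<gamma>, \<delta>)" "\<beta> = \<gamma> + \<delta>" by auto
  have "- \<gamma> + - \<delta> = - \<beta>" using p by simp
  then show "(case p of (\<gamma>, \<delta>) \<Rightarrow> F \<gamma> * G \<delta>) \<in> YY_wt (- \<beta>) \<beta>"
    using YY_wt_mult[OF assms(1)[of \<gamma>] assms(2)[of \<delta>]] p by simp
qed

lemma fps_mult_left_cancel:
  fixes F G :: "'a::ring_1 fps"
  assumes "F $ 0 = 1" "F * G = F * G'"
  shows "G = G'"
proof -
  have "F * (G - G') = 0" using assms(2) by (simp add: right_diff_distrib)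
  moreover have "(G - G') $ m = 0" if "F * (G - G') = 0" for m
  proof (induction m rule: less_induct)
    case (less m)
    have "0 = (F * (G - G')) $ m" using that by simp
    also have "\<dots> = (\<Sum>k\<in>{0}. F $ k * (G - G') $ (m - k))"
      unfolding fps_mult_nth using less by (intro sum.mono_neutral_right) auto
    finally show ?case using assms(1) by simp
  qed
  ultimately have "G - G' = 0" by (simp add: fps_eq_iff)
  then show ?thesis by simp
qed

lemma fps_mult_right_cancel:
  fixes F G :: "'a::ring_1 fps"
  assumes "F $ 0 = 1" "G * F = G' * F"
  shows "G = G'"
proof -
  have "(G - G') * F = 0" using assms(2) by (simp add: left_diff_distrib)
  moreover have "(G - G') $ m = 0" if "(G - G') * F = 0" for m
  proof (induction m rule: less_induct)
    case (less m)
    have "0 = ((G - G') * F) $ m" using that by simp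
    also have "\<dots> = (\<Sum>k\<in>{m}. (G - G') $ k * F $ (m - k))"
      unfolding fps_mult_nth using less by (intro sum.mono_neutral_right) auto
    finally show ?case using assms(1) by simp
  qed
  ultimately have "G - G' = 0" by (simp add: fps_eq_iff)
  then show ?thesis by simp
qed

context yangian_node
begin

abbreviation Ec :: "weight \<Rightarrow> 'n yangian2" where "Ec \<equiv> E_components \<iota> i"
abbreviation P :: "nat \<Rightarrow> weight \<Rightarrow> 'n yangian2" where "P \<equiv> graded_pow CARD('n) Ec"

text \<open>The positive roots containing \<alpha>_i. Each contains it with coefficient 1.\<close>

definition roots :: "weight set" where
  "roots = (\<lambda>(j, k). root_sum j k) ` ({1..i} \<times> {Suc i..Suc CARD('n)})"

lemma roots: "finite roots" "roots \<subseteq> Q_plus CARD('n)" "\<gamma> \<in> roots \<Longrightarrow> coweight_pairing i \<gamma> = 1"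
proof -
  show "finite roots" by (simp add: roots_def)
  show "roots \<subseteq> Q_plus CARD('n)"
  proof
    fix \<gamma> assume "\<gamma> \<in> roots"
    then obtain j k where "\<gamma> = root_sum j k" "j \<in> {1..i}" "k \<in> {Suc i..Suc CARD('n)}"
      by (auto simp: roots_def)
    then show "\<gamma> \<in> Q_plus CARD('n)"
      using root_sum_Q_pos[of j k "CARD('n)"] by (simp add: Q_pos_def)
  qed
  show "coweight_pairing i \<gamma> = 1" if \<gamma>: "\<gamma> \<in> roots"
  proof -
    obtain j k where "\<gamma> = root_sum j k" "j \<in> {1..i}" "k \<in> {Suc i..Suc CARD('n)}"
      using \<gamma> by (auto simp: roots_def)
    then show ?thesis unfolding \<open>\<gamma> = root_sum j k\<close> lookup_root_sum by simp
  qed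
qed

lemma Ec_eq: "Ec \<beta> = (\<Sum>p\<in>{p \<in> {1..i} \<times> {Suc i..Suc CARD('n)}. (\<lambda>(j, k). root_sum j k) p = \<beta>}.
    (\<lambda>(j, k). E k j \<otimes> E j k) p)"
  unfolding E_components_def by (rule sum.cong) auto

lemma Ec_outside: "\<beta> \<notin> roots \<Longrightarrow> Ec \<beta> = 0"
  unfolding Ec_eq roots_def by (rule sum.neutral) auto

lemma sum_Ec: "(\<Sum>\<beta>\<in>roots. Ec \<beta>) = E_sum \<iota> i"
proof -
  have "E_sum \<iota> i = (\<Sum>p\<in>{1..i} \<times> {Suc i..Suc CARD('n)}. (\<lambda>(j, k). E k j \<otimes> E j k) p)"
    by (simp only: E_sum_def Suc_eq_plus1)
  also have "\<dots> = (\<Sum>\<beta>\<in>roots. Ec \<beta>)"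
    unfolding Ec_eq roots_def by (rule sum.image_gen) simp
  finally show ?thesis ..
qed

lemma Ec_weight: "Ec \<beta> \<in> YY_wt (- \<beta>) \<beta>"
  unfolding Ec_eq
proof (rule cvs.subspace_sum[OF YY_wt_subspace])
  fix p assume "p \<in> {p \<in> {1..i} \<times> {Suc i..Suc CARD('n)}. (\<lambda>(j, k). root_sum j k) p = \<beta>}"
  then obtain j k where p: "p = (j, k)" "j \<in> {1..i}" "k \<in> {Suc i..Suc CARD('n)}" "root_sum j k = \<beta>"
    by auto
  then show "(\<lambda>(j, k). E k j \<otimes> E j k) p \<in> YY_wt (- \<beta>) \<beta>"
    using E_weight[of j k] YY_wt_tensor[of "E k j" "- root_sum j k" "E j k" "root_sum j k"] by simp
qed

text \<open>Every root in \<open>roots\<close> contains \<alpha>_i once, so the coefficient of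
  \<alpha>_i counts the factors in a product. The grading by powers of E can thus be recovered from
  the weight.\<close>

lemma P_support:
  "\<exists>B. finite B \<and> B \<subseteq> Q_plus CARD('n) \<and> (\<forall>\<beta>\<in>B. coweight_pairing i \<beta> = int m) \<and> (\<forall>\<beta>. \<beta> \<notin> B \<longrightarrow> P m \<beta>
      = 0)
     \<and> (\<Sum>\<beta>\<in>B. P m \<beta>) = E_sum \<iota> i ^ m"
proof (induction m)
  case 0
  show ?case by (rule exI[of _ "{0}"]) (auto simp: Q_plus_zero)
next
  case (Suc m)
  then obtain B where B: "finite B" "B \<subseteq> Q_plus CARD('n)" "\<And>\<beta>. \<beta> \<in> B \<Longrightarrow> coweight_pairing i \<beta> = int m"
    "\<And>\<beta>. \<beta> \<notin> B \<Longrightarrow> P m \<beta> = 0" "(\<Sum>\<beta>\<in>B. P m \<beta>) = E_sum \<iota> i ^ m" by blast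
  let ?C = "(\<lambda>p. fst p + snd p) ` (roots \<times> B)"
  note sum = sum_graded_mult[where F = Ec and G = "P m", OF roots(1,2) Ec_outside B(1,2,4)]
  show ?case
  proof (intro exI[of _ ?C] conjI ballI allI impI)
    show "finite ?C" using roots(1) B(1) by simp
    show "?C \<subseteq> Q_plus CARD('n)" using roots(2) B(2) by (auto intro!: Q_plus_add)
    show "coweight_pairing i \<beta> = int (Suc m)" if "\<beta> \<in> ?C" for \<beta>
      using that roots(3) B(3) by (auto simp: lookup_add)
    show "P (Suc m) \<beta> = 0" if "\<beta> \<notin> ?C" for \<beta>
      using sum(2) that by simp
    show "(\<Sum>\<beta>\<in>?C. P (Suc m) \<beta>) = E_sum \<iota> i ^ Suc m"
      using sum(1) by (simp add: sum_Ec B(5))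
  qed
qed

lemma P_zero: "\<beta> \<notin> Q_plus CARD('n) \<or> coweight_pairing i \<beta> \<noteq> int m \<Longrightarrow> P m \<beta> = 0"
  using P_support[of m] by blast

lemma P_weight: "P m \<beta> \<in> YY_wt (- \<beta>) \<beta>"
proof (induction m arbitrary: \<beta>)
  case 0
  show ?case using YY_wt_tensor[OF Y_wt_one Y_wt_one]
    by (auto simp: tensor_one cvs.subspace_0[OF YY_wt_subspace])
next
  case (Suc m)
  then show ?case by (simp add: graded_mult_YY_wt[OF Ec_weight])
qed

text \<open>At most one power of E contributes at a given weight. If the coefficient of \<alpha>_i
  is negative, \<open>nat\<close> selects the power 0, whose component vanishes there as
  well.\<close>

lemma graded_exp_eq: "graded_exp CARD('n) Ec \<beta>
    = (1 / fact (nat (coweight_pairing i \<beta>))) *\<^sub>C P (nat (coweight_pairing i \<beta>)) \<beta>"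
proof -
  have "P m \<beta> = 0" if "m \<notin> {nat (coweight_pairing i \<beta>)}" for m
    using that by (intro P_zero) auto
  then show ?thesis
    unfolding graded_exp_def by (subst Sum_any_subset[of "{nat (coweight_pairing i \<beta>)}"]) auto
qed

definition \<Omega>_component :: "weight \<Rightarrow> 'n yangian2 fps" where
  "\<Omega>_component \<beta> = Abs_fps (\<lambda>m. ((- 1) ^ m / fact m) *\<^sub>C P m \<beta>)"

lemma \<Omega>_component_eq:
  defines "k \<equiv> \<lambda>\<beta>. nat (coweight_pairing i \<beta>)"
  shows "\<Omega>_component \<beta> = fps_const ((- 1) ^ k \<beta> *\<^sub>C graded_exp CARD('n) Ec \<beta>) * fps_X ^ k \<beta>"
proof (rule fps_ext)
  fix m
  have "P m \<beta> = 0" if "m \<noteq> k \<beta>" using that by (intro P_zero) (auto simp: k_def)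
  then show "\<Omega>_component \<beta> $ m
      = (fps_const ((- 1) ^ k \<beta> *\<^sub>C graded_exp CARD('n) Ec \<beta>) * fps_X ^ k \<beta>) $ m"
    by (cases "m = k \<beta>")
      (simp_all add: \<Omega>_component_def graded_exp_eq k_def fps_X_power_mult_right_nth scaleC_scaleC)
qed

text \<open>With k the coefficient of \<alpha>_i in \<beta>, the component of exp(-E z^-1) is (-1)^k
  z^-k times that of exp(E). The normalising factor (-z)^k cancels this exactly, which is why the
  Theta series is constant in z.\<close>

lemma \<Theta>_component:
  "(- fls_X_inv) ^ nat (coweight_pairing i \<beta>) * fps_to_fls (\<Omega>_component \<beta>)
    = fls_const (graded_exp CARD('n) Ec \<beta>)"
proof -
  let ?k = "nat (coweight_pairing i \<beta>)" and ?g = "graded_exp CARD('n) Ec \<beta>"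
  have pow: "(- fls_X_inv) ^ k = fls_shift (int k) (fls_const ((- 1) ^ k) :: 'n yangian2 fls)" for k
  proof -
    have "(- fls_X_inv) ^ k = (- 1) ^ k * (fls_X_inv ^ k :: 'n yangian2 fls)"
      by (rule power_minus)
    also have "(- 1 :: 'n yangian2 fls) ^ k = fls_const ((- 1) ^ k)"
      by (induction k) (simp_all flip: fls_const_mult_const)
    finally show ?thesis
      by (simp add: fls_X_inv_power_times_conv_shift)
  qed
  have "fps_to_fls (\<Omega>_component \<beta>) = fls_const ((- 1) ^ ?k *\<^sub>C ?g) * fls_X ^ ?k"
    unfolding \<Omega>_component_eq by (simp add: fls_times_fps_to_fls fps_to_fls_power)
  moreover have "(- 1) ^ ?k * (- 1) ^ ?k *\<^sub>C ?g = ?g" by (cases "even ?k") simp_all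
  ultimately show ?thesis
    unfolding pow
    by (simp add: fls_X_power_times_conv_shift fls_shifted_times_simps)
qed

lemma SL_SR_nth_0: "SL $ 0 = 1" "SR $ 0 = 1"
  using S i unfolding S_series_def by (auto simp: SL_def SR_def tensor_one)

lemma is_theta_series_\<Omega>:
  "is_theta_series \<Delta> (S i) i (\<lambda>\<beta>. fls_const (graded_exp CARD('n) Ec \<beta>))"
  unfolding is_theta_series_def
proof (intro exI[of _ T] exI[of _ \<Omega>_component] conjI ballI allI impI ext)
  show "T $ 0 = 1" by (simp add: T_def fps_exponential_linear_nth)
  show "fps_map \<Delta> (S i) = fps_map (\<lambda>y. 1 \<otimes> y) (S i) * T * fps_map (\<lambda>y. y \<otimes> 1) (S i)"
    using coproduct_S by (simp add: SL_def SR_def)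
  show "\<Omega>_component \<beta> $ m \<in> YY_wt (- \<beta>) \<beta>" for \<beta> m
    by (simp add: \<Omega>_component_def cvs.subspace_scale[OF YY_wt_subspace] P_weight)
  show "\<Omega>_component \<beta> = 0" if "\<beta> \<notin> Q_plus CARD('n)" for \<beta>
    using that P_zero by (simp add: fps_eq_iff \<Omega>_component_def)
  fix m
  obtain B where B: "finite B" "\<And>\<beta>. \<beta> \<notin> B \<Longrightarrow> P m \<beta> = 0" "(\<Sum>\<beta>\<in>B. P m \<beta>) = E_sum \<iota> i ^ m"
    using P_support[of m] by blast
  have zero: "\<Omega>_component \<beta> $ m = 0" if "\<beta> \<notin> B" for \<beta>
    using B(2)[OF that] by (simp add: \<Omega>_component_def)
  then show "finite {\<beta>. \<Omega>_component \<beta> $ m \<noteq> 0}"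
    by (intro finite_subset[OF _ B(1)]) blast
  have "Sum_any (\<lambda>\<beta>. \<Omega>_component \<beta> $ m) = (\<Sum>\<beta>\<in>B. \<Omega>_component \<beta> $ m)"
    by (rule Sum_any_subset[OF B(1) zero])
  also have "\<dots> = T $ m"
    by (simp add: \<Omega>_component_def T_def fps_exponential_linear_nth B(3) flip: cvs.scale_sum_right)
  finally show "T $ m = Sum_any (\<lambda>\<beta>. \<Omega>_component \<beta> $ m)" ..
qed (rule \<Theta>_component[symmetric])

text \<open>\<open>SL\<close> and \<open>SR\<close> have constant term 1 and can be cancelled, which
  makes \<Omega>_i unique. Its components are then unique because already their second weights
  separate them.\<close>

lemma theta_series_unique:
  assumes "is_theta_series \<Delta> (S i) i \<Theta>" "is_theta_series \<Delta> (S i) i \<Theta>'"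
  shows "\<Theta> = \<Theta>'"
proof -
  from assms(1)[unfolded is_theta_series_def, folded SL_def SR_def]
  obtain W F where "W $ 0 = 1 \<and> fps_map \<Delta> (S i) = SR * W * SL \<and>
      (\<forall>\<beta>\<in>Q_plus CARD('n). \<forall>m. F \<beta> $ m \<in> YY_wt (- \<beta>) \<beta>) \<and> (\<forall>\<beta>. \<beta> \<notin> Q_plus CARD('n) \<longrightarrow> F \<beta> = 0) \<and>
      (\<forall>m. finite {\<beta>. F \<beta> $ m \<noteq> 0} \<and> W $ m = Sum_any (\<lambda>\<beta>. F \<beta> $ m)) \<and>
      \<Theta> = (\<lambda>\<beta>. (- fls_X_inv) ^ nat (coweight_pairing i \<beta>) * fps_to_fls (F \<beta>))"
    by (elim exE)
  then have W: "fps_map \<Delta> (S i) = SR * W * SL"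
    and F: "\<And>\<beta> m. \<beta> \<in> Q_plus CARD('n) \<Longrightarrow> F \<beta> $ m \<in> YY_wt (- \<beta>) \<beta>"
      "\<And>\<beta>. \<beta> \<notin> Q_plus CARD('n) \<Longrightarrow> F \<beta> = 0" "\<And>m. finite {\<beta>. F \<beta> $ m \<noteq> 0}"
      "\<And>m. W $ m = Sum_any (\<lambda>\<beta>. F \<beta> $ m)"
    and \<Theta>: "\<Theta> = (\<lambda>\<beta>. (- fls_X_inv) ^ nat (coweight_pairing i \<beta>) * fps_to_fls (F \<beta>))"
    by blast+
  from assms(2)[unfolded is_theta_series_def, folded SL_def SR_def]
  obtain W' F' where "W' $ 0 = 1 \<and> fps_map \<Delta> (S i) = SR * W' * SL \<and>
      (\<forall>\<beta>\<in>Q_plus CARD('n). \<forall>m. F' \<beta> $ m \<in> YY_wt (- \<beta>) \<beta>) \<and> (\<forall>\<beta>. \<beta> \<notin> Q_plus CARD('n) \<longrightarrow> F' \<beta> = 0) \<and>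
      (\<forall>m. finite {\<beta>. F' \<beta> $ m \<noteq> 0} \<and> W' $ m = Sum_any (\<lambda>\<beta>. F' \<beta> $ m)) \<and>
      \<Theta>' = (\<lambda>\<beta>. (- fls_X_inv) ^ nat (coweight_pairing i \<beta>) * fps_to_fls (F' \<beta>))"
    by (elim exE)
  then have W': "fps_map \<Delta> (S i) = SR * W' * SL"
    and F': "\<And>\<beta> m. \<beta> \<in> Q_plus CARD('n) \<Longrightarrow> F' \<beta> $ m \<in> YY_wt (- \<beta>) \<beta>"
      "\<And>\<beta>. \<beta> \<notin> Q_plus CARD('n) \<Longrightarrow> F' \<beta> = 0" "\<And>m. finite {\<beta>. F' \<beta> $ m \<noteq> 0}"
      "\<And>m. W' $ m = Sum_any (\<lambda>\<beta>. F' \<beta> $ m)"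
    and \<Theta>': "\<Theta>' = (\<lambda>\<beta>. (- fls_X_inv) ^ nat (coweight_pairing i \<beta>) * fps_to_fls (F' \<beta>))"
    by blast+
  have "SR * W = SR * W'"
    by (rule fps_mult_right_cancel[OF SL_SR_nth_0(1)]) (rule trans[OF W[symmetric] W'])
  then have WW': "W = W'" by (rule fps_mult_left_cancel[OF SL_SR_nth_0(2)])
  have "F \<beta> $ m = F' \<beta> $ m" for \<beta> m
  proof (cases "F \<beta> $ m = 0 \<and> F' \<beta> $ m = 0")
    case False
    let ?\<Gamma> = "{\<beta>. F \<beta> $ m \<noteq> 0} \<union> {\<beta>. F' \<beta> $ m \<noteq> 0}"
    have fin: "finite ?\<Gamma>" using F(3) F'(3) by blast
    have sub: "?\<Gamma> \<subseteq> Q_plus CARD('n)" using F(2) F'(2) by force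
    have wt: "F \<beta> $ m - F' \<beta> $ m \<in> VS {\<beta>}" if "\<beta> \<in> ?\<Gamma>" for \<beta>
      using that sub F(1)[of \<beta> m] F'(1)[of \<beta> m] by (blast intro: VS_diff YY_wt_VS)
    have "(\<Sum>\<beta>\<in>?\<Gamma>. F \<beta> $ m) = W $ m"
      unfolding F(4) by (rule Sum_any_subset[OF fin, symmetric]) blast
    moreover have "(\<Sum>\<beta>\<in>?\<Gamma>. F' \<beta> $ m) = W $ m"
      unfolding WW' F'(4) by (rule Sum_any_subset[OF fin, symmetric]) blast
    ultimately have "(\<Sum>\<beta>\<in>?\<Gamma>. F \<beta> $ m - F' \<beta> $ m) = 0" by (simp add: sum_subtractf)
    from VS_independent[where v = "\<lambda>\<beta>. F \<beta> $ m - F' \<beta> $ m", OF fin sub wt this]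
    have "F \<beta> $ m - F' \<beta> $ m = 0" using False by blast
    then show ?thesis by simp
  qed simp
  then have "F = F'" by (simp add: fun_eq_iff fps_eq_iff)
  then show ?thesis by (simp add: \<Theta> \<Theta>')
qed

lemma theta_series_eq:
  "theta_series \<Delta> (S i) i = (\<lambda>\<beta>. fls_const (graded_exp CARD('n) Ec \<beta>))"
  unfolding theta_series_def
  by (rule the_equality) (rule is_theta_series_\<Omega>, erule theta_series_unique[OF _ is_theta_series_\<Omega>])

end

theorem theorem3p1:
  fixes \<iota> :: "cmat \<Rightarrow> 'n::finite yangian"
    and \<Delta> :: "'n yangian \<Rightarrow> 'n yangian2"
    and A S :: "nat \<Rightarrow> 'n yangian fps"
    and i :: nat
  assumes "sl_embedding \<iota>"
    and "yangian_coproduct \<iota> \<Delta>"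
    and "GKLO_series A"
    and "S_series A S"
    and "1 \<le> i" and "i \<le> CARD('n)"
  shows "theta_series \<Delta> (S i) i
           = (\<lambda>\<beta>. fls_const (graded_exp CARD('n) (E_components \<iota> i) \<beta>)) \<and>
         fps_map \<Delta> (S i)
           = fps_map (\<lambda>y. 1 \<otimes> y) (S i) * fps_exponential (- (fps_const (E_sum \<iota> i) * fps_X))
             * fps_map (\<lambda>y. y \<otimes> 1) (S i)"
proof -
  interpret yangian_node \<iota> \<Delta> A S i
    using assms by unfold_locales auto
  show ?thesis
    using theta_series_eq coproduct_S unfolding SL_def SR_def T_def by blast
qed

end
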